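(* Let $\Omega=(a,b)\subset\mathbb{R}$ be a bounded interval, $\lambda\in\mathbb{R}$ a given constant, $V$ a real-valued potential and $T>0$. Let $\psi=\psi(x,t)$ be the exact solution on $[0,T]$ of the logarithmic Schrödinger equation with periodic boundary condition $$ i\partial_t\psi=-\Delta\psi+V\psi+\lambda\ln(|\psi|^2)\psi,\qquad \psi(\cdot,0)=\psi_0. $$ For a time step size $\tau>0$ (with $t_n=n\tau$) and a mesh size $h=(b-a)/N$ ($N$ a positive even integer), let $\psi^n\in X_N$, $n\ge0$, be the numerical solution given by the exponential wave integrator Fourier spectral (EWI-FS) method $$ \psi^{n+1}=e^{i\tau\Delta}\psi^n-i\tau\varphi_1(i\tau\Delta)P_NB(\psi^n),\quad n\ge0,\qquad \psi^0=P_N\psi_0. $$ Under the assumptions $V\in L^\infty(\Omega)$ and $\psi\in C([0,T];H^2_{\rm per}(\Omega))\cap C^1([0,T];L^2(\Omega))$, there exist $0<\tau_0,\,h_0<e^{-1}$ sufficiently small depending on $M$ and $T$, where $$ M:=\max\{\|\psi\|_{L^\infty([0,T];H^2)},\ \|\partial_t\psi\|_{L^\infty([0,T];L^2)},\ \|\psi\|_{L^\infty([0,T];L^\infty)},\ \|V\|_{L^\infty}\}, $$ such that when $0<\tau<\tau_0$, $0<h<h_0$ and $\tau|\ln\tau|\le\tilde C h^2/|\ln h|$ for some $\tilde C>0$, we have $$ \|\psi(t_n)-\psi^n\|_{L^2}\lesssim\tau|\ln\tau|^2+h^2|\ln h|,\qquad \|\psi^n\|_{H^2}\lesssim|\ln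 h|, $$ $$ \|\psi(t_n)-\psi^n\|_{H^1}\lesssim\sqrt{\tau}\,|\ln\tau|+h|\ln h|,\qquad 0\le n\le T/\tau. $$
   Context: Here $A\lesssim B$ means that there is a generic constant $C>0$, independent of the time step size $\tau$ and the mesh size $h$, such that $|A|\le CB$. The wave function $\psi$ is complex-valued and $\psi(t)$ denotes $\psi(\cdot,t)$. For $m\in\mathbb{Z}^+$, $H^m_{\rm per}(\Omega)=\{\phi\in H^m(\Omega):\phi^{(k)}(a)=\phi^{(k)}(b),\ k=0,\dots,m-1\}$. The expression $z\ln|z|^2$ is understood to be $0$ at $z=0$, and $B(\phi)=V\phi+\lambda\ln(|\phi|^2)\phi$ (pointwise); $B(\phi)\in L^2(\Omega)$ for every $\phi\in X_N$. Fourier notation: $\mu_l=\frac{2\pi l}{b-a}$; $\widehat\phi_l=\frac1{b-a}\int_a^b\phi(x)e^{-i\mu_l(x-a)}\,dx$ for $l\in\mathbb{Z}$; $\mathcal{T}_N=\{-N/2,\dots,N/2-1\}$; $X_N=\mathrm{span}\{e^{i\mu_l(x-a)}:l\in\mathcal{T}_N\}$; $P_N:L^2(\Omega)\to X_N$ is the $L^2$-projection, $(P_N\phi)(x)=\sum_{l\in\mathcal{T}_N}\widehat\phi_l e^{i\mu_l(x-a)}$. The operators $e^{it\Delta}$ and $\varphi_1(it\Delta)$ act in Fourier space: $\widehat{(e^{it\Delta}\phi)}_l=e^{-it\mu_l^2}\widehat\phi_l$ and $\widehat{(\varphi_1(it\Delta)\phi)}_l=\varphi_1(-it\mu_l^2)\widehat\phi_l$,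 where $\varphi_1(z)=(e^z-1)/z$ (with $\varphi_1(0)=1$). Equivalently, for $l\in\mathcal{T}_N$ the scheme reads $\widehat{(\psi^{n+1})}_l=e^{-i\tau\mu_l^2}\widehat{(\psi^n)}_l-i\tau\varphi_1(-i\tau\mu_l^2)\widehat{(B(\psi^n))}_l$, $\widehat{(\psi^0)}_l=\widehat{(\psi_0)}_l$. *)

theory Defs
  imports "HOL-Analysis.Analysis" "HOL-Probability.Essential_Supremum"
begin

text \<open>
  Elements of the function spaces over \<open>(a, b)\<close> are represented by arbitrary functions on the
  real line; nothing below depends on values outside \<open>(a, b)\<close> or on null sets.
\<close>

abbreviation Omega :: "real \<Rightarrow> real \<Rightarrow> real measure" where
  "Omega a b \<equiv> lebesgue_on {a<..<b}"

definition L2 :: "real \<Rightarrow> real \<Rightarrow> (real \<Rightarrow> complex) set" where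
  "L2 a b = {f. f \<in> borel_measurable (Omega a b) \<and> integrable (Omega a b) (\<lambda>x. (cmod (f x))\<^sup>2)}"

definition L2_norm :: "real \<Rightarrow> real \<Rightarrow> (real \<Rightarrow> complex) \<Rightarrow> real" where
  "L2_norm a b f = sqrt (LINT x|Omega a b. (cmod (f x))\<^sup>2)"

definition Linf_norm :: "real \<Rightarrow> real \<Rightarrow> (real \<Rightarrow> 'a::real_normed_vector) \<Rightarrow> ereal" where
  "Linf_norm a b f = esssup (Omega a b) (\<lambda>x. ereal (norm (f x)))"

definition Linf :: "real \<Rightarrow> real \<Rightarrow> (real \<Rightarrow> 'a::real_normed_vector) set" where
  "Linf a b = {f. f \<in> borel_measurable (Omega a b) \<and> Linf_norm a b f < \<infinity>}"

text \<open>
  \<open>g\<close> is the weak derivative of \<open>f\<close>; the test functions are the \<open>C\<^sup>1\<close> functions with compact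
  support in \<open>(a, b)\<close>.
\<close>

definition has_weak_deriv ::
    "real \<Rightarrow> real \<Rightarrow> (real \<Rightarrow> complex) \<Rightarrow> (real \<Rightarrow> complex) \<Rightarrow> bool" where
  "has_weak_deriv a b f g \<longleftrightarrow> f \<in> L2 a b \<and> g \<in> L2 a b \<and>
     (\<forall>\<eta>::real \<Rightarrow> real. \<eta> C1_differentiable_on UNIV \<and> closure {x. \<eta> x \<noteq> 0} \<subseteq> {a<..<b} \<longrightarrow>
        (LINT x|Omega a b. f x * of_real (deriv \<eta> x)) = - (LINT x|Omega a b. g x * of_real (\<eta> x)))"

primrec Hsob :: "real \<Rightarrow> real \<Rightarrow> nat \<Rightarrow> (real \<Rightarrow> complex) set" where
  "Hsob a b 0 = L2 a b"
| "Hsob a b (Suc m) = {f. \<exists>g\<in>Hsob a b m. has_weak_deriv a b f g}"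

text \<open>
  The weak derivative is unique up to null sets, so the choice made here is immaterial. It is
  meaningful only for functions that have a weak derivative.
\<close>

definition wderiv :: "real \<Rightarrow> real \<Rightarrow> (real \<Rightarrow> complex) \<Rightarrow> real \<Rightarrow> complex" where
  "wderiv a b f = (SOME g. has_weak_deriv a b f g)"

definition Hsob_norm :: "real \<Rightarrow> real \<Rightarrow> nat \<Rightarrow> (real \<Rightarrow> complex) \<Rightarrow> real" where
  "Hsob_norm a b m f = sqrt (\<Sum>k\<le>m. (L2_norm a b ((wderiv a b ^^ k) f))\<^sup>2)"

text \<open>The boundary values of \<open>\<phi>\<^sup>(\<^sup>k\<^sup>)\<close>, \<open>k < m\<close>, are those of its continuous representative \<open>u\<close>.\<close>

definition Hper :: "real \<Rightarrow> real \<Rightarrow> nat \<Rightarrow> (real \<Rightarrow> complex) set" where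
  "Hper a b m = {\<phi> \<in> Hsob a b m. \<forall>k<m. \<exists>u. continuous_on {a..b} u \<and>
     (AE x in Omega a b. u x = (wderiv a b ^^ k) \<phi> x) \<and> u a = u b}"

text \<open>Here \<open>\<psi> t\<close> is the function \<open>\<psi>(\<cdot>, t)\<close>.\<close>

definition C_Hper :: "real \<Rightarrow> real \<Rightarrow> nat \<Rightarrow> real \<Rightarrow> (real \<Rightarrow> real \<Rightarrow> complex) \<Rightarrow> bool" where
  "C_Hper a b m T \<psi> \<longleftrightarrow> (\<forall>t\<in>{0..T}. \<psi> t \<in> Hper a b m \<and>
     ((\<lambda>s. Hsob_norm a b m (\<lambda>x. \<psi> s x - \<psi> t x)) \<longlongrightarrow> 0) (at t within {0..T}))"

text \<open>\<open>\<psi>t\<close> is the time derivative of \<open>\<psi>\<close> in the sense of \<open>L\<^sup>2\<close>-valued functions.\<close>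

definition C1_L2 :: "real \<Rightarrow> real \<Rightarrow> real \<Rightarrow> (real \<Rightarrow> real \<Rightarrow> complex) \<Rightarrow>
    (real \<Rightarrow> real \<Rightarrow> complex) \<Rightarrow> bool" where
  "C1_L2 a b T \<psi> \<psi>t \<longleftrightarrow> (\<forall>t\<in>{0..T}. \<psi> t \<in> L2 a b \<and> \<psi>t t \<in> L2 a b \<and>
     ((\<lambda>s. L2_norm a b (\<lambda>x. (\<psi> s x - \<psi> t x) / of_real (s - t) - \<psi>t t x)) \<longlongrightarrow> 0)
       (at t within {0..T}) \<and>
     ((\<lambda>s. L2_norm a b (\<lambda>x. \<psi>t s x - \<psi>t t x)) \<longlongrightarrow> 0) (at t within {0..T}))"

definition time_Linf :: "real \<Rightarrow> (real \<Rightarrow> ereal) \<Rightarrow> ereal" where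
  "time_Linf T g = esssup (lebesgue_on {0..T}) g"

definition data_bound :: "real \<Rightarrow> real \<Rightarrow> real \<Rightarrow> (real \<Rightarrow> real) \<Rightarrow>
    (real \<Rightarrow> real \<Rightarrow> complex) \<Rightarrow> (real \<Rightarrow> real \<Rightarrow> complex) \<Rightarrow> ereal" where
  "data_bound a b T V \<psi> \<psi>t = Max {
     time_Linf T (\<lambda>t. ereal (Hsob_norm a b 2 (\<psi> t))),
     time_Linf T (\<lambda>t. ereal (L2_norm a b (\<psi>t t))),
     time_Linf T (\<lambda>t. Linf_norm a b (\<psi> t)),
     Linf_norm a b V}"

text \<open>Since the factor \<open>z\<close> vanishes at \<open>z = 0\<close>, so does \<open>Bop V \<lambda>\<close>, whatever \<open>ln 0\<close> is.\<close>

definition Bop :: "(real \<Rightarrow> real) \<Rightarrow> real \<Rightarrow> (real \<Rightarrow> complex) \<Rightarrow> real \<Rightarrow> complex" where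
  "Bop V lam \<phi> x =
     of_real (V x) * \<phi> x + of_real lam * of_real (ln ((cmod (\<phi> x))\<^sup>2)) * \<phi> x"

text \<open>
  The equation holds in \<open>L\<^sup>2\<close> for every \<open>t \<in> [0, T]\<close>; the periodic boundary condition is part of
  the membership of \<open>\<psi> t\<close> in \<open>Hper a b 2\<close>.
\<close>

definition logSE_solution :: "real \<Rightarrow> real \<Rightarrow> real \<Rightarrow> (real \<Rightarrow> real) \<Rightarrow> real \<Rightarrow>
    (real \<Rightarrow> complex) \<Rightarrow> (real \<Rightarrow> real \<Rightarrow> complex) \<Rightarrow> (real \<Rightarrow> real \<Rightarrow> complex) \<Rightarrow> bool" where
  "logSE_solution a b T V lam \<psi>0 \<psi> \<psi>t \<longleftrightarrow>
     C_Hper a b 2 T \<psi> \<and> C1_L2 a b T \<psi> \<psi>t \<and>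
     (\<forall>t\<in>{0..T}. AE x in Omega a b.
        \<i> * \<psi>t t x = - (wderiv a b ^^ 2) (\<psi> t) x + Bop V lam (\<psi> t) x) \<and>
     (AE x in Omega a b. \<psi> 0 x = \<psi>0 x)"

definition freq :: "real \<Rightarrow> real \<Rightarrow> int \<Rightarrow> real" where
  "freq a b l = 2 * pi * of_int l / (b - a)"

definition fbasis :: "real \<Rightarrow> real \<Rightarrow> int \<Rightarrow> real \<Rightarrow> complex" where
  "fbasis a b l x = exp (\<i> * of_real (freq a b l * (x - a)))"

definition fcoeff :: "real \<Rightarrow> real \<Rightarrow> (real \<Rightarrow> complex) \<Rightarrow> int \<Rightarrow> complex" where
  "fcoeff a b \<phi> l =
     (LINT x|Omega a b. \<phi> x * exp (- \<i> * of_real (freq a b l * (x - a)))) / of_real (b - a)"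

definition freqs :: "nat \<Rightarrow> int set" where
  "freqs N = {- int (N div 2)..int (N div 2) - 1}"

definition PN :: "real \<Rightarrow> real \<Rightarrow> nat \<Rightarrow> (real \<Rightarrow> complex) \<Rightarrow> real \<Rightarrow> complex" where
  "PN a b N \<phi> x = (\<Sum>l\<in>freqs N. fcoeff a b \<phi> l * fbasis a b l x)"

text \<open>
  The operator that multiplies the \<open>l\<close>-th Fourier coefficient by \<open>m l\<close>. It is only applied to
  trigonometric polynomials, for which the sum over all \<open>l\<close> has finitely many nonzero terms.
\<close>

definition fourier_mult ::
    "real \<Rightarrow> real \<Rightarrow> (int \<Rightarrow> complex) \<Rightarrow> (real \<Rightarrow> complex) \<Rightarrow> real \<Rightarrow> complex" where
  "fourier_mult a b m \<phi> x = (\<Sum>\<^sub>\<infinity>l\<in>UNIV. m l * fcoeff a b \<phi> l * fbasis a b l x)"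

definition varphi1 :: "complex \<Rightarrow> complex" where
  "varphi1 z = (if z = 0 then 1 else (exp z - 1) / z)"

definition exp_itLaplace ::
    "real \<Rightarrow> real \<Rightarrow> real \<Rightarrow> (real \<Rightarrow> complex) \<Rightarrow> real \<Rightarrow> complex" where
  "exp_itLaplace a b t = fourier_mult a b (\<lambda>l. exp (- \<i> * of_real (t * (freq a b l)\<^sup>2)))"

definition varphi1_itLaplace ::
    "real \<Rightarrow> real \<Rightarrow> real \<Rightarrow> (real \<Rightarrow> complex) \<Rightarrow> real \<Rightarrow> complex" where
  "varphi1_itLaplace a b t = fourier_mult a b (\<lambda>l. varphi1 (- \<i> * of_real (t * (freq a b l)\<^sup>2)))"

primrec ewi_fs :: "real \<Rightarrow> real \<Rightarrow> (real \<Rightarrow> real) \<Rightarrow> real \<Rightarrow> (real \<Rightarrow> complex) \<Rightarrow>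
    nat \<Rightarrow> real \<Rightarrow> nat \<Rightarrow> real \<Rightarrow> complex" where
  "ewi_fs a b V lam \<psi>0 N \<tau> 0 = PN a b N \<psi>0"
| "ewi_fs a b V lam \<psi>0 N \<tau> (Suc n) = (\<lambda>x.
     exp_itLaplace a b \<tau> (ewi_fs a b V lam \<psi>0 N \<tau> n) x
     - \<i> * of_real \<tau> *
       varphi1_itLaplace a b \<tau> (PN a b N (Bop V lam (ewi_fs a b V lam \<psi>0 N \<tau> n))) x)"

end

theory Submission
  imports Defs "HOL-Probability.Characteristic_Functions"
begin

text \<open>
  Let \<open>e\<^sup>n = P\<^sub>N \<psi>(t\<^sub>n) - \<psi>\<^sup>n\<close>. The nonlinearity \<open>z ln |z|\<^sup>2\<close> is only log-Lipschitz, and Osgood's lemma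
  alone would lose the rate; but \<open>Im (conj (z - w) (z ln |z|\<^sup>2 - w ln |w|\<^sup>2))\<close> is at most \<open>2 |z - w|\<^sup>2\<close>.
  Hence in the recursion for \<open>\<parallel>e\<^sup>n\<parallel>\<^sup>2\<close> the logarithm only multiplies the projection error
  \<open>\<psi> - P\<^sub>N \<psi> = O(h\<^sup>2)\<close>, the local error \<open>O(\<tau>\<^sup>2 |ln \<tau>|)\<close>, and the defect of replacing
  \<open>\<phi>\<^sub>1(- i \<tau> \<Delta>)\<close> by the identity. On \<open>X\<^sub>N\<close> the last is at most \<open>\<tau> (\<pi> / h)\<^sup>2\<close>, which the step size
  restriction bounds by a multiple of \<open>1 / (|ln \<tau>| |ln h|)\<close>, so this logarithm is compensated. As the
  log-Lipschitz constant also depends on the maximum norm of \<open>\<psi>\<^sup>n\<close>, an Osgood argument first shows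
  that \<open>\<parallel>e\<^sup>n\<parallel>\<close> is bounded; the discrete Gronwall lemma then gives
  \<open>\<parallel>e\<^sup>n\<parallel> = O(\<tau> |ln \<tau>| + h\<^sup>2 |ln h|)\<close>. The other norms follow from inverse inequalities on \<open>X\<^sub>N\<close>.
  The bounds for \<open>\<psi> - P\<^sub>N \<psi>\<close> need Parseval's identity, obtained from the Stone-Weierstrass
  theorem on the circle.
\<close>

section \<open>The space of square integrable functions\<close>

text \<open>The discrete error is measured against \<open>PN\<close> of the exact solution, since
  only elements of X_N can be advanced mode by mode. The one-sided bound, however, concerns the full
  difference of exact and numerical solution; the two differ by the projection error, and that is
  why the projection error meets the log-Lipschitz bound. No bound on the maximum norm of the
  numerical solution is known beforehand. The inverse inequality gives (m0 + E) / sqrt h, whose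
  logarithm is half of |ln h| plus ln (m0 + E). The first part joins the other powers of |ln h|; the
  second makes the recursion one of Osgood type. Each |ln h| is spent against a small factor: h^2
  |ln h| at the projection error, \<tau> |ln h| / h^2 \<le> Ct at the defect of \<phi>1, \<tau> |ln
  h|^2 \<le> Ct in the square of the nonlinear difference. The last one leaves a term \<tau> ln (m0
  + E)^2, which is why the discrete lemma admits a squared logarithm with an additional factor
  \<tau>. The constant Ct of the step size restriction may be arbitrary, because it only enters the
  constant of the recursion.\<close>

lemma L2_measurable [measurable_dest]: "f \<in> L2 a b \<Longrightarrow> f \<in> borel_measurable (Omega a b)"
  by (simp add: L2_def)

lemma L2_integrable_square: "f \<in> L2 a b \<Longrightarrow> integrable (Omega a b) (\<lambda>x. (cmod (f x))\<^sup>2)"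
  by (simp add: L2_def)

lemma emeasure_Omega_finite: "emeasure (Omega a b) (space (Omega a b)) < \<infinity>"
  by (cases "a \<le> b") (auto simp: emeasure_restrict_space)

lemma finite_measure_Omega: "finite_measure (Omega a b)"
  using emeasure_Omega_finite[of a b] by (intro finite_measureI) (auto simp del: space_lebesgue_on)

lemma integrable_Omega_bounded:
  fixes f :: "real \<Rightarrow> 'a::{banach, second_countable_topology}"
  assumes "f \<in> borel_measurable (Omega a b)" "AE x in Omega a b. norm (f x) \<le> B"
  shows "integrable (Omega a b) f"
  using assms finite_measure.integrable_const_bound[OF finite_measure_Omega] by blast

lemma L2_bounded:
  assumes "f \<in> borel_measurable (Omega a b)" "AE x in Omega a b. cmod (f x) \<le> B"
  shows "f \<in> L2 a b"
proof -
  have "AE x in Omega a b. norm ((cmod (f x))\<^sup>2) \<le> B\<^sup>2"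
    using assms(2) by eventually_elim (simp add: power_mono)
  then show ?thesis
    unfolding L2_def using assms(1) by (auto intro!: integrable_Omega_bounded)
qed

lemma integrable_cmod_mult:
  assumes "f \<in> L2 a b" "g \<in> L2 a b"
  shows "integrable (Omega a b) (\<lambda>x. cmod (f x) * cmod (g x))"
proof (rule Bochner_Integration.integrable_bound)
  show "integrable (Omega a b) (\<lambda>x. (cmod (f x))\<^sup>2 + (cmod (g x))\<^sup>2)"
    using assms by (intro Bochner_Integration.integrable_add L2_integrable_square)
  show "(\<lambda>x. cmod (f x) * cmod (g x)) \<in> borel_measurable (Omega a b)"
    using assms by measurable
  have "cmod (f x) * cmod (g x) \<le> (cmod (f x))\<^sup>2 + (cmod (g x))\<^sup>2" for x
    using sum_squares_bound[of "cmod (f x)" "cmod (g x)"]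
      mult_nonneg_nonneg[OF norm_ge_zero[of "f x"] norm_ge_zero[of "g x"]] by linarith
  then show "AE x in Omega a b. norm (cmod (f x) * cmod (g x)) \<le> norm ((cmod (f x))\<^sup>2 + (cmod (g x))\<^sup>2)"
    by simp
qed

lemma integrable_L2_mult:
  assumes "f \<in> L2 a b" "g \<in> L2 a b"
  shows "integrable (Omega a b) (\<lambda>x. f x * g x)"
proof (rule Bochner_Integration.integrable_bound[OF integrable_cmod_mult[OF assms]])
  show "(\<lambda>x. f x * g x) \<in> borel_measurable (Omega a b)"
    using assms by measurable
qed (simp add: norm_mult)

lemma L2_const: "(\<lambda>x. c) \<in> L2 a b"
  by (rule L2_bounded[where B="cmod c"]) auto

lemma integrable_L2: "f \<in> L2 a b \<Longrightarrow> integrable (Omega a b) f"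
  using integrable_L2_mult[OF _ L2_const[of 1]] by simp

lemma L2_add:
  assumes "f \<in> L2 a b" "g \<in> L2 a b"
  shows "(\<lambda>x. f x + g x) \<in> L2 a b"
proof -
  have m: "(\<lambda>x. f x + g x) \<in> borel_measurable (Omega a b)"
    using assms by measurable
  have i: "integrable (Omega a b) (\<lambda>x. (cmod (f x))\<^sup>2 + 2 * (cmod (f x) * cmod (g x)) + (cmod (g x))\<^sup>2)"
    using assms by (intro Bochner_Integration.integrable_add L2_integrable_square
        integrable_cmod_mult integrable_mult_right)
  have "(cmod (f x + g x))\<^sup>2 \<le> (cmod (f x))\<^sup>2 + 2 * (cmod (f x) * cmod (g x)) + (cmod (g x))\<^sup>2" for x
    using power_mono[OF norm_triangle_ineq[of "f x" "g x"], of 2] by (simp add: power2_sum)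
  then have "integrable (Omega a b) (\<lambda>x. (cmod (f x + g x))\<^sup>2)"
    using m by (intro Bochner_Integration.integrable_bound[OF i]) (auto intro!: AE_I2 order_trans[OF _ abs_ge_self])
  then show ?thesis using m by (simp add: L2_def)
qed

lemma L2_mult_bounded:
  assumes f: "f \<in> L2 a b" and g: "g \<in> borel_measurable (Omega a b)" "AE x in Omega a b. cmod (g x) \<le> B"
  shows "(\<lambda>x. g x * f x) \<in> L2 a b"
proof -
  have m: "(\<lambda>x. g x * f x) \<in> borel_measurable (Omega a b)"
    using f g by measurable
  have i: "integrable (Omega a b) (\<lambda>x. B\<^sup>2 * (cmod (f x))\<^sup>2)"
    using f by (intro integrable_mult_right L2_integrable_square)
  have "AE x in Omega a b. norm ((cmod (g x * f x))\<^sup>2) \<le> norm (B\<^sup>2 * (cmod (f x))\<^sup>2)"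
    using g(2) by eventually_elim (simp add: norm_mult power_mult_distrib mult_right_mono power_mono)
  then have "integrable (Omega a b) (\<lambda>x. (cmod (g x * f x))\<^sup>2)"
    using m by (intro Bochner_Integration.integrable_bound[OF i]) auto
  then show ?thesis using m by (simp add: L2_def)
qed

lemma L2_cmult: "f \<in> L2 a b \<Longrightarrow> (\<lambda>x. c * f x) \<in> L2 a b"
  by (rule L2_mult_bounded[where B="cmod c"]) auto

lemma L2_diff: "f \<in> L2 a b \<Longrightarrow> g \<in> L2 a b \<Longrightarrow> (\<lambda>x. f x - g x) \<in> L2 a b"
  using L2_add[OF _ L2_cmult[of g a b "-1"], of f] by simp

lemma L2_cnj: "f \<in> L2 a b \<Longrightarrow> (\<lambda>x. cnj (f x)) \<in> L2 a b"
  unfolding L2_def using borel_measurable_continuous_onI[OF continuous_on_cnj[OF continuous_on_id], simplified]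
  by (auto intro: measurable_compose)

lemma L2_sum: "finite A \<Longrightarrow> (\<And>i. i \<in> A \<Longrightarrow> f i \<in> L2 a b) \<Longrightarrow> (\<lambda>x. \<Sum>i\<in>A. f i x) \<in> L2 a b"
proof (induction A rule: finite_induct)
  case empty
  then show ?case using L2_const[of 0 a b] by simp
qed (simp add: L2_add)

lemma L2_norm_nonneg [simp]: "0 \<le> L2_norm a b f"
  by (simp add: L2_norm_def)

lemma L2_norm_square: "(L2_norm a b f)\<^sup>2 = (LINT x|Omega a b. (cmod (f x))\<^sup>2)"
  by (simp add: L2_norm_def)

lemma L2_norm_cong_AE:
  assumes "f \<in> L2 a b" "g \<in> L2 a b" "AE x in Omega a b. f x = g x"
  shows "L2_norm a b f = L2_norm a b g"
proof -
  have "(LINT x|Omega a b. (cmod (f x))\<^sup>2) = (LINT x|Omega a b. (cmod (g x))\<^sup>2)"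
  proof (rule integral_cong_AE)
    show "AE x in Omega a b. (cmod (f x))\<^sup>2 = (cmod (g x))\<^sup>2"
      using assms(3) by eventually_elim simp
  qed (use assms in measurable)
  then show ?thesis by (simp add: L2_norm_def)
qed

lemma L2_norm_mono_AE:
  assumes "f \<in> L2 a b" "g \<in> L2 a b" "AE x in Omega a b. cmod (f x) \<le> cmod (g x)"
  shows "L2_norm a b f \<le> L2_norm a b g"
  unfolding L2_norm_def
proof (intro real_sqrt_le_mono integral_mono_AE L2_integrable_square assms)
  show "AE x in Omega a b. (cmod (f x))\<^sup>2 \<le> (cmod (g x))\<^sup>2"
    using assms(3) by eventually_elim (simp add: power_mono)
qed

lemma L2_norm_cmult: "L2_norm a b (\<lambda>x. c * f x) = cmod c * L2_norm a b f"
  by (simp add: L2_norm_def norm_mult power_mult_distrib real_sqrt_mult)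

lemma L2_norm_const: "a < b \<Longrightarrow> L2_norm a b (\<lambda>x. c) = cmod c * sqrt (b - a)"
  by (simp add: L2_norm_def measure_restrict_space real_sqrt_mult mult.commute)

lemma L2_norm_cnj: "L2_norm a b (\<lambda>x. cnj (f x)) = L2_norm a b f"
  by (simp add: L2_norm_def)

lemma L2_norm_eq_0_AE:
  assumes "f \<in> L2 a b" "L2_norm a b f = 0"
  shows "AE x in Omega a b. f x = 0"
proof -
  have "(LINT x|Omega a b. (cmod (f x))\<^sup>2) = 0"
    using assms(2) by (metis L2_norm_square zero_power2)
  then have "AE x in Omega a b. (cmod (f x))\<^sup>2 = 0"
    using integral_nonneg_eq_0_iff_AE[OF L2_integrable_square[OF assms(1)]] by simp
  then show ?thesis by simp
qed

lemma Cauchy_Schwarz_cmod: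
  assumes f: "f \<in> L2 a b" and g: "g \<in> L2 a b"
  shows "(LINT x|Omega a b. cmod (f x) * cmod (g x)) \<le> L2_norm a b f * L2_norm a b g"
proof (cases "L2_norm a b f = 0 \<or> L2_norm a b g = 0")
  case True
  then have "AE x in Omega a b. cmod (f x) * cmod (g x) = 0"
  proof
    assume "L2_norm a b f = 0"
    from L2_norm_eq_0_AE[OF f this] show ?thesis by eventually_elim simp
  next
    assume "L2_norm a b g = 0"
    from L2_norm_eq_0_AE[OF g this] show ?thesis by eventually_elim simp
  qed
  then have "(LINT x|Omega a b. cmod (f x) * cmod (g x)) = 0"
    by (rule integral_eq_zero_AE)
  then show ?thesis by simp
next
  case False
  define A B where "A = L2_norm a b f" and "B = L2_norm a b g"
  have pos: "A > 0" "B > 0"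
    using False L2_norm_nonneg[of a b f] L2_norm_nonneg[of a b g] by (simp_all add: A_def B_def less_le)
  \<comment> \<open>With these weights Young's inequality is sharp after integration: each summand
    contributes half of \<open>A * B\<close>.\<close>
  let ?h = "\<lambda>x. (B / A) / 2 * (cmod (f x))\<^sup>2 + (A / B) / 2 * (cmod (g x))\<^sup>2"
  have "cmod (f x) * cmod (g x) \<le> ?h x" for x
  proof -
    have "0 \<le> (B * cmod (f x) - A * cmod (g x))\<^sup>2" by simp
    then have "2 * A * B * (cmod (f x) * cmod (g x)) \<le> B\<^sup>2 * (cmod (f x))\<^sup>2 + A\<^sup>2 * (cmod (g x))\<^sup>2"
      by (simp add: power2_diff power_mult_distrib mult_ac)
    then show ?thesis using pos by (simp add: field_simps power2_eq_square)
  qed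
  moreover have i: "integrable (Omega a b) (\<lambda>x. (B / A) / 2 * (cmod (f x))\<^sup>2)"
      "integrable (Omega a b) (\<lambda>x. (A / B) / 2 * (cmod (g x))\<^sup>2)"
    by (intro integrable_mult_right L2_integrable_square f g)+
  ultimately have "(LINT x|Omega a b. cmod (f x) * cmod (g x)) \<le> (LINT x|Omega a b. ?h x)"
    by (intro integral_mono integrable_cmod_mult f g Bochner_Integration.integrable_add)
  also have "\<dots> = (B / A) / 2 * A\<^sup>2 + (A / B) / 2 * B\<^sup>2"
    unfolding Bochner_Integration.integral_add[OF i] by (simp add: A_def B_def L2_norm_square)
  also have "\<dots> = A * B"
    using pos by (simp add: field_simps power2_eq_square)
  finally show ?thesis by (simp add: A_def B_def)
qed

lemma Cauchy_Schwarz_L2: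
  assumes "f \<in> L2 a b" "g \<in> L2 a b"
  shows "cmod (LINT x|Omega a b. f x * g x) \<le> L2_norm a b f * L2_norm a b g"
proof -
  have "cmod (LINT x|Omega a b. f x * g x) \<le> (LINT x|Omega a b. cmod (f x * g x))"
    by (rule integral_norm_bound)
  then show ?thesis using Cauchy_Schwarz_cmod[OF assms] by (simp add: norm_mult)
qed

lemma L2_norm_add:
  assumes f: "f \<in> L2 a b" and g: "g \<in> L2 a b"
  shows "L2_norm a b (\<lambda>x. f x + g x) \<le> L2_norm a b f + L2_norm a b g"
proof -
  have i: "integrable (Omega a b) (\<lambda>x. (cmod (f x))\<^sup>2)" "integrable (Omega a b) (\<lambda>x. (cmod (g x))\<^sup>2)"
     "integrable (Omega a b) (\<lambda>x. 2 * (cmod (f x) * cmod (g x)))"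
    using assms by (intro L2_integrable_square integrable_mult_right integrable_cmod_mult; simp)+
  have "(cmod (f x + g x))\<^sup>2 \<le> (cmod (f x))\<^sup>2 + 2 * (cmod (f x) * cmod (g x)) + (cmod (g x))\<^sup>2" for x
    using power_mono[OF norm_triangle_ineq[of "f x" "g x"], of 2] by (simp add: power2_sum)
  then have "(LINT x|Omega a b. (cmod (f x + g x))\<^sup>2)
    \<le> (LINT x|Omega a b. (cmod (f x))\<^sup>2 + 2 * (cmod (f x) * cmod (g x)) + (cmod (g x))\<^sup>2)"
    using i by (intro integral_mono L2_integrable_square L2_add f g Bochner_Integration.integrable_add) auto
  also have "\<dots> = (L2_norm a b f)\<^sup>2 + 2 * (LINT x|Omega a b. cmod (f x) * cmod (g x)) + (L2_norm a b g)\<^sup>2"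
    using i by (simp add: L2_norm_square)
  also have "\<dots> \<le> (L2_norm a b f + L2_norm a b g)\<^sup>2"
    using Cauchy_Schwarz_cmod[OF f g] by (simp add: power2_sum)
  finally have "(L2_norm a b (\<lambda>x. f x + g x))\<^sup>2 \<le> (L2_norm a b f + L2_norm a b g)\<^sup>2"
    by (simp add: L2_norm_square)
  then show ?thesis by (rule power2_le_imp_le) simp
qed

lemma L2_norm_diff:
  assumes f: "f \<in> L2 a b" and g: "g \<in> L2 a b"
  shows "L2_norm a b (\<lambda>x. f x - g x) \<le> L2_norm a b f + L2_norm a b g"
  using L2_norm_add[OF f L2_cmult[OF g, of "-1"]] L2_norm_cmult[of a b "-1" g] by simp

lemma L2_norm_minus_commute: "L2_norm a b (\<lambda>x. f x - g x) = L2_norm a b (\<lambda>x. g x - f x)"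
  by (simp add: L2_norm_def norm_minus_commute)

lemma L2_norm_triangle:
  assumes f: "f \<in> L2 a b" and g: "g \<in> L2 a b"
  shows "L2_norm a b f \<le> L2_norm a b g + L2_norm a b (\<lambda>x. f x - g x)"
  using L2_norm_add[OF g L2_diff[OF f g]] by simp

lemma L2_norm_bounded:
  assumes "a < b" "f \<in> borel_measurable (Omega a b)" "AE x in Omega a b. cmod (f x) \<le> B" "0 \<le> B"
  shows "L2_norm a b f \<le> B * sqrt (b - a)"
proof -
  have "L2_norm a b f \<le> L2_norm a b (\<lambda>x. of_real B)"
    using assms by (intro L2_norm_mono_AE L2_bounded[OF assms(2,3)] L2_const) auto
  then show ?thesis using assms by (simp add: L2_norm_const)
qed

text \<open>The shape of every estimate of the nonlinearity: \<open>d\<close> is the threshold below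
  which the logarithm is not resolved. Minkowski's inequality with the constant function
  \<open>d\<close> turns the pointwise bound into a bound of norms.\<close>

lemma L2_norm_affine_bound:
  assumes "a < b" and f: "f \<in> L2 a b" and g: "g \<in> L2 a b" and "0 \<le> c" "0 \<le> d"
    and le: "AE x in Omega a b. cmod (f x) \<le> c * (cmod (g x) + d)"
  shows "L2_norm a b f \<le> c * (L2_norm a b g + d * sqrt (b - a))"
proof -
  let ?G = "\<lambda>x. complex_of_real (cmod (g x))"
  have G: "?G \<in> L2 a b" and nG: "L2_norm a b ?G = L2_norm a b g"
    using g by (auto simp: L2_def L2_norm_def)
  have s: "(\<lambda>x. ?G x + of_real d) \<in> L2 a b" by (intro L2_add G L2_const)
  have "L2_norm a b f \<le> L2_norm a b (\<lambda>x. of_real c * (?G x + of_real d))"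
  proof (intro L2_norm_mono_AE f L2_cmult s)
    have *: "cmod (of_real c * (?G x + of_real d)) = c * (cmod (g x) + d)" for x
    proof -
      have "of_real c * (?G x + of_real d) = complex_of_real (c * (cmod (g x) + d))" by simp
      then show ?thesis using assms by (simp only: norm_of_real) simp
    qed
    show "AE x in Omega a b. cmod (f x) \<le> cmod (of_real c * (?G x + of_real d))"
      using le unfolding * .
  qed
  also have "\<dots> = c * L2_norm a b (\<lambda>x. ?G x + of_real d)"
    using assms by (simp add: L2_norm_cmult)
  also have "\<dots> \<le> c * (L2_norm a b g + d * sqrt (b - a))"
    using L2_norm_add[OF G L2_const[of "of_real d"]] assms
    by (intro mult_left_mono) (auto simp: L2_norm_const nG)
  finally show ?thesis .
qed

section \<open>Fourier coefficients\<close>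

lemma continuous_on_fbasis [continuous_intros]: "continuous_on A (fbasis a b l)"
  unfolding fbasis_def by (intro continuous_intros)

lemma cmod_fbasis [simp]: "cmod (fbasis a b l x) = 1"
  by (simp add: fbasis_def)

lemma cnj_fbasis: "cnj (fbasis a b l x) = fbasis a b (- l) x"
proof -
  have "cnj (fbasis a b l x) = exp (cnj (\<i> * of_real (freq a b l * (x - a))))"
    by (simp only: fbasis_def exp_cnj)
  also have "cnj (\<i> * of_real (freq a b l * (x - a))) = \<i> * of_real (freq a b (- l) * (x - a))"
    by (simp only: complex_cnj_mult complex_cnj_i complex_cnj_complex_of_real) (simp add: freq_def)
  finally show ?thesis by (simp only: fbasis_def)
qed

lemma borel_measurable_Omega_continuous:
  fixes f :: "real \<Rightarrow> 'a::{real_normed_vector, second_countable_topology}"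
  shows "continuous_on UNIV f \<Longrightarrow> f \<in> borel_measurable (Omega a b)"
  by (rule continuous_imp_measurable_on_sets_lebesgue) (auto intro: continuous_on_subset)

lemma L2_continuous:
  fixes h :: "real \<Rightarrow> complex"
  assumes "continuous_on UNIV h"
  shows "h \<in> L2 a b"
proof -
  have "compact (h ` {a..b})"
    by (intro compact_continuous_image continuous_on_subset[OF assms]) auto
  then obtain B where "\<And>x. x \<in> {a..b} \<Longrightarrow> cmod (h x) \<le> B"
    by (metis bounded_iff compact_imp_bounded imageI)
  then show ?thesis
    using assms by (intro L2_bounded[where B=B] borel_measurable_Omega_continuous) (auto intro!: AE_I2)
qed

lemma fbasis_L2 [simp]: "fbasis a b l \<in> L2 a b"
  by (intro L2_continuous continuous_on_fbasis)

lemma fbasis_0: "fbasis a b 0 x = 1"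
  by (simp add: fbasis_def freq_def)

lemma fbasis_mult: "fbasis a b l x * fbasis a b m x = fbasis a b (l + m) x"
proof -
  have "freq a b (l + m) * (x - a) = freq a b l * (x - a) + freq a b m * (x - a)"
    by (simp add: freq_def add_divide_distrib distrib_left distrib_right)
  then show ?thesis by (simp only: fbasis_def of_real_add distrib_left exp_add)
qed

lemma fbasis_left: "fbasis a b l a = 1"
  by (simp add: fbasis_def)

lemma fbasis_right:
  assumes "a < b"
  shows "fbasis a b l b = 1"
proof -
  have "freq a b l * (b - a) = 2 * pi * of_int l"
    using assms by (simp add: freq_def)
  then have "fbasis a b l b = exp (of_int (2 * l) * (of_real pi * \<i>))"
    unfolding fbasis_def by (simp add: mult_ac)
  also have "\<dots> = 1" by (subst exp_eq_1) simp
  finally show ?thesis .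
qed

lemma fbasis_has_vector_derivative:
  "(fbasis a b l has_vector_derivative \<i> * of_real (freq a b l) * fbasis a b l x) (at x within A)"
proof -
  have "((\<lambda>z. exp (\<i> * (of_real (freq a b l) * (z - of_real a)))) has_field_derivative
      \<i> * of_real (freq a b l) * exp (\<i> * (of_real (freq a b l) * (of_real x - of_real a)))) (at (of_real x))"
    by (auto intro!: derivative_eq_intros)
  from has_vector_derivative_real_field[OF this, of A] show ?thesis
    by (simp add: fbasis_def[abs_def] o_def)
qed

lemma freq_eq_0_iff: "a < b \<Longrightarrow> freq a b l = 0 \<longleftrightarrow> l = 0"
  by (simp add: freq_def)

lemma integral_Omega_continuous:
  fixes f :: "real \<Rightarrow> complex"
  assumes "continuous_on {a..b} f"
  shows "(LINT x|Omega a b. f x) = integral {a..b} f"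
proof -
  have "f absolutely_integrable_on {a..b}"
    using absolutely_integrable_continuous[of a b f] assms by simp
  then have "f absolutely_integrable_on {a<..<b}"
    by (rule set_integrable_subset) auto
  then have "integrable (Omega a b) f"
    by (simp add: set_integrable_def integrable_restrict_space)
  then have "(LINT x|Omega a b. f x) = integral {a<..<b} f"
    by (intro lebesgue_integral_eq_integral) auto
  then show ?thesis
    using integral_open_interval[of a b f] by simp
qed

lemma integral_fbasis:
  assumes "a < b"
  shows "(LINT x|Omega a b. fbasis a b l x) = (if l = 0 then of_real (b - a) else 0)"
proof (cases "l = 0")
  case True
  then show ?thesis using assms by (simp add: fbasis_0 measure_restrict_space scaleR_conv_of_real)
next
  case False
  then have nz: "\<i> * complex_of_real (freq a b l) \<noteq> 0" using freq_eq_0_iff[OF assms] by simp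
  let ?F = "\<lambda>x. fbasis a b l x / (\<i> * of_real (freq a b l))"
  have "(fbasis a b l has_integral ?F b - ?F a) {a..b}"
  proof (rule fundamental_theorem_of_calculus)
    fix x show "(?F has_vector_derivative fbasis a b l x) (at x within {a..b})"
      using has_vector_derivative_divide[OF fbasis_has_vector_derivative[of a b l x "{a..b}"], of "\<i> * of_real (freq a b l)"] nz
      by simp
  qed (use assms in simp)
  then have "integral {a..b} (fbasis a b l) = 0"
    using fbasis_left fbasis_right[OF assms] by (simp add: integral_unique)
  then show ?thesis
    using False by (simp add: integral_Omega_continuous continuous_on_fbasis)
qed

lemma fcoeff_eq: "fcoeff a b f l = (LINT x|Omega a b. f x * fbasis a b (- l) x) / of_real (b - a)"
  by (simp add: fcoeff_def fbasis_def freq_def)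

lemma fcoeff_add: "f \<in> L2 a b \<Longrightarrow> g \<in> L2 a b \<Longrightarrow>
    fcoeff a b (\<lambda>x. f x + g x) l = fcoeff a b f l + fcoeff a b g l"
  using integrable_L2_mult[of f a b "fbasis a b (- l)"] integrable_L2_mult[of g a b "fbasis a b (- l)"]
  by (simp add: fcoeff_eq distrib_right add_divide_distrib)

lemma fcoeff_cmult: "fcoeff a b (\<lambda>x. c * f x) l = c * fcoeff a b f l"
  by (simp add: fcoeff_eq mult.assoc)

lemma fcoeff_diff: "f \<in> L2 a b \<Longrightarrow> g \<in> L2 a b \<Longrightarrow>
    fcoeff a b (\<lambda>x. f x - g x) l = fcoeff a b f l - fcoeff a b g l"
  using fcoeff_add[OF _ L2_cmult[of g a b "-1"], of f l] fcoeff_cmult[of a b "-1" g l] by simp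

lemma fcoeff_cong_AE:
  assumes "f \<in> L2 a b" "g \<in> L2 a b" "AE x in Omega a b. f x = g x"
  shows "fcoeff a b f l = fcoeff a b g l"
proof -
  have "(LINT x|Omega a b. f x * fbasis a b (- l) x) = (LINT x|Omega a b. g x * fbasis a b (- l) x)"
  proof (rule integral_cong_AE)
    show "AE x in Omega a b. f x * fbasis a b (- l) x = g x * fbasis a b (- l) x"
      using assms(3) by eventually_elim simp
  qed (use assms L2_measurable[OF fbasis_L2] in measurable)
  then show ?thesis by (simp add: fcoeff_eq)
qed

lemma fcoeff_fbasis: "a < b \<Longrightarrow> fcoeff a b (fbasis a b m) l = (if l = m then 1 else 0)"
  by (simp add: fcoeff_eq fbasis_mult integral_fbasis)

lemma fcoeff_sum:
  assumes "finite A" "\<And>i. i \<in> A \<Longrightarrow> f i \<in> L2 a b"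
  shows "fcoeff a b (\<lambda>x. \<Sum>i\<in>A. f i x) l = (\<Sum>i\<in>A. fcoeff a b (f i) l)"
  using assms
proof (induction A rule: finite_induct)
  case empty
  then show ?case by (simp add: fcoeff_eq)
qed (simp add: fcoeff_add L2_sum)

text \<open>An index set together with a coefficient function on all integers, so that Fourier
  multipliers, derivatives and \<open>PN\<close> act on the coefficient function alone.\<close>

definition trig :: "real \<Rightarrow> real \<Rightarrow> int set \<Rightarrow> (int \<Rightarrow> complex) \<Rightarrow> real \<Rightarrow> complex" where
  "trig a b A c x = (\<Sum>l\<in>A. c l * fbasis a b l x)"

lemma trig_L2: "finite A \<Longrightarrow> trig a b A c \<in> L2 a b"
  unfolding trig_def[abs_def] by (intro L2_sum L2_cmult fbasis_L2)

lemma continuous_on_trig: "continuous_on S (trig a b A c)"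
  unfolding trig_def[abs_def] by (intro continuous_intros)

lemma fcoeff_trig:
  assumes "a < b" "finite A"
  shows "fcoeff a b (trig a b A c) l = (if l \<in> A then c l else 0)"
proof -
  have "fcoeff a b (trig a b A c) l = (\<Sum>i\<in>A. if l = i then c i else 0)"
    unfolding trig_def[abs_def]
    using assms
    by (subst fcoeff_sum) (auto simp: L2_cmult fcoeff_cmult fcoeff_fbasis intro!: sum.cong simp del: sum.delta sum.delta')
  then show ?thesis using assms by simp
qed

lemma PN_eq_trig: "PN a b N f = trig a b (freqs N) (fcoeff a b f)"
  by (rule ext) (simp add: PN_def trig_def)

lemma trig_diff: "trig a b A c x - trig a b A d x = trig a b A (\<lambda>l. c l - d l) x"
  by (simp add: trig_def sum_subtractf left_diff_distrib)

text \<open>Linearity and the definition of the Fourier coefficients suffice. Applied to a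
  trigonometric polynomial it is Parseval's identity; later it carries the energy estimate and the
  local error between physical and Fourier space.\<close>

lemma integral_cnj_trig_mult:
  assumes "a < b" "finite A" "f \<in> L2 a b"
  shows "(LINT x|Omega a b. cnj (trig a b A c x) * f x) = of_real (b - a) * (\<Sum>l\<in>A. cnj (c l) * fcoeff a b f l)"
proof -
  have "(LINT x|Omega a b. cnj (trig a b A c x) * f x)
      = (LINT x|Omega a b. (\<Sum>l\<in>A. cnj (c l) * (f x * fbasis a b (- l) x)))"
    by (simp add: trig_def cnj_fbasis sum_distrib_left sum_distrib_right mult_ac)
  also have "\<dots> = (\<Sum>l\<in>A. (LINT x|Omega a b. cnj (c l) * (f x * fbasis a b (- l) x)))"
    using assms by (intro Bochner_Integration.integral_sum integrable_mult_right integrable_L2_mult fbasis_L2)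
  also have "\<dots> = (\<Sum>l\<in>A. cnj (c l) * (LINT x|Omega a b. f x * fbasis a b (- l) x))"
    by simp
  also have "\<dots> = of_real (b - a) * (\<Sum>l\<in>A. cnj (c l) * fcoeff a b f l)"
    using assms(1) unfolding sum_distrib_left fcoeff_eq by (intro sum.cong) auto
  finally show ?thesis .
qed

lemma L2_norm_square_complex: "of_real ((L2_norm a b f)\<^sup>2) = (LINT x|Omega a b. cnj (f x) * f x)"
proof -
  have "(LINT x|Omega a b. cnj (f x) * f x) = (LINT x|Omega a b. complex_of_real ((cmod (f x))\<^sup>2))"
    by (intro Bochner_Integration.integral_cong refl) (metis complex_norm_square mult.commute)
  then show ?thesis by (simp add: L2_norm_square del: of_real_power)
qed

lemma L2_norm_trig:
  assumes "a < b" "finite A"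
  shows "(L2_norm a b (trig a b A c))\<^sup>2 = (b - a) * (\<Sum>l\<in>A. (cmod (c l))\<^sup>2)"
proof -
  have "complex_of_real ((L2_norm a b (trig a b A c))\<^sup>2) = of_real (b - a) * (\<Sum>l\<in>A. cnj (c l) * fcoeff a b (trig a b A c) l)"
    unfolding L2_norm_square_complex using assms by (intro integral_cnj_trig_mult trig_L2)
  also have "(\<Sum>l\<in>A. cnj (c l) * fcoeff a b (trig a b A c) l) = of_real (\<Sum>l\<in>A. (cmod (c l))\<^sup>2)"
    unfolding of_real_sum using assms
    by (intro sum.cong) (auto simp: fcoeff_trig complex_norm_square simp del: of_real_power)
  finally show ?thesis by (metis of_real_eq_iff of_real_mult)
qed

lemma L2_norm_square_add:
  assumes f: "f \<in> L2 a b" and g: "g \<in> L2 a b"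
  shows "(L2_norm a b (\<lambda>x. f x + g x))\<^sup>2
    = (L2_norm a b f)\<^sup>2 + 2 * Re (LINT x|Omega a b. cnj (f x) * g x) + (L2_norm a b g)\<^sup>2"
proof -
  have i: "integrable (Omega a b) (\<lambda>x. cnj (f x) * g x)"
    by (intro integrable_L2_mult L2_cnj f g)
  have "(cmod (f x + g x))\<^sup>2 = (cmod (f x))\<^sup>2 + 2 * Re (cnj (f x) * g x) + (cmod (g x))\<^sup>2" for x
    unfolding cmod_power2 by (simp add: power2_eq_square algebra_simps)
  then have "(L2_norm a b (\<lambda>x. f x + g x))\<^sup>2 =
      (LINT x|Omega a b. (cmod (f x))\<^sup>2 + 2 * Re (cnj (f x) * g x) + (cmod (g x))\<^sup>2)"
    by (simp add: L2_norm_square)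
  also have "\<dots> = (L2_norm a b f)\<^sup>2 + 2 * (LINT x|Omega a b. Re (cnj (f x) * g x)) + (L2_norm a b g)\<^sup>2"
    using i L2_integrable_square[OF f] L2_integrable_square[OF g]
    by (simp add: L2_norm_square del: times_complex.sel)
  also have "(LINT x|Omega a b. Re (cnj (f x) * g x)) = Re (LINT x|Omega a b. cnj (f x) * g x)"
    using i by (rule integral_Re)
  finally show ?thesis .
qed

text \<open>Completing the square in each coefficient. The choice \<open>c = fcoeff a b f\<close>
  gives Bessel's inequality and the exact projection error; a free \<open>c\<close> gives the best
  approximation property.\<close>

lemma L2_norm_diff_partial_sum:
  assumes ab: "a < b" and A: "finite A" and f: "f \<in> L2 a b"
  shows "(L2_norm a b (\<lambda>x. f x - trig a b A c x))\<^sup>2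
    = (L2_norm a b f)\<^sup>2 - (b - a) * (\<Sum>l\<in>A. (cmod (fcoeff a b f l))\<^sup>2)
      + (b - a) * (\<Sum>l\<in>A. (cmod (fcoeff a b f l - c l))\<^sup>2)"
proof -
  let ?p = "trig a b A (\<lambda>l. - c l)"
  have *: "(LINT x|Omega a b. cnj (f x) * ?p x) = cnj (of_real (b - a) * (\<Sum>l\<in>A. cnj (- c l) * fcoeff a b f l))"
  proof -
    have "(LINT x|Omega a b. cnj (f x) * ?p x) = (LINT x|Omega a b. cnj (cnj (?p x) * f x))"
      by (intro Bochner_Integration.integral_cong refl) simp
    also have "\<dots> = cnj (LINT x|Omega a b. cnj (?p x) * f x)"
      by (rule Bochner_Integration.integral_cnj)
    finally show ?thesis unfolding integral_cnj_trig_mult[OF ab A f] .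
  qed
  have "(\<lambda>x. f x - trig a b A c x) = (\<lambda>x. f x + ?p x)"
    by (simp add: trig_def sum_negf)
  then have "(L2_norm a b (\<lambda>x. f x - trig a b A c x))\<^sup>2
    = (L2_norm a b f)\<^sup>2 + 2 * Re (of_real (b - a) * (\<Sum>l\<in>A. cnj (- c l) * fcoeff a b f l))
      + (b - a) * (\<Sum>l\<in>A. (cmod (c l))\<^sup>2)"
    using L2_norm_square_add[OF f trig_L2[OF A, of a b "\<lambda>l. - c l"]] L2_norm_trig[OF ab A, of "\<lambda>l. - c l"]
    unfolding * by simp
  also have "Re (of_real (b - a) * (\<Sum>l\<in>A. cnj (- c l) * fcoeff a b f l))
      = (b - a) * (\<Sum>l\<in>A. Re (cnj (- c l) * fcoeff a b f l))"
    by (simp only: Re_complex_of_real Im_complex_of_real times_complex.sel(1) Re_sum)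
  finally show ?thesis
  proof -
    assume *: "(L2_norm a b (\<lambda>x. f x - trig a b A c x))\<^sup>2
      = (L2_norm a b f)\<^sup>2 + 2 * ((b - a) * (\<Sum>l\<in>A. Re (cnj (- c l) * fcoeff a b f l)))
      + (b - a) * (\<Sum>l\<in>A. (cmod (c l))\<^sup>2)"
    have "(cmod (fcoeff a b f l - c l))\<^sup>2 = (cmod (fcoeff a b f l))\<^sup>2 + 2 * Re (cnj (- c l) * fcoeff a b f l) + (cmod (c l))\<^sup>2" for l
      unfolding cmod_power2 by (simp add: power2_eq_square algebra_simps)
    then have "(\<Sum>l\<in>A. (cmod (fcoeff a b f l - c l))\<^sup>2) = (\<Sum>l\<in>A. (cmod (fcoeff a b f l))\<^sup>2)
       + 2 * (\<Sum>l\<in>A. Re (cnj (- c l) * fcoeff a b f l)) + (\<Sum>l\<in>A. (cmod (c l))\<^sup>2)"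
      by (simp only: sum.distrib sum_distrib_left)
    then show ?thesis unfolding * by (simp add: algebra_simps)
  qed
qed

lemma Bessel:
  assumes "a < b" "finite A" "f \<in> L2 a b"
  shows "(b - a) * (\<Sum>l\<in>A. (cmod (fcoeff a b f l))\<^sup>2) \<le> (L2_norm a b f)\<^sup>2"
  using L2_norm_diff_partial_sum[OF assms, of "fcoeff a b f"]
    zero_le_power2[of "L2_norm a b (\<lambda>x. f x - trig a b A (fcoeff a b f) x)"] by simp

section \<open>Weak derivatives\<close>

lemma sigma_finite_lebesgue: "sigma_finite_measure (lebesgue :: real measure)"
proof -
  obtain A :: "real set set" where "countable A" "A \<subseteq> sets lborel" "\<Union>A = space lborel"
      "\<forall>a\<in>A. emeasure lborel a \<noteq> \<infinity>"
    using lborel.sigma_finite_countable by blast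
  then show ?thesis
    by (intro sigma_finite_measure.intro exI[of _ A]) (auto simp: main_part_sets)
qed

text \<open>Half-lines are an intersection-stable generator of the Borel sets, and the sets over
  which \<open>D\<close> integrates to zero form a Dynkin system; \<open>total\<close> serves the
  complements. A Lebesgue set differs from a Borel set by a null set only.\<close>

lemma AE_zero_if_integrals_greaterThan_zero:
  fixes D :: "real \<Rightarrow> complex"
  assumes D: "integrable lebesgue D" and total: "(LINT y|lebesgue. D y) = 0"
    and half: "\<And>x. (LINT y:{x<..}|lebesgue. D y) = 0"
  shows "AE x in lebesgue. D x = 0"
proof -
  have si: "set_integrable lebesgue A D" if "A \<in> sets lebesgue" for A
    using that D by (simp add: set_integrable_def integrable_mult_indicator)
  have borel: "(LINT y:B|lebesgue. D y) = 0" if "B \<in> sets borel" for B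
  proof -
    let ?E = "range (\<lambda>x::real. {x<..})"
    have leb: "B \<in> sets lebesgue" if "B \<in> sigma_sets UNIV ?E" for B
    proof -
      have "B \<in> sets borel" using that unfolding borel_Ioi by simp
      then show ?thesis by simp
    qed
    have "Int_stable ?E" by (auto simp: Int_stable_def lessThan_Int_lessThan)
    moreover have "?E \<subseteq> Pow UNIV" by simp
    moreover have "B \<in> sigma_sets UNIV ?E" using that unfolding borel_Ioi by simp
    ultimately show ?thesis
    proof (induction rule: sigma_sets_induct_disjoint)
      case (basic A)
      then show ?case using half by auto
    next
      case empty
      show ?case by (simp add: set_lebesgue_integral_def)
    next
      case (compl A)
      have A: "A \<in> sets lebesgue" "UNIV - A \<in> sets lebesgue"
        using leb compl.hyps sigma_sets.Compl by blast+
      have "(LINT y:A \<union> (UNIV - A)|lebesgue. D y) = (LINT y:A|lebesgue. D y) + (LINT y:(UNIV - A)|lebesgue. D y)"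
        by (intro set_integral_Un si A) auto
      then show ?case using compl total by (simp add: set_lebesgue_integral_def)
    next
      case (union A)
      have A: "A i \<in> sets lebesgue" for i using leb union.hyps by blast
      have "(LINT y:(\<Union>i. A i)|lebesgue. D y) = (\<Sum>i. (LINT y:(A i)|lebesgue. D y))"
        using A union.hyps(1) by (intro lebesgue_integral_countable_add si) (auto simp: disjoint_family_on_def)
      then show ?case using union by simp
    qed
  qed
  have zero: "(LINT y:A|lebesgue. D y) = 0" if A: "A \<in> sets lebesgue" for A
  proof -
    from A obtain S N N' where S: "A = S \<union> N" "N \<subseteq> N'" "N' \<in> null_sets lborel" "S \<in> sets lborel"
      by (rule sets_completionE)
    have "(LINT y:A|lebesgue. D y) = (LINT y:S|lebesgue. D y)"
    proof (rule set_integral_null_delta[OF D A])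
      show "sym_diff A S \<in> null_sets lebesgue"
        by (rule null_sets_completion_subset[OF _ null_sets_completionI[OF S(3)]]) (use S in auto)
    qed (use S in simp)
    then show ?thesis using borel S by simp
  qed
  show ?thesis
    by (rule sigma_finite_measure.density_zero[OF sigma_finite_lebesgue D zero])
qed

section \<open>C1 cut-off functions\<close>

lemma eventually_nat_ge_real: "\<forall>\<^sub>F n in sequentially. C \<le> real n"
  using filterlim_real_sequentially by (simp add: filterlim_at_top)

text \<open>A quadratic spline that climbs from 0 to 1 on [0, 2]. It is C1, which is the regularity
  that \<open>has_weak_deriv\<close> asks of its test functions.\<close>

definition step :: "real \<Rightarrow> real" where
  "step x = ((max 0 x)\<^sup>2 - 2 * (max 0 (x - 1))\<^sup>2 + (max 0 (x - 2))\<^sup>2) / 2"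

text \<open>The piecewise linear bump on [0, 2] with peak 1 and integral 1, the derivative of
  \<open>step\<close>.\<close>

definition hat :: "real \<Rightarrow> real" where
  "hat x = max 0 x - 2 * max 0 (x - 1) + max 0 (x - 2)"

lemma has_real_derivative_max0_square:
  "((\<lambda>x::real. (max 0 x)\<^sup>2) has_real_derivative 2 * max 0 x) (at x)"
proof (cases x "0::real" rule: linorder_cases)
  case less
  have "((\<lambda>x. 0::real) has_real_derivative 2 * max 0 x) (at x)"
    using less by simp
  then show ?thesis
    by (rule has_field_derivative_transform_within_open[where S="{..<0}"]) (use less in auto)
next
  case greater
  have "((\<lambda>x. x\<^sup>2) has_real_derivative 2 * max 0 x) (at x)"
    using greater by (auto intro!: derivative_eq_intros)
  then show ?thesis
    by (rule has_field_derivative_transform_within_open[where S="{0<..}"]) (use greater in auto)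
next
  case equal
  \<comment> \<open>At the kink the difference quotient is at most \<open>\<bar>h\<bar>\<close>, so
    the one-sided derivatives agree there.\<close>
  have "(\<lambda>h::real. (max 0 h)\<^sup>2 / h) \<midarrow>0\<rightarrow> 0"
  proof (rule Lim_null_comparison)
    have "norm ((max 0 h)\<^sup>2 / h) \<le> \<bar>h\<bar>" for h :: real
      by (cases "h > 0") (auto simp: power2_eq_square max_def)
    then show "\<forall>\<^sub>F h in at (0::real). norm ((max 0 h)\<^sup>2 / h) \<le> \<bar>h\<bar>" by simp
    show "(\<lambda>h::real. \<bar>h\<bar>) \<midarrow>0\<rightarrow> 0" by (rule tendsto_rabs_zero) (rule tendsto_ident_at)
  qed
  then show ?thesis using equal by (simp add: DERIV_def)
qed

lemma step_has_real_derivative: "(step has_real_derivative hat x) (at x)"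
proof -
  have d: "((\<lambda>x. (max 0 (x - c))\<^sup>2) has_real_derivative 2 * max 0 (x - c)) (at x)" for c :: real
    using DERIV_shift[of "\<lambda>x. (max 0 x)\<^sup>2" "2 * max 0 (x - c)" x "- c"]
      has_real_derivative_max0_square[of "x - c"] by simp
  from DERIV_cdivide[OF DERIV_add[OF DERIV_diff[OF d[of 0] DERIV_cmult[OF d[of 1], of 2]] d[of 2]], of 2]
  show ?thesis by (simp add: step_def[abs_def] hat_def diff_divide_distrib add_divide_distrib)
qed

lemma hat_nonneg: "0 \<le> hat x" and hat_eq_0: "x \<le> 0 \<or> 2 \<le> x \<Longrightarrow> hat x = 0"
  by (auto simp: hat_def max_def)

lemma continuous_on_hat [continuous_intros]:
  "continuous_on A f \<Longrightarrow> continuous_on A (\<lambda>x. hat (f x))"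
  unfolding hat_def by (intro continuous_intros)

lemma step_eq_0: "x \<le> 0 \<Longrightarrow> step x = 0" and step_eq_1: "2 \<le> x \<Longrightarrow> step x = 1"
  by (auto simp: step_def max_def power2_eq_square algebra_simps)

lemma step_mono: "x \<le> y \<Longrightarrow> step x \<le> step y"
  using DERIV_nonneg_imp_nondecreasing[of x y step] step_has_real_derivative hat_nonneg by blast

lemma step_nonneg: "0 \<le> step x" and step_le_1: "step x \<le> 1"
  using step_mono[of "min x 0" x] step_mono[of x "max x 2"] by (auto simp: step_eq_0 step_eq_1)

text \<open>For \<open>k (d - c) \<ge> 6\<close> this is a \<open>C\<^sup>1\<close> approximation of the indicator of \<open>(c, d)\<close>, since at every
  point at least one of the two steps equals 1.\<close>

definition cutoff :: "real \<Rightarrow> real \<Rightarrow> real \<Rightarrow> real \<Rightarrow> real" where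
  "cutoff c d k x = step (k * (x - c) - 1) + step (k * (d - x) - 1) - 1"

definition dcutoff :: "real \<Rightarrow> real \<Rightarrow> real \<Rightarrow> real \<Rightarrow> real" where
  "dcutoff c d k x = k * hat (k * (x - c) - 1) - k * hat (k * (d - x) - 1)"

lemma cutoff_has_real_derivative: "(cutoff c d k has_real_derivative dcutoff c d k x) (at x)"
proof -
  have "((\<lambda>x. step (k * (x - c) - 1)) has_real_derivative hat (k * (x - c) - 1) * k) (at x)"
    by (rule DERIV_chain2[OF step_has_real_derivative]) (auto intro!: derivative_eq_intros)
  moreover have "((\<lambda>x. step (k * (d - x) - 1)) has_real_derivative hat (k * (d - x) - 1) * (- k)) (at x)"
    by (rule DERIV_chain2[OF step_has_real_derivative]) (auto intro!: derivative_eq_intros)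
  ultimately show ?thesis
    unfolding cutoff_def[abs_def] dcutoff_def by (auto intro!: derivative_eq_intros)
qed

lemma continuous_on_dcutoff [continuous_intros]: "continuous_on A (dcutoff c d k)"
  unfolding dcutoff_def[abs_def] by (intro continuous_intros)

lemma continuous_on_cutoff [continuous_intros]: "continuous_on A (cutoff c d k)"
  using cutoff_has_real_derivative by (meson DERIV_isCont continuous_at_imp_continuous_on)

lemma abs_cutoff_le_1: "\<bar>cutoff c d k x\<bar> \<le> 1"
  using step_nonneg step_le_1 unfolding cutoff_def by (smt (verit))

text \<open>The shift by 1 in the arguments of \<open>step\<close> leaves a margin of width
  \<open>1 / k\<close> at each end, which makes the support compact in the open interval. The number
  6 provides the room: where one argument is at most 0, the other is at least 4, so its step equals
  1 and cancels against the final 1.\<close>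

lemma cutoff_eq_0:
  assumes "0 < k" "6 \<le> k * (d - c)" "x \<le> c + 1 / k \<or> d - 1 / k \<le> x"
  shows "cutoff c d k x = 0"
  using assms(3)
proof
  assume "x \<le> c + 1 / k"
  then have 1: "k * (x - c) \<le> 1" using assms by (simp add: field_simps)
  moreover have "k * (d - x) = k * (d - c) - k * (x - c)" by (simp add: algebra_simps)
  ultimately show ?thesis using assms by (simp add: cutoff_def step_eq_0 step_eq_1)
next
  assume "d - 1 / k \<le> x"
  then have 1: "k * (d - x) \<le> 1" using assms by (simp add: field_simps)
  moreover have "k * (x - c) = k * (d - c) - k * (d - x)" by (simp add: algebra_simps)
  ultimately show ?thesis using assms by (simp add: cutoff_def step_eq_0 step_eq_1)
qed

lemma cutoff_tendsto_indicator:
  assumes "c < d"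
  shows "(\<lambda>n. cutoff c d (real n) x) \<longlonglongrightarrow> indicator {c<..<d} x"
proof (rule tendsto_eventually)
  show "\<forall>\<^sub>F n in sequentially. cutoff c d (real n) x = indicator {c<..<d} x"
  proof (cases "x \<in> {c<..<d}")
    case True
    \<comment> \<open>Once \<open>n * (x - c)\<close> and \<open>n * (d - x)\<close> reach 3, both
      arguments of \<open>step\<close> are at least 2: the limit is attained exactly.\<close>
    show ?thesis using eventually_nat_ge_real[of "3 / (x - c)"] eventually_nat_ge_real[of "3 / (d - x)"]
    proof eventually_elim
      case (elim n)
      then have "3 \<le> real n * (x - c)" "3 \<le> real n * (d - x)"
        using True by (simp_all add: field_simps)
      then show ?case using True by (simp add: cutoff_def step_eq_1)
    qed
  next
    case False
    show ?thesis using eventually_nat_ge_real[of "6 / (d - c)"] eventually_nat_ge_real[of 1]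
    proof eventually_elim
      case (elim n)
      then have "6 \<le> real n * (d - c)" "real n > 0" "0 \<le> 1 / real n"
        using assms by (simp_all add: field_simps)
      moreover from this False have "x \<le> c + 1 / real n \<or> d - 1 / real n \<le> x"
        by (smt (verit) greaterThanLessThan_iff)
      ultimately show ?case using False cutoff_eq_0[of "real n" d c x] by simp
    qed
  qed
qed

lemma integral_mult_cutoff_tendsto:
  fixes f :: "real \<Rightarrow> complex"
  assumes "c < d" and f: "integrable (Omega a b) f"
  shows "(\<lambda>n. LINT x|Omega a b. f x * of_real (cutoff c d (real n) x))
    \<longlonglongrightarrow> (LINT x|Omega a b. f x * indicator {c<..<d} x)"
proof (rule integral_dominated_convergence[where w="\<lambda>x. cmod (f x)"])
  have "cutoff c d k \<in> borel_measurable (Omega a b)" for k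
    by (intro borel_measurable_Omega_continuous continuous_intros)
  then show "(\<lambda>x. f x * of_real (cutoff c d (real n) x)) \<in> borel_measurable (Omega a b)" for n
    using f by measurable
  have "indicator {c<..<d} \<in> borel_measurable (Omega a b)"
    by (intro measurable_restrict_space1 borel_measurable_indicator) simp
  then show "(\<lambda>x. f x * indicator {c<..<d} x) \<in> borel_measurable (Omega a b)"
    using f by measurable
  show "AE x in Omega a b. (\<lambda>n. f x * of_real (cutoff c d (real n) x)) \<longlonglongrightarrow> f x * indicator {c<..<d} x"
  proof (intro AE_I2 tendsto_mult tendsto_const)
    fix x
    have "(\<lambda>n. complex_of_real (cutoff c d (real n) x)) \<longlonglongrightarrow> of_real (indicator {c<..<d} x)"
      by (intro tendsto_of_real cutoff_tendsto_indicator assms)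
    then show "(\<lambda>n. complex_of_real (cutoff c d (real n) x)) \<longlonglongrightarrow> indicator {c<..<d} x"
      by (auto simp: indicator_def)
  qed
  show "AE x in Omega a b. norm (f x * of_real (cutoff c d (real n) x)) \<le> cmod (f x)" for n
    using abs_cutoff_le_1 by (auto simp: norm_mult intro!: AE_I2 mult_right_le_one_le)
qed (use f in simp)

section \<open>Calculus of weak derivatives\<close>

lemma has_weak_derivD:
  fixes \<eta> :: "real \<Rightarrow> real"
  assumes "has_weak_deriv a b f g" "\<eta> C1_differentiable_on UNIV" "closure {x. \<eta> x \<noteq> 0} \<subseteq> {a<..<b}"
  shows "(LINT x|Omega a b. f x * of_real (deriv \<eta> x)) = - (LINT x|Omega a b. g x * of_real (\<eta> x))"
  using assms by (simp add: has_weak_deriv_def)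

text \<open>Applies the definition to a test function with an explicit derivative; the margin
  \<open>\<delta>\<close> places the closure of its support inside the open interval.\<close>

lemma weak_deriv_test:
  assumes w: "has_weak_deriv a b f g"
    and d: "\<And>x. (\<eta> has_real_derivative \<eta>' x) (at x)" and c: "continuous_on UNIV \<eta>'"
    and "0 < \<delta>" and supp: "\<And>x. x \<le> a + \<delta> \<or> b - \<delta> \<le> x \<Longrightarrow> \<eta> x = 0"
  shows "(LINT x|Omega a b. f x * of_real (\<eta>' x)) = - (LINT x|Omega a b. g x * of_real (\<eta> x))"
proof -
  have 1: "\<eta> C1_differentiable_on UNIV"
    unfolding C1_differentiable_on_def using d c
    by (metis has_real_derivative_iff_has_vector_derivative)
  have "closure {x. \<eta> x \<noteq> 0} \<subseteq> {a + \<delta>..b - \<delta>}"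
    using supp by (intro closure_minimal) (auto, meson linear, meson linear)
  then have 2: "closure {x. \<eta> x \<noteq> 0} \<subseteq> {a<..<b}" using \<open>0 < \<delta>\<close> by fastforce
  have "deriv \<eta> = \<eta>'" using d by (auto intro: DERIV_imp_deriv)
  then show ?thesis using has_weak_derivD[OF w 1 2] by simp
qed

lemma has_weak_deriv_L2: "has_weak_deriv a b f g \<Longrightarrow> f \<in> L2 a b" "has_weak_deriv a b f g \<Longrightarrow> g \<in> L2 a b"
  by (auto simp: has_weak_deriv_def)

text \<open>Testing the difference \<open>D\<close> with cut-offs of (c, b) and passing to the limit
  shows that \<open>D\<close> has integral zero over (c, b) for every c; integrals over half-lines
  determine an integrable function.\<close>

lemma has_weak_deriv_unique:
  assumes ab: "a < b" and g: "has_weak_deriv a b f g" and g': "has_weak_deriv a b f g'"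
  shows "AE x in Omega a b. g x = g' x"
proof -
  define D where "D x = g x - g' x" for x
  have D: "D \<in> L2 a b" unfolding D_def[abs_def] using g g' by (intro L2_diff has_weak_deriv_L2)
  note iD = integrable_L2[OF D]
  have zero: "(LINT x|Omega a b. D x * indicator {c<..<b} x) = 0" if c: "a \<le> c" "c < b" for c
  proof (rule LIMSEQ_unique[OF integral_mult_cutoff_tendsto[OF c(2) iD]])
    have "\<forall>\<^sub>F n in sequentially. (LINT x|Omega a b. D x * of_real (cutoff c b (real n) x)) = 0"
      using eventually_nat_ge_real[of "6 / (b - c)"] eventually_nat_ge_real[of 1]
    proof eventually_elim
      case (elim n)
      then have n: "6 \<le> real n * (b - c)" "real n > 0"
        using c by (simp_all add: field_simps)
      let ?e = "cutoff c b (real n)"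
      have e: "(LINT x|Omega a b. f x * of_real (dcutoff c b (real n) x)) = - (LINT x|Omega a b. h x * of_real (?e x))"
        if "has_weak_deriv a b f h" for h
        using that cutoff_has_real_derivative
      proof (rule weak_deriv_test[where \<delta>="1 / real n"])
        fix x assume "x \<le> a + 1 / real n \<or> b - 1 / real n \<le> x"
        then show "?e x = 0" using c by (intro cutoff_eq_0 n) auto
      qed (use n in \<open>auto intro: continuous_intros\<close>)
      have m: "(\<lambda>x. complex_of_real (?e x)) \<in> L2 a b"
        by (intro L2_bounded[where B=1] borel_measurable_Omega_continuous continuous_intros)
          (simp add: abs_cutoff_le_1)
      have "(LINT x|Omega a b. D x * of_real (?e x))
         = (LINT x|Omega a b. g x * of_real (?e x)) - (LINT x|Omega a b. g' x * of_real (?e x))"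
        unfolding D_def left_diff_distrib using g g'
        by (intro Bochner_Integration.integral_diff integrable_L2_mult m has_weak_deriv_L2)
      then show ?case using e[OF g] e[OF g'] by simp
    qed
    then show "(\<lambda>n. LINT x|Omega a b. D x * of_real (cutoff c b (real n) x)) \<longlonglongrightarrow> 0"
      by (rule tendsto_eventually)
  qed
  \<comment> \<open>Extension by zero to the real line, where an integral over a half-line is again
    one over some (c, b), or zero.\<close>
  define E where "E x = indicator {a<..<b} x *\<^sub>R D x" for x
  have EA: "(LINT x|lebesgue. indicator A x *\<^sub>R E x) = (LINT x|Omega a b. D x * indicator A x)" for A
  proof -
    have "(LINT x|Omega a b. D x * indicator A x) = (LINT x|lebesgue. indicator {a<..<b} x *\<^sub>R (D x * indicator A x))"
      by (subst integral_restrict_space) auto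
    also have "\<dots> = (LINT x|lebesgue. indicator A x *\<^sub>R E x)"
      by (intro Bochner_Integration.integral_cong) (auto simp: E_def indicator_def)
    finally show ?thesis by simp
  qed
  have "AE x in lebesgue. E x = 0"
  proof (rule AE_zero_if_integrals_greaterThan_zero)
    show "integrable lebesgue E"
      using iD by (simp add: E_def[abs_def] integrable_restrict_space)
    have eq: "(LINT x|Omega a b. D x * indicator {x0<..} x) = (LINT x|Omega a b. D x * indicator {max a x0<..<b} x)" for x0
      by (intro Bochner_Integration.integral_cong refl) (auto simp: indicator_def)
    show half: "(LINT y:{x<..}|lebesgue. E y) = 0" for x
      unfolding set_lebesgue_integral_def EA eq using zero[of "max a x"] ab by (cases "max a x < b") auto
    have "(LINT y|lebesgue. E y) = (LINT y:{a<..}|lebesgue. E y)"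
      unfolding set_lebesgue_integral_def by (intro Bochner_Integration.integral_cong) (auto simp: E_def indicator_def)
    then show "(LINT y|lebesgue. E y) = 0" using half by simp
  qed
  then have "AE x in lebesgue. x \<in> {a<..<b} \<longrightarrow> D x = 0"
    by eventually_elim (auto simp: E_def indicator_def)
  then have "AE x in Omega a b. D x = 0"
    by (subst AE_restrict_space_iff) auto
  then show ?thesis by eventually_elim (simp add: D_def)
qed

text \<open>Needed for second derivatives: \<open>wderiv\<close> picks its representative by choice,
  so the function whose weak derivative is known agrees with the chosen first derivative only almost
  everywhere.\<close>

lemma has_weak_deriv_cong_AE:
  assumes w: "has_weak_deriv a b f g" and f': "f' \<in> L2 a b" "AE x in Omega a b. f x = f' x"
    and g': "g' \<in> L2 a b" "AE x in Omega a b. g x = g' x"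
  shows "has_weak_deriv a b f' g'"
  unfolding has_weak_deriv_def
proof (intro conjI allI impI f' g')
  fix \<eta> :: "real \<Rightarrow> real"
  assume \<eta>: "\<eta> C1_differentiable_on UNIV \<and> closure {x. \<eta> x \<noteq> 0} \<subseteq> {a<..<b}"
  then have d: "(\<eta> has_real_derivative deriv \<eta> x) (at x)" for x
    using C1_differentiable_on_def[of \<eta> UNIV]
    by (metis DERIV_imp_deriv UNIV_I has_real_derivative_iff_has_vector_derivative)
  obtain D where D: "\<And>x. (\<eta> has_vector_derivative D x) (at x)" "continuous_on UNIV D"
    using \<eta> unfolding C1_differentiable_on_def by auto
  have "deriv \<eta> = D"
    by (rule ext, rule DERIV_imp_deriv) (simp add: has_real_derivative_iff_has_vector_derivative D(1))
  then have [measurable]: "deriv \<eta> \<in> borel_measurable (Omega a b)"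
    using D(2) by (auto intro: borel_measurable_Omega_continuous)
  have [measurable]: "\<eta> \<in> borel_measurable (Omega a b)"
    using d by (intro borel_measurable_Omega_continuous) (meson DERIV_isCont continuous_at_imp_continuous_on)
  have m [measurable]: "f \<in> borel_measurable (Omega a b)" "f' \<in> borel_measurable (Omega a b)"
    "g \<in> borel_measurable (Omega a b)" "g' \<in> borel_measurable (Omega a b)"
    using w f' g' by (auto simp: has_weak_deriv_def L2_measurable)
  have "(LINT x|Omega a b. f x * of_real (deriv \<eta> x)) = (LINT x|Omega a b. f' x * of_real (deriv \<eta> x))"
    by (rule integral_cong_AE) (use f'(2) in \<open>measurable; eventually_elim; simp\<close>)+
  moreover have "(LINT x|Omega a b. g x * of_real (\<eta> x)) = (LINT x|Omega a b. g' x * of_real (\<eta> x))"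
    by (rule integral_cong_AE) (use g'(2) in \<open>measurable; eventually_elim; simp\<close>)+
  ultimately show "(LINT x|Omega a b. f' x * of_real (deriv \<eta> x)) = - (LINT x|Omega a b. g' x * of_real (\<eta> x))"
    using has_weak_derivD[OF w, of \<eta>] \<eta> by simp
qed

lemma has_weak_deriv_diff:
  assumes f: "has_weak_deriv a b f f'" and g: "has_weak_deriv a b g g'"
  shows "has_weak_deriv a b (\<lambda>x. f x - g x) (\<lambda>x. f' x - g' x)"
  unfolding has_weak_deriv_def
proof (intro conjI allI impI L2_diff has_weak_deriv_L2[OF f] has_weak_deriv_L2[OF g])
  fix \<eta> :: "real \<Rightarrow> real"
  assume \<eta>: "\<eta> C1_differentiable_on UNIV \<and> closure {x. \<eta> x \<noteq> 0} \<subseteq> {a<..<b}"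
  obtain D where D: "\<And>x. (\<eta> has_vector_derivative D x) (at x)" "continuous_on UNIV D"
    using \<eta> unfolding C1_differentiable_on_def by auto
  have dD: "deriv \<eta> = D"
    by (rule ext, rule DERIV_imp_deriv) (simp add: has_real_derivative_iff_has_vector_derivative D(1))
  have c: "continuous_on UNIV \<eta>" using D(1)
    by (meson continuous_at_imp_continuous_on has_vector_derivative_continuous)
  have L: "(\<lambda>x. complex_of_real (h x)) \<in> L2 a b" if "continuous_on UNIV h" for h
    using that by (intro L2_continuous continuous_intros)
  have "(LINT x|Omega a b. (f x - g x) * of_real (deriv \<eta> x)) =
    (LINT x|Omega a b. f x * of_real (deriv \<eta> x)) - (LINT x|Omega a b. g x * of_real (deriv \<eta> x))"
    unfolding left_diff_distrib dD
    by (intro Bochner_Integration.integral_diff integrable_L2_mult L D has_weak_deriv_L2[OF f] has_weak_deriv_L2[OF g])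
  moreover have "(LINT x|Omega a b. (f' x - g' x) * of_real (\<eta> x)) =
    (LINT x|Omega a b. f' x * of_real (\<eta> x)) - (LINT x|Omega a b. g' x * of_real (\<eta> x))"
    unfolding left_diff_distrib
    by (intro Bochner_Integration.integral_diff integrable_L2_mult L c has_weak_deriv_L2[OF f] has_weak_deriv_L2[OF g])
  ultimately show "(LINT x|Omega a b. (f x - g x) * of_real (deriv \<eta> x)) = - (LINT x|Omega a b. (f' x - g' x) * of_real (\<eta> x))"
    using has_weak_derivD[OF f, of \<eta>] has_weak_derivD[OF g, of \<eta>] \<eta> by simp
qed

lemma has_weak_deriv_wderiv:
  "has_weak_deriv a b f g \<Longrightarrow> has_weak_deriv a b f (wderiv a b f)"
  unfolding wderiv_def by (rule someI[where P="has_weak_deriv a b f"])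

lemma wderiv_AE_eq:
  "a < b \<Longrightarrow> has_weak_deriv a b f g \<Longrightarrow> AE x in Omega a b. wderiv a b f x = g x"
  using has_weak_deriv_unique has_weak_deriv_wderiv by blast

text \<open>The fundamental theorem of calculus for the product of \<open>p\<close> with a test
  function, which vanishes at both end points.\<close>

lemma has_weak_deriv_classical:
  fixes p :: "real \<Rightarrow> complex"
  assumes ab: "a < b" and d: "\<And>x. (p has_vector_derivative p' x) (at x)"
    and c: "continuous_on UNIV p'"
  shows "has_weak_deriv a b p p'"
  unfolding has_weak_deriv_def
proof (intro conjI allI impI)
  have cp: "continuous_on UNIV p"
    using d by (meson continuous_at_imp_continuous_on has_vector_derivative_continuous)
  note L = L2_continuous
  show "p \<in> L2 a b" "p' \<in> L2 a b" using L cp c by auto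
  fix \<eta> :: "real \<Rightarrow> real"
  assume \<eta>: "\<eta> C1_differentiable_on UNIV \<and> closure {x. \<eta> x \<noteq> 0} \<subseteq> {a<..<b}"
  obtain D where D: "\<And>x. (\<eta> has_vector_derivative D x) (at x)" "continuous_on UNIV D"
    using \<eta> unfolding C1_differentiable_on_def by auto
  have dD: "deriv \<eta> = D"
    by (rule ext, rule DERIV_imp_deriv) (simp add: has_real_derivative_iff_has_vector_derivative D(1))
  have c\<eta>: "continuous_on UNIV \<eta>" using D(1)
    by (meson continuous_at_imp_continuous_on has_vector_derivative_continuous)
  have z: "\<eta> a = 0" "\<eta> b = 0"
    using \<eta> closure_subset[of "{x. \<eta> x \<noteq> 0}"] by (auto simp: subset_iff)
  let ?F = "\<lambda>x. p x * of_real (\<eta> x)" and ?F' = "\<lambda>x. p x * of_real (D x) + p' x * of_real (\<eta> x)"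
  have "(?F' has_integral ?F b - ?F a) {a..b}"
  proof (rule fundamental_theorem_of_calculus)
    fix x
    have "((\<lambda>x. complex_of_real (\<eta> x)) has_vector_derivative of_real (D x)) (at x)"
      using D(1)[of x] by (intro has_vector_derivative_of_real)
        (simp add: has_real_derivative_iff_has_vector_derivative)
    from has_vector_derivative_mult[OF d this]
    show "(?F has_vector_derivative ?F' x) (at x within {a..b})"
      by (rule has_vector_derivative_at_within)
  qed (use ab in simp)
  then have "integral {a..b} ?F' = 0" using z by (simp add: integral_unique)
  then have "(LINT x|Omega a b. ?F' x) = 0"
    using continuous_on_subset[OF cp] continuous_on_subset[OF c] continuous_on_subset[OF D(2)] continuous_on_subset[OF c\<eta>]
    by (subst integral_Omega_continuous) (auto intro!: continuous_intros)
  moreover have "(LINT x|Omega a b. ?F' x) = (LINT x|Omega a b. p x * of_real (D x)) + (LINT x|Omega a b. p' x * of_real (\<eta> x))"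
    by (intro Bochner_Integration.integral_add integrable_L2_mult L cp c continuous_intros D(2) c\<eta>)
  ultimately show "(LINT x|Omega a b. p x * of_real (deriv \<eta> x)) = - (LINT x|Omega a b. p' x * of_real (\<eta> x))"
    by (simp add: dD add_eq_0_iff2)
qed

lemma has_weak_deriv_trig:
  assumes "a < b" "finite A"
  shows "has_weak_deriv a b (trig a b A c) (trig a b A (\<lambda>l. \<i> * of_real (freq a b l) * c l))"
proof (rule has_weak_deriv_classical[OF assms(1) _ continuous_on_trig])
  fix x
  have "((\<lambda>x. c l * fbasis a b l x) has_vector_derivative c l * (\<i> * of_real (freq a b l) * fbasis a b l x)) (at x)" for l
    by (intro has_vector_derivative_mult_right fbasis_has_vector_derivative)
  then have "((\<lambda>x. \<Sum>l\<in>A. c l * fbasis a b l x) has_vector_derivative (\<Sum>l\<in>A. c l * (\<i> * of_real (freq a b l) * fbasis a b l x))) (at x)"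
    by (intro has_vector_derivative_sum)
  then show "(trig a b A c has_vector_derivative trig a b A (\<lambda>l. \<i> * of_real (freq a b l) * c l) x) (at x)"
    by (simp add: trig_def[abs_def] mult_ac)
qed

text \<open>The derivative of the cutoff acts as the difference of two approximate point masses at the
  two end points.\<close>

lemma integral_mult_dcutoff_tendsto_0:
  fixes F :: "real \<Rightarrow> complex"
  assumes ab: "a < b" and F: "continuous_on {a..b} F" "F a = F b"
  shows "(\<lambda>n. LINT x|Omega a b. F x * of_real (dcutoff a b (real n) x)) \<longlonglongrightarrow> 0"
proof (rule LIMSEQ_I)
  fix e :: real assume "0 < e"
  define r where "r = e / 3"
  have r: "0 < r" using \<open>0 < e\<close> by (simp add: r_def)
  obtain \<delta> where \<delta>: "0 < \<delta>" "\<And>x y. x \<in> {a..b} \<Longrightarrow> y \<in> {a..b} \<Longrightarrow> dist y x < \<delta> \<Longrightarrow> dist (F y) (F x) < r"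
    using compact_uniformly_continuous[OF F(1)] r unfolding uniformly_continuous_on_def by (metis compact_Icc)
  \<comment> \<open>Each hat lives within distance \<open>3 / k\<close> of its end point, so
    \<open>4 / \<delta>\<close> puts it where \<open>F\<close> is within \<open>r\<close> of its end
    value; \<open>6 / (b - a)\<close> makes it fit into the interval with its full mass 1.\<close>
  obtain n0 where n0: "max (4 / \<delta>) (max 1 (6 / (b - a))) \<le> real n0"
    using real_arch_simple by blast
  have "norm ((LINT x|Omega a b. F x * of_real (dcutoff a b (real n) x)) - 0) < e" if "n0 \<le> n" for n
  proof -
    define k where "k = real n"
    have k: "4 / \<delta> \<le> k" "1 \<le> k" "6 / (b - a) \<le> k" using n0 that by (auto simp: k_def)
    then have k6: "6 \<le> k * (b - a)" and kd: "4 \<le> k * \<delta>" using ab \<delta>(1) by (simp_all add: field_simps)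
    let ?l = "\<lambda>x. k * hat (k * (x - a) - 1)" and ?r = "\<lambda>x. k * hat (k * (b - x) - 1)"
    have c: "continuous_on {a..b} ?l" "continuous_on {a..b} ?r" by (intro continuous_intros)+
    have l: "(?l has_integral 1) {a..b}"
    proof -
      have "(?l has_integral step (k * (b - a) - 1) - step (k * (a - a) - 1)) {a..b}"
      proof (rule fundamental_theorem_of_calculus)
        fix x
        have "((\<lambda>x. step (k * (x - a) - 1)) has_real_derivative hat (k * (x - a) - 1) * k) (at x)"
          by (rule DERIV_chain2[OF step_has_real_derivative]) (auto intro!: derivative_eq_intros)
        then show "((\<lambda>x. step (k * (x - a) - 1)) has_vector_derivative ?l x) (at x within {a..b})"
          by (simp add: has_real_derivative_iff_has_vector_derivative mult.commute has_vector_derivative_at_within)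
      qed (use ab in simp)
      then show ?thesis using k6 by (simp add: step_eq_0 step_eq_1)
    qed
    have rr: "(?r has_integral 1) {a..b}"
    proof -
      have "(?r has_integral - step (k * (b - b) - 1) - (- step (k * (b - a) - 1))) {a..b}"
      proof (rule fundamental_theorem_of_calculus)
        fix x
        have "((\<lambda>x. - step (k * (b - x) - 1)) has_real_derivative - (hat (k * (b - x) - 1) * (- k))) (at x)"
          by (intro derivative_intros DERIV_chain2[OF step_has_real_derivative]) (auto intro!: derivative_eq_intros)
        then show "((\<lambda>x. - step (k * (b - x) - 1)) has_vector_derivative ?r x) (at x within {a..b})"
          by (simp add: has_real_derivative_iff_has_vector_derivative mult.commute has_vector_derivative_at_within)
      qed (use ab in simp)
      then show ?thesis using k6 by (simp add: step_eq_0 step_eq_1)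
    qed
    have cF: "continuous_on {a..b} (\<lambda>x. F x * of_real (dcutoff a b k x))"
      by (intro continuous_intros F)
    have cG: "continuous_on {a..b} (\<lambda>x. F a * of_real (dcutoff a b k x))"
      by (intro continuous_intros)
    \<comment> \<open>The two hats have equal mass, so the constant \<open>F a\<close> integrates to
      zero against their difference and may be subtracted.\<close>
    have "((\<lambda>x. F a * of_real (dcutoff a b k x)) has_integral F a * of_real (1 - 1)) {a..b}"
      unfolding dcutoff_def by (intro has_integral_mult_right has_integral_of_real has_integral_diff l rr)
    note G0 = integral_unique[OF this]
    have "integral {a..b} (\<lambda>x. F x * of_real (dcutoff a b k x) - F a * of_real (dcutoff a b k x)) =
        integral {a..b} (\<lambda>x. F x * of_real (dcutoff a b k x)) - integral {a..b} (\<lambda>x. F a * of_real (dcutoff a b k x))"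
      using cF cG by (intro Henstock_Kurzweil_Integration.integral_diff integrable_continuous_interval)
    then have eq: "integral {a..b} (\<lambda>x. F x * of_real (dcutoff a b k x) - F a * of_real (dcutoff a b k x)) =
        integral {a..b} (\<lambda>x. F x * of_real (dcutoff a b k x))"
      using G0 by simp
    have "norm (integral {a..b} (\<lambda>x. F x * of_real (dcutoff a b k x))) \<le> integral {a..b} (\<lambda>x. r * (?l x + ?r x))"
      unfolding eq[symmetric]
    proof (rule integral_norm_bound_integral)
      show "(\<lambda>x. F x * of_real (dcutoff a b k x) - F a * of_real (dcutoff a b k x)) integrable_on {a..b}"
        using cF cG by (intro Henstock_Kurzweil_Integration.integrable_diff integrable_continuous_interval)
      show "(\<lambda>x. r * (?l x + ?r x)) integrable_on {a..b}"
        using c by (intro integrable_continuous_interval continuous_intros)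
      fix x assume x: "x \<in> {a..b}"
      have 1: "norm (F x - F a) * ?l x \<le> r * ?l x"
      proof (cases "hat (k * (x - a) - 1) = 0")
        case False
        then have "k * (x - a) < 3" using hat_eq_0[of "k * (x - a) - 1"] by linarith
        then have "k * (x - a) < k * \<delta>" using kd by linarith
        then have "x - a < \<delta>" using k by simp
        then have "dist (F x) (F a) < r" using x ab by (intro \<delta>(2)) (auto simp: dist_real_def)
        then show ?thesis using k hat_nonneg by (intro mult_right_mono) (auto simp: dist_norm)
      next
        case True
        show ?thesis unfolding True by simp
      qed
      have 2: "norm (F x - F a) * ?r x \<le> r * ?r x"
      proof (cases "hat (k * (b - x) - 1) = 0")
        case False
        then have "k * (b - x) < 3" using hat_eq_0[of "k * (b - x) - 1"] by linarith
        then have "k * (b - x) < k * \<delta>" using kd by linarith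
        then have "b - x < \<delta>" using k by simp
        then have "dist (F x) (F b) < r" using x ab by (intro \<delta>(2)) (auto simp: dist_real_def)
        then show ?thesis using k hat_nonneg F(2) by (intro mult_right_mono) (auto simp: dist_norm)
      next
        case True
        show ?thesis unfolding True by simp
      qed
      have "\<bar>dcutoff a b k x\<bar> \<le> ?l x + ?r x"
      proof -
        have "0 \<le> ?l x" "0 \<le> ?r x" using k hat_nonneg by simp_all
        then show ?thesis unfolding dcutoff_def by linarith
      qed
      then have "norm (F x - F a) * \<bar>dcutoff a b k x\<bar> \<le> norm (F x - F a) * (?l x + ?r x)"
        by (rule mult_left_mono) simp
      moreover have "norm (F x * of_real (dcutoff a b k x) - F a * of_real (dcutoff a b k x)) = norm (F x - F a) * \<bar>dcutoff a b k x\<bar>"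
        by (simp only: left_diff_distrib[symmetric] norm_mult norm_of_real)
      ultimately show "norm (F x * of_real (dcutoff a b k x) - F a * of_real (dcutoff a b k x)) \<le> r * (?l x + ?r x)"
        using 1 2 by (simp only: distrib_left)
    qed
    also have "\<dots> = r * (1 + 1)"
      by (intro integral_unique has_integral_mult_right has_integral_add l rr)
    also have "\<dots> < e" using r by (simp add: r_def)
    finally show ?thesis
      using integral_Omega_continuous[OF cF] by (simp add: k_def)
  qed
  then show "\<exists>no. \<forall>n\<ge>no. norm ((LINT x|Omega a b. F x * of_real (dcutoff a b (real n) x)) - 0) < e" by blast
qed

text \<open>A test function has to vanish near the end points, while \<open>\<theta>\<close> need
  not; so \<open>\<theta>\<close> is multiplied by a cut-off and the limit is taken. The derivative
  of the cut-off produces the boundary term, which tends to zero because \<open>u\<close> times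
  \<open>\<theta>\<close> has equal values at \<open>a\<close> and \<open>b\<close>.\<close>

lemma weak_deriv_integration_by_parts:
  assumes ab: "a < b" and w: "has_weak_deriv a b f g"
    and u: "continuous_on {a..b} u" "AE x in Omega a b. u x = f x"
    and \<theta>: "\<And>x. (\<theta> has_real_derivative \<theta>' x) (at x)" "continuous_on UNIV \<theta>'"
    and per: "u a * of_real (\<theta> a) = u b * of_real (\<theta> b)"
  shows "(LINT x|Omega a b. g x * of_real (\<theta> x)) = - (LINT x|Omega a b. f x * of_real (\<theta>' x))"
proof -
  note fL = has_weak_deriv_L2(1)[OF w] and gL = has_weak_deriv_L2(2)[OF w]
  have c\<theta>: "continuous_on UNIV \<theta>" using \<theta>(1) by (meson DERIV_isCont continuous_at_imp_continuous_on)
  have L: "(\<lambda>x. complex_of_real (h x)) \<in> L2 a b" if "continuous_on UNIV h" for h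
    using that by (intro L2_continuous continuous_intros)
  note M = integrable_L2_mult[OF fL L] integrable_L2_mult[OF gL L]
  have ind: "(LINT x|Omega a b. h x * indicator {a<..<b} x) = (LINT x|Omega a b. h x)" for h :: "real \<Rightarrow> complex"
    by (intro Bochner_Integration.integral_cong) (auto simp: indicator_def)
  have 1: "(\<lambda>n. LINT x|Omega a b. (g x * of_real (\<theta> x)) * of_real (cutoff a b (real n) x)) \<longlonglongrightarrow> (LINT x|Omega a b. g x * of_real (\<theta> x))"
    using integral_mult_cutoff_tendsto[OF ab M(2)[OF c\<theta>]] unfolding ind .
  have 2: "(\<lambda>n. LINT x|Omega a b. (f x * of_real (\<theta>' x)) * of_real (cutoff a b (real n) x)) \<longlonglongrightarrow> (LINT x|Omega a b. f x * of_real (\<theta>' x))"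
    using integral_mult_cutoff_tendsto[OF ab M(1)[OF \<theta>(2)]] unfolding ind .
  have "continuous_on {a..b} (\<lambda>x. u x * of_real (\<theta> x))"
    using u(1) continuous_on_subset[OF c\<theta>] by (intro continuous_intros) auto
  from integral_mult_dcutoff_tendsto_0[OF ab this per]
  have 3: "(\<lambda>n. LINT x|Omega a b. u x * of_real (\<theta> x) * of_real (dcutoff a b (real n) x)) \<longlonglongrightarrow> 0" .
  have um: "u \<in> borel_measurable (Omega a b)"
    by (intro continuous_imp_measurable_on_sets_lebesgue continuous_on_subset[OF u(1)]) auto
  have "\<forall>\<^sub>F n in sequentially.
      (LINT x|Omega a b. u x * of_real (\<theta> x) * of_real (dcutoff a b (real n) x))
      + (LINT x|Omega a b. (f x * of_real (\<theta>' x)) * of_real (cutoff a b (real n) x))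
      = - (LINT x|Omega a b. (g x * of_real (\<theta> x)) * of_real (cutoff a b (real n) x))"
    using eventually_nat_ge_real[of "6 / (b - a)"] eventually_nat_ge_real[of 1]
  proof eventually_elim
    case (elim n)
    define k where "k = real n"
    have n: "6 \<le> k * (b - a)" "k > 0"
      using ab elim by (simp_all add: field_simps k_def)
    have cc: "continuous_on UNIV (\<lambda>x. \<theta> x * dcutoff a b k x)" "continuous_on UNIV (\<lambda>x. \<theta>' x * cutoff a b k x)"
      by (intro continuous_intros c\<theta> \<theta>)+
    have A1: "(LINT x|Omega a b. f x * of_real (\<theta>' x * cutoff a b k x + \<theta> x * dcutoff a b k x)) =
       - (LINT x|Omega a b. g x * of_real (\<theta> x * cutoff a b k x))"
      using w
    proof (rule weak_deriv_test[where \<delta>="1 / k"])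
      show "((\<lambda>x. \<theta> x * cutoff a b k x) has_real_derivative \<theta>' x * cutoff a b k x + \<theta> x * dcutoff a b k x) (at x)" for x
        using DERIV_mult[OF \<theta>(1) cutoff_has_real_derivative[of a b k x]] by (simp add: mult.commute)
      show "continuous_on UNIV (\<lambda>x. \<theta>' x * cutoff a b k x + \<theta> x * dcutoff a b k x)"
        by (intro continuous_intros c\<theta> \<theta>)
      show "\<theta> x * cutoff a b k x = 0" if "x \<le> a + 1 / k \<or> b - 1 / k \<le> x" for x
        using cutoff_eq_0[OF n(2,1) that] by simp
    qed (use n in simp)
    have A2: "(LINT x|Omega a b. f x * of_real (\<theta>' x * cutoff a b k x + \<theta> x * dcutoff a b k x))
      = (LINT x|Omega a b. f x * of_real (\<theta>' x * cutoff a b k x)) + (LINT x|Omega a b. f x * of_real (\<theta> x * dcutoff a b k x))"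
      unfolding of_real_add distrib_left by (intro Bochner_Integration.integral_add M cc)
    have A3: "(LINT x|Omega a b. f x * of_real (\<theta> x * dcutoff a b k x)) = (LINT x|Omega a b. u x * of_real (\<theta> x) * of_real (dcutoff a b k x))"
    proof (rule integral_cong_AE)
      show "AE x in Omega a b. f x * of_real (\<theta> x * dcutoff a b k x) = u x * of_real (\<theta> x) * of_real (dcutoff a b k x)"
        using u(2) by eventually_elim simp
      show "(\<lambda>x. f x * of_real (\<theta> x * dcutoff a b k x)) \<in> borel_measurable (Omega a b)"
        using M(1)[OF cc(1)] by (rule borel_measurable_integrable)
      have "(\<lambda>x. u x * of_real (\<theta> x * dcutoff a b k x)) \<in> borel_measurable (Omega a b)"
        using um L2_measurable[OF L[OF cc(1)]] by (rule borel_measurable_times)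
      then show "(\<lambda>x. u x * of_real (\<theta> x) * of_real (dcutoff a b k x)) \<in> borel_measurable (Omega a b)"
        by (simp only: mult.assoc of_real_mult)
    qed
    show ?case using A1 unfolding A2 A3 by (simp only: of_real_mult mult.assoc k_def add.commute)
  qed
  moreover have "(\<lambda>n. (LINT x|Omega a b. u x * of_real (\<theta> x) * of_real (dcutoff a b (real n) x))
      + (LINT x|Omega a b. (f x * of_real (\<theta>' x)) * of_real (cutoff a b (real n) x)))
     \<longlonglongrightarrow> 0 + (LINT x|Omega a b. f x * of_real (\<theta>' x))"
    by (intro tendsto_add 2 3)
  ultimately have "(\<lambda>n. - (LINT x|Omega a b. (g x * of_real (\<theta> x)) * of_real (cutoff a b (real n) x)))
     \<longlonglongrightarrow> 0 + (LINT x|Omega a b. f x * of_real (\<theta>' x))"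
    by (rule Lim_transform_eventually[rotated])
  then have "- (LINT x|Omega a b. g x * of_real (\<theta> x)) = 0 + (LINT x|Omega a b. f x * of_real (\<theta>' x))"
    by (rule LIMSEQ_unique[OF tendsto_minus[OF 1]])
  then show ?thesis by (simp add: minus_equation_iff)
qed

text \<open>Integration by parts against a character. Test functions are real-valued, hence the
  separate treatment of cosine and sine; both have period \<open>b - a\<close>, so periodicity of
  \<open>u\<close> removes the boundary terms.\<close>

lemma fcoeff_weak_deriv:
  assumes ab: "a < b" and w: "has_weak_deriv a b f g"
    and u: "continuous_on {a..b} u" "AE x in Omega a b. u x = f x" "u a = u b"
  shows "fcoeff a b g l = \<i> * of_real (freq a b l) * fcoeff a b f l"
proof -
  let ?m = "freq a b l"
  let ?c = "\<lambda>x. cos (?m * (x - a))" and ?s = "\<lambda>x. sin (?m * (x - a))"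
  note fL = has_weak_deriv_L2(1)[OF w] and gL = has_weak_deriv_L2(2)[OF w]
  have e: "fbasis a b (- l) x = of_real (?c x) - \<i> * of_real (?s x)" for x
    using cis_conv_exp[of "- ?m * (x - a)"] by (simp add: fbasis_def freq_def complex_eq_iff Re_exp Im_exp)
  have per: "?c b = 1" "?s b = 0"
  proof -
    have "?m * (b - a) = 2 * pi * of_int l" using ab by (simp add: freq_def)
    then show "?c b = 1" "?s b = 0" by (metis cos_int_2pin mult.commute, metis sin_int_2pin mult.commute)
  qed
  have C: "(LINT x|Omega a b. g x * of_real (?c x)) = - (LINT x|Omega a b. f x * of_real (- ?m * ?s x))"
    by (rule weak_deriv_integration_by_parts[OF ab w u(1,2)])
      (use per u(3) in \<open>auto intro!: derivative_eq_intros continuous_intros\<close>)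
  have S: "(LINT x|Omega a b. g x * of_real (?s x)) = - (LINT x|Omega a b. f x * of_real (?m * ?c x))"
    by (rule weak_deriv_integration_by_parts[OF ab w u(1,2)])
      (use per u(3) in \<open>auto intro!: derivative_eq_intros continuous_intros\<close>)
  have L: "(\<lambda>x. complex_of_real (?c x)) \<in> L2 a b" "(\<lambda>x. complex_of_real (?s x)) \<in> L2 a b"
    by (intro L2_bounded[where B=1] borel_measurable_Omega_continuous continuous_intros; simp)+
  have ex: "(LINT x|Omega a b. h x * fbasis a b (- l) x) = (LINT x|Omega a b. h x * of_real (?c x)) - \<i> * (LINT x|Omega a b. h x * of_real (?s x))"
    if "h \<in> L2 a b" for h
  proof -
    have "(LINT x|Omega a b. h x * fbasis a b (- l) x) = (LINT x|Omega a b. h x * of_real (?c x) - \<i> * (h x * of_real (?s x)))"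
      by (simp add: e algebra_simps)
    also have "\<dots> = (LINT x|Omega a b. h x * of_real (?c x)) - (LINT x|Omega a b. \<i> * (h x * of_real (?s x)))"
      by (intro Bochner_Integration.integral_diff integrable_mult_right integrable_L2_mult that L)
    finally show ?thesis by simp
  qed
  have *: "(LINT x|Omega a b. f x * of_real (r * t x)) = of_real r * (LINT x|Omega a b. f x * of_real (t x))" for r t
    by (simp only: of_real_mult mult.left_commute[of "f _"] integral_mult_right_zero)
  have C': "(LINT x|Omega a b. g x * of_real (?c x)) = of_real ?m * (LINT x|Omega a b. f x * of_real (?s x))"
    unfolding C * by simp
  have S': "(LINT x|Omega a b. g x * of_real (?s x)) = - of_real ?m * (LINT x|Omega a b. f x * of_real (?c x))"
    unfolding S * by simp
  show ?thesis unfolding fcoeff_eq ex[OF fL] ex[OF gL] C' S' by (simp add: field_simps)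
qed

section \<open>Trigonometric approximation\<close>

definition trig_polys :: "real \<Rightarrow> real \<Rightarrow> (real \<Rightarrow> complex) set" where
  "trig_polys a b = {trig a b A c | A c. finite A}"

lemma trig_extend:
  assumes "finite B" "A \<subseteq> B"
  shows "trig a b A c = trig a b B (\<lambda>l. if l \<in> A then c l else 0)"
proof
  fix x
  have "trig a b B (\<lambda>l. if l \<in> A then c l else 0) x = (\<Sum>l\<in>B. if l \<in> A then c l * fbasis a b l x else 0)"
    unfolding trig_def by (intro sum.cong) auto
  also have "\<dots> = (\<Sum>l\<in>B \<inter> A. c l * fbasis a b l x)"
    using assms by (simp add: sum.inter_restrict)
  also have "B \<inter> A = A" using assms by auto
  finally show "trig a b A c x = trig a b B (\<lambda>l. if l \<in> A then c l else 0) x"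
    by (simp add: trig_def)
qed

lemma trig_polys_add:
  assumes "f \<in> trig_polys a b" "g \<in> trig_polys a b"
  shows "(\<lambda>x. f x + g x) \<in> trig_polys a b"
proof -
  obtain A c B d where f: "f = trig a b A c" "finite A" and g: "g = trig a b B d" "finite B"
    using assms by (auto simp: trig_polys_def)
  let ?c = "\<lambda>l. if l \<in> A then c l else 0" and ?d = "\<lambda>l. if l \<in> B then d l else 0"
  have "(\<lambda>x. f x + g x) = trig a b (A \<union> B) (\<lambda>l. ?c l + ?d l)"
    using f g trig_extend[of "A \<union> B" A a b c] trig_extend[of "A \<union> B" B a b d]
    by (simp add: trig_def[abs_def] distrib_right sum.distrib)
  then show ?thesis using f g unfolding trig_polys_def by blast
qed

lemma trig_polys_monomial: "(\<lambda>x. c * fbasis a b l x) \<in> trig_polys a b"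
proof -
  have "(\<lambda>x. c * fbasis a b l x) = trig a b {l} (\<lambda>_. c)" by (simp add: trig_def[abs_def])
  then show ?thesis unfolding trig_polys_def by blast
qed

lemma trig_polys_const: "(\<lambda>x. c) \<in> trig_polys a b"
  using trig_polys_monomial[of c a b 0] by (simp add: fbasis_0)

lemma trig_polys_sum:
  "finite I \<Longrightarrow> (\<And>i. i \<in> I \<Longrightarrow> f i \<in> trig_polys a b) \<Longrightarrow> (\<lambda>x. \<Sum>i\<in>I. f i x) \<in> trig_polys a b"
  by (induction I rule: finite_induct) (simp_all add: trig_polys_const trig_polys_add)

lemma trig_polys_mult:
  assumes "f \<in> trig_polys a b" "g \<in> trig_polys a b"
  shows "(\<lambda>x. f x * g x) \<in> trig_polys a b"
proof -
  obtain A c B d where f: "f = trig a b A c" "finite A" and g: "g = trig a b B d" "finite B"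
    using assms by (auto simp: trig_polys_def)
  have eq: "f x * g x = (\<Sum>l\<in>A. \<Sum>m\<in>B. (c l * d m) * fbasis a b (l + m) x)" for x
    unfolding f g trig_def sum_product fbasis_mult[symmetric]
    by (intro sum.cong refl) (simp add: mult_ac)
  show ?thesis
    unfolding eq by (intro trig_polys_sum trig_polys_monomial f g)
qed

text \<open>A real linear functional of z is a combination of z and its conjugate, which on the
  circle are the characters with index 1 and -1; constants, sums and products stay in the
  algebra.\<close>

lemma trig_polys_real_polynomial:
  assumes "real_polynomial_function p"
  shows "(\<lambda>x. complex_of_real (p (fbasis a b 1 x))) \<in> trig_polys a b"
  using assms
proof (induction p rule: real_polynomial_function.induct)
  case (linear f)
  interpret bounded_linear f by fact
  have fz: "complex_of_real (f z) = of_real (f 1) * ((z + cnj z) / 2) + of_real (f \<i>) * ((z - cnj z) / (2 * \<i>))" for z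
  proof -
    have "z = Re z *\<^sub>R 1 + Im z *\<^sub>R \<i>" by (simp add: complex_eq_iff)
    then have "f z = Re z * f 1 + Im z * f \<i>" by (metis add scale real_scaleR_def)
    moreover have "(z + cnj z) / 2 = of_real (Re z)" "(z - cnj z) / (2 * \<i>) = of_real (Im z)"
      by (simp_all add: complex_eq_iff complex_add_cnj complex_diff_cnj)
    ultimately show ?thesis by (simp add: mult.commute)
  qed
  have eq: "(\<lambda>x. complex_of_real (f (fbasis a b 1 x))) = (\<lambda>x. of_real (f 1) * ((fbasis a b 1 x + fbasis a b (- 1) x) / 2)
      + of_real (f \<i>) * ((fbasis a b 1 x + (- 1) * fbasis a b (- 1) x) / (2 * \<i>)))"
    by (rule ext, subst fz) (simp only: cnj_fbasis mult_minus_left mult_1_left diff_conv_add_uminus)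
  have "(\<lambda>x. of_real (f 1) * ((fbasis a b 1 x + fbasis a b (- 1) x) / 2)
      + of_real (f \<i>) * ((fbasis a b 1 x + (- 1) * fbasis a b (- 1) x) / (2 * \<i>))) \<in> trig_polys a b"
    unfolding divide_inverse
    by (intro trig_polys_add trig_polys_mult trig_polys_const)
      (use trig_polys_monomial[of 1 a b] in simp_all)
  then show ?case by (simp only: eq)
qed (simp_all add: trig_polys_const trig_polys_add trig_polys_mult)

text \<open>A continuous function with equal end values is a continuous function on the unit circle,
  where the Stone-Weierstrass theorem supplies polynomials in the real and imaginary part.
  Substituting \<open>fbasis a b 1\<close> turns them into trigonometric polynomials.\<close>

lemma trig_polys_dense:
  fixes u :: "real \<Rightarrow> complex"
  assumes ab: "a < b" and u: "continuous_on {a..b} u" "u a = u b" and "0 < e"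
  obtains A c where "finite A" "\<And>x. x \<in> {a..b} \<Longrightarrow> cmod (u x - trig a b A c x) < e"
proof -
  define \<gamma> where "\<gamma> t = u (a + (b - a) * t)" for t
  have "continuous_on {0..1} \<gamma>"
    unfolding \<gamma>_def
  proof (intro continuous_on_compose2[OF u(1)] continuous_intros subsetI)
    fix y assume "y \<in> (\<lambda>t. a + (b - a) * t) ` {0..1}"
    then obtain t where t: "y = a + (b - a) * t" "0 \<le> t" "t \<le> 1"
      unfolding image_iff Bex_def atLeastAtMost_iff by blast
    then have "0 \<le> (b - a) * t" "(b - a) * t \<le> (b - a) * 1"
      using ab by (intro mult_nonneg_nonneg mult_left_mono; simp)+
    then show "y \<in> {a..b}" using t by simp
  qed
  \<comment> \<open>The constant homotopy serves to convert the loop into a continuous map on the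
    circle: equivalence of loops and circle maps hides the continuity across the cut of
    \<open>Arg2pi\<close>.\<close>
  then have "homotopic_loops UNIV \<gamma> \<gamma>"
    using u(2) by (simp add: homotopic_loops_refl path_def pathfinish_def pathstart_def \<gamma>_def)
  from homotopic_with_imp_continuous[OF homotopic_loops_imp_homotopic_circlemaps[OF this]]
  have c: "continuous_on (sphere 0 1) (\<gamma> \<circ> (\<lambda>z. Arg2pi z / (2 * pi)))" by simp
  obtain g where g: "polynomial_function g"
      "\<And>z. z \<in> sphere 0 1 \<Longrightarrow> norm ((\<gamma> \<circ> (\<lambda>z. Arg2pi z / (2 * pi))) z - g z) < e"
    using Stone_Weierstrass_polynomial_function[OF compact_sphere c \<open>0 < e\<close>] by blast
  have "real_polynomial_function (Re \<circ> g)" "real_polynomial_function (Im \<circ> g)"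
    using g(1) bounded_linear_Re bounded_linear_Im unfolding polynomial_function_def by blast+
  from this[THEN trig_polys_real_polynomial, of a b]
  have "(\<lambda>x. of_real (Re (g (fbasis a b 1 x))) + \<i> * of_real (Im (g (fbasis a b 1 x)))) \<in> trig_polys a b"
    by (intro trig_polys_add trig_polys_mult trig_polys_const) (simp_all add: o_def)
  then have "(\<lambda>x. g (fbasis a b 1 x)) \<in> trig_polys a b"
    by (simp add: complex_eq[symmetric])
  then obtain A d where A: "finite A" "(\<lambda>x. g (fbasis a b 1 x)) = trig a b A d"
    by (auto simp: trig_polys_def)
  have "cmod (u x - trig a b A d x) < e" if x: "x \<in> {a..b}" for x
  proof -
    have "(\<gamma> \<circ> (\<lambda>z. Arg2pi z / (2 * pi))) (fbasis a b 1 x) = u x"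
    proof (cases "x = b")
      case True
      \<comment> \<open>The end point \<open>b\<close> is mapped to 1, whose argument is 0, so the
        circle map returns \<open>u a\<close> there; it equals \<open>u b\<close>.\<close>
      then show ?thesis using fbasis_right[OF ab] u(2) Arg2pi_of_real[of 1] by (simp add: \<gamma>_def)
    next
      case False
      let ?\<theta> = "freq a b 1 * (x - a)"
      have "(x - a) / (b - a) < 1" using False x ab by simp
      then have "0 \<le> ?\<theta>" "?\<theta> < 2 * pi"
        using x ab by (auto simp: freq_def field_simps)
      then have "Arg2pi (fbasis a b 1 x) = ?\<theta>"
        unfolding fbasis_def by (subst Arg2pi_exp) simp_all
      then show ?thesis using ab by (simp add: \<gamma>_def freq_def)
    qed
    then show ?thesis using g(2)[of "fbasis a b 1 x"] A(2) by (metis cmod_fbasis mem_sphere_0)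
  qed
  then show thesis using that A(1) by blast
qed

section \<open>The projection \<open>PN\<close> and its error\<close>

lemma finite_freqs [simp]: "finite (freqs N)"
  by (simp add: freqs_def)

lemma PN_L2: "PN a b N f \<in> L2 a b"
  by (simp add: PN_eq_trig trig_L2)

lemma freqs_mono: "N \<le> K \<Longrightarrow> freqs N \<subseteq> freqs K"
  using div_le_mono[of N K 2] by (auto simp: freqs_def)

lemma finite_subset_freqs:
  assumes "finite A"
  obtains K where "A \<subseteq> freqs K" "N \<le> K"
proof -
  define m where "m = (\<Sum>l\<in>A. \<bar>l\<bar>)"
  have m: "\<bar>l\<bar> \<le> m" if "l \<in> A" for l
    unfolding m_def using assms that by (intro member_le_sum) auto
  show thesis
  proof (rule that)
    show "A \<subseteq> freqs (N + 2 * nat (\<bar>m\<bar> + 1))" using m by (fastforce simp: freqs_def)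
  qed simp
qed

lemma L2_norm_diff_PN_square:
  assumes "a < b" "f \<in> L2 a b"
  shows "(L2_norm a b (\<lambda>x. f x - PN a b N f x))\<^sup>2 =
    (L2_norm a b f)\<^sup>2 - (b - a) * (\<Sum>l\<in>freqs N. (cmod (fcoeff a b f l))\<^sup>2)"
  using L2_norm_diff_partial_sum[OF assms(1) finite_freqs assms(2)] by (simp add: PN_eq_trig)

lemma PN_best_approximation:
  assumes ab: "a < b" and f: "f \<in> L2 a b" and A: "A \<subseteq> freqs N"
  shows "L2_norm a b (\<lambda>x. f x - PN a b N f x) \<le> L2_norm a b (\<lambda>x. f x - trig a b A c x)"
proof (rule power2_le_imp_le)
  show "(L2_norm a b (\<lambda>x. f x - PN a b N f x))\<^sup>2 \<le> (L2_norm a b (\<lambda>x. f x - trig a b A c x))\<^sup>2"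
    unfolding L2_norm_diff_PN_square[OF ab f] trig_extend[OF finite_freqs A] L2_norm_diff_partial_sum[OF ab finite_freqs f]
    using ab by (simp add: sum_nonneg)
qed simp

text \<open>Stands in for Parseval's identity: by density the error of \<open>PN a b K\<close> is
  negligible for some large K, and the squared errors for K and N differ by a finite tail. Thus only
  finite sums have to be bounded.\<close>

lemma PN_tail_bound:
  assumes ab: "a < b" and f: "f \<in> L2 a b"
    and u: "continuous_on {a..b} u" "u a = u b" "AE x in Omega a b. u x = f x"
    and B: "\<And>K. (b - a) * (\<Sum>l\<in>freqs K - freqs N. (cmod (fcoeff a b f l))\<^sup>2) \<le> B"
  shows "(L2_norm a b (\<lambda>x. f x - PN a b N f x))\<^sup>2 \<le> B"
proof (rule field_le_epsilon)
  fix e :: real assume "0 < e"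
  define d where "d = sqrt (e / (b - a))"
  have d: "0 < d" "d\<^sup>2 * (b - a) = e" using \<open>0 < e\<close> ab by (auto simp: d_def)
  obtain A c where A: "finite A" "\<And>x. x \<in> {a..b} \<Longrightarrow> cmod (u x - trig a b A c x) < d"
    using trig_polys_dense[OF ab u(1,2) d(1)] by blast
  obtain K where K: "A \<subseteq> freqs K" "N \<le> K" by (rule finite_subset_freqs[OF A(1)])
  have "L2_norm a b (\<lambda>x. f x - PN a b K f x) \<le> L2_norm a b (\<lambda>x. f x - trig a b A c x)"
    by (rule PN_best_approximation[OF ab f K(1)])
  also have "\<dots> \<le> d * sqrt (b - a)"
  proof (rule L2_norm_bounded[OF ab])
    show "(\<lambda>x. f x - trig a b A c x) \<in> borel_measurable (Omega a b)"
      by (intro L2_measurable L2_diff f trig_L2 A)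
    have "AE x in Omega a b. x \<in> {a<..<b}" by (rule AE_I2) simp
    with u(3) show "AE x in Omega a b. cmod (f x - trig a b A c x) \<le> d"
    proof eventually_elim
      case (elim x)
      then show ?case using A(2)[of x] by (simp add: less_imp_le)
    qed
  qed (use d in simp)
  finally have "(L2_norm a b (\<lambda>x. f x - PN a b K f x))\<^sup>2 \<le> (d * sqrt (b - a))\<^sup>2"
    by (intro power_mono) auto
  also have "\<dots> = e" using d ab by (simp add: power_mult_distrib)
  finally have 1: "(L2_norm a b (\<lambda>x. f x - PN a b K f x))\<^sup>2 \<le> e" .
  have "(\<Sum>l\<in>freqs K. (cmod (fcoeff a b f l))\<^sup>2)
      = (\<Sum>l\<in>freqs K - freqs N. (cmod (fcoeff a b f l))\<^sup>2) + (\<Sum>l\<in>freqs N. (cmod (fcoeff a b f l))\<^sup>2)"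
    by (rule sum.subset_diff) (use freqs_mono K in auto)
  then have "(L2_norm a b (\<lambda>x. f x - PN a b N f x))\<^sup>2 = (L2_norm a b (\<lambda>x. f x - PN a b K f x))\<^sup>2
      + (b - a) * (\<Sum>l\<in>freqs K - freqs N. (cmod (fcoeff a b f l))\<^sup>2)"
    unfolding L2_norm_diff_PN_square[OF ab f] by (simp add: algebra_simps)
  then show "(L2_norm a b (\<lambda>x. f x - PN a b N f x))\<^sup>2 \<le> B + e" using 1 B[of K] by linarith
qed

lemma freq_in_freqs_le:
  assumes "a < b" "0 < N" "l \<in> freqs N"
  shows "\<bar>freq a b l\<bar> \<le> pi / ((b - a) / real N)"
proof -
  have "2 * \<bar>l\<bar> \<le> int N" using assms(3) by (auto simp: freqs_def)
  then have "2 * \<bar>real_of_int l\<bar> \<le> real N" by linarith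
  then have "pi * (2 * \<bar>real_of_int l\<bar>) \<le> pi * real N" by (intro mult_left_mono) auto
  then have "pi * (2 * \<bar>real_of_int l\<bar>) / (b - a) \<le> pi * real N / (b - a)"
    using assms by (intro divide_right_mono) auto
  then show ?thesis using assms by (simp add: freq_def abs_mult mult_ac)
qed

text \<open>Evenness of \<open>N\<close> matters: \<open>freqs N\<close> then runs from -N/2 to N/2
  - 1, so an index outside it has modulus at least N/2.\<close>

lemma freq_notin_freqs_ge:
  assumes "a < b" "0 < N" "even N" "l \<notin> freqs N"
  shows "pi / ((b - a) / real N) \<le> \<bar>freq a b l\<bar>"
proof -
  have "int N \<le> 2 * \<bar>l\<bar>" using assms(3,4) by (auto simp: freqs_def elim!: evenE)
  then have "real N \<le> 2 * \<bar>real_of_int l\<bar>" by linarith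
  then have "pi * real N \<le> pi * (2 * \<bar>real_of_int l\<bar>)" by (intro mult_left_mono) auto
  then have "pi * real N / (b - a) \<le> pi * (2 * \<bar>real_of_int l\<bar>) / (b - a)"
    using assms by (intro divide_right_mono) auto
  then show ?thesis using assms by (simp add: freq_def abs_mult mult_ac)
qed

text \<open>Outside \<open>freqs N\<close> a frequency has modulus at least 1 / h, so each
  coefficient of \<open>f\<close> is at most h^m times that of \<open>g\<close>, and Bessel's
  inequality for \<open>g\<close> sums up the tail. The case m = 2 serves the solution, m = 1 its
  derivative, both with the second derivative as \<open>g\<close>.\<close>

lemma PN_error:
  assumes ab: "a < b" and N: "0 < N" "even N" and f: "f \<in> L2 a b" and g: "g \<in> L2 a b"
    and u: "continuous_on {a..b} u" "u a = u b" "AE x in Omega a b. u x = f x"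
    and fg: "\<And>l. cmod (fcoeff a b g l) = \<bar>freq a b l\<bar> ^ m * cmod (fcoeff a b f l)"
  shows "L2_norm a b (\<lambda>x. f x - PN a b N f x) \<le> ((b - a) / real N) ^ m * L2_norm a b g"
proof (rule power2_le_imp_le)
  define h where "h = (b - a) / real N"
  have h: "0 < h" using ab N by (simp add: h_def)
  show "(L2_norm a b (\<lambda>x. f x - PN a b N f x))\<^sup>2 \<le> (((b - a) / real N) ^ m * L2_norm a b g)\<^sup>2"
    unfolding h_def[symmetric]
  proof (rule PN_tail_bound[OF ab f u])
    fix K
    have "cmod (fcoeff a b f l) \<le> h ^ m * cmod (fcoeff a b g l)" if "l \<in> freqs K - freqs N" for l
    proof -
      have "1 \<le> pi" using pi_ge_two by linarith
      have "1 / h \<le> pi / h" using \<open>1 \<le> pi\<close> h by (simp add: divide_right_mono)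
      also have "pi / h \<le> \<bar>freq a b l\<bar>" using freq_notin_freqs_ge[OF ab N] that by (simp add: h_def)
      finally have "1 \<le> h * \<bar>freq a b l\<bar>" using h by (simp add: field_simps)
      then have "1 \<le> (h * \<bar>freq a b l\<bar>) ^ m" by (rule one_le_power)
      then have "1 * cmod (fcoeff a b f l) \<le> (h * \<bar>freq a b l\<bar>) ^ m * cmod (fcoeff a b f l)"
        by (rule mult_right_mono) simp
      then show ?thesis by (simp add: fg power_mult_distrib mult_ac)
    qed
    then have "(\<Sum>l\<in>freqs K - freqs N. (cmod (fcoeff a b f l))\<^sup>2) \<le> (\<Sum>l\<in>freqs K - freqs N. (h ^ m * cmod (fcoeff a b g l))\<^sup>2)"
      by (intro sum_mono power_mono) auto
    then have "(b - a) * (\<Sum>l\<in>freqs K - freqs N. (cmod (fcoeff a b f l))\<^sup>2)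
        \<le> (b - a) * (\<Sum>l\<in>freqs K - freqs N. (h ^ m * cmod (fcoeff a b g l))\<^sup>2)"
      using ab by (intro mult_left_mono) auto
    also have "\<dots> = (h ^ m)\<^sup>2 * ((b - a) * (\<Sum>l\<in>freqs K - freqs N. (cmod (fcoeff a b g l))\<^sup>2))"
      by (simp add: power_mult_distrib sum_distrib_left[symmetric] mult_ac)
    also have "\<dots> \<le> (h ^ m)\<^sup>2 * (L2_norm a b g)\<^sup>2"
      by (intro mult_left_mono Bessel ab g) auto
    finally show "(b - a) * (\<Sum>l\<in>freqs K - freqs N. (cmod (fcoeff a b f l))\<^sup>2) \<le> (h ^ m * L2_norm a b g)\<^sup>2"
      by (simp add: power_mult_distrib)
  qed
qed (use ab in simp)

lemma L2_norm_trig_mono: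
  assumes ab: "a < b" and A: "finite A" and le: "\<And>l. l \<in> A \<Longrightarrow> cmod (c l) \<le> r * cmod (d l)" and "0 \<le> r"
  shows "L2_norm a b (trig a b A c) \<le> r * L2_norm a b (trig a b A d)"
proof (rule power2_le_imp_le)
  have "(\<Sum>l\<in>A. (cmod (c l))\<^sup>2) \<le> (\<Sum>l\<in>A. (r * cmod (d l))\<^sup>2)"
    by (intro sum_mono power_mono le) auto
  also have "\<dots> = r\<^sup>2 * (\<Sum>l\<in>A. (cmod (d l))\<^sup>2)" by (simp add: power_mult_distrib sum_distrib_left)
  finally have "(b - a) * (\<Sum>l\<in>A. (cmod (c l))\<^sup>2) \<le> (b - a) * (r\<^sup>2 * (\<Sum>l\<in>A. (cmod (d l))\<^sup>2))"
    using ab by (intro mult_left_mono) auto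
  then show "(L2_norm a b (trig a b A c))\<^sup>2 \<le> (r * L2_norm a b (trig a b A d))\<^sup>2"
    unfolding power_mult_distrib L2_norm_trig[OF ab A] by (simp add: mult_ac)
qed (use \<open>0 \<le> r\<close> in simp)

lemma inverse_inequality:
  assumes ab: "a < b" and N: "0 < N"
  shows "L2_norm a b (trig a b (freqs N) (\<lambda>l. \<i> * of_real (freq a b l) * c l))
    \<le> pi / ((b - a) / real N) * L2_norm a b (trig a b (freqs N) c)"
proof (rule L2_norm_trig_mono[OF ab finite_freqs])
  show "cmod (\<i> * of_real (freq a b l) * c l) \<le> pi / ((b - a) / real N) * cmod (c l)" if "l \<in> freqs N" for l
    using mult_right_mono[OF freq_in_freqs_le[OF ab N that] norm_ge_zero[of "c l"]]
    by (simp only: norm_mult norm_ii norm_of_real mult_1_left)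
qed (use ab in simp)

lemma PN_norm_le:
  assumes "a < b" "f \<in> L2 a b"
  shows "L2_norm a b (PN a b N f) \<le> L2_norm a b f"
  by (rule power2_le_imp_le)
    (simp_all add: PN_eq_trig L2_norm_trig[OF assms(1) finite_freqs] Bessel[OF assms(1) finite_freqs assms(2)])

section \<open>Sobolev norms\<close>

text \<open>\<open>Hsob_norm\<close> is defined through the choice in \<open>wderiv\<close>;
  uniqueness up to null sets allows any known weak derivatives in its place.\<close>

lemma Hsob_norm_eq:
  assumes ab: "a < b" and f: "has_weak_deriv a b f f1"
  shows "Hsob_norm a b 1 f = sqrt ((L2_norm a b f)\<^sup>2 + (L2_norm a b f1)\<^sup>2)"
    and "has_weak_deriv a b f1 f2 \<Longrightarrow>
      Hsob_norm a b 2 f = sqrt ((L2_norm a b f)\<^sup>2 + (L2_norm a b f1)\<^sup>2 + (L2_norm a b f2)\<^sup>2)"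
proof -
  note w = has_weak_deriv_wderiv[OF f] and e = wderiv_AE_eq[OF ab f]
  have 1: "L2_norm a b (wderiv a b f) = L2_norm a b f1"
    by (rule L2_norm_cong_AE[OF has_weak_deriv_L2(2)[OF w] has_weak_deriv_L2(2)[OF f] e])
  have 2: "L2_norm a b (wderiv a b (wderiv a b f)) = L2_norm a b f2" if f1: "has_weak_deriv a b f1 f2"
  proof -
    have "AE x in Omega a b. f1 x = wderiv a b f x" using e by eventually_elim simp
    then have w2: "has_weak_deriv a b (wderiv a b f) f2"
      by (intro has_weak_deriv_cong_AE[OF f1] has_weak_deriv_L2[OF w] has_weak_deriv_L2[OF f1]) auto
    show ?thesis
      by (rule L2_norm_cong_AE[OF has_weak_deriv_L2(2)[OF has_weak_deriv_wderiv[OF w2]]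
            has_weak_deriv_L2(2)[OF f1] wderiv_AE_eq[OF ab w2]])
  qed
  show "Hsob_norm a b 1 f = sqrt ((L2_norm a b f)\<^sup>2 + (L2_norm a b f1)\<^sup>2)"
    by (simp add: Hsob_norm_def 1)
  show "has_weak_deriv a b f1 f2 \<Longrightarrow>
      Hsob_norm a b 2 f = sqrt ((L2_norm a b f)\<^sup>2 + (L2_norm a b f1)\<^sup>2 + (L2_norm a b f2)\<^sup>2)"
    by (simp add: Hsob_norm_def numeral_2_eq_2 1 2)
qed

lemma sqrt_sum_squares3_le: "0 \<le> x \<Longrightarrow> 0 \<le> y \<Longrightarrow> 0 \<le> z \<Longrightarrow> sqrt (x\<^sup>2 + y\<^sup>2 + z\<^sup>2) \<le> x + y + z"
  by (rule real_le_lsqrt) (simp_all add: power2_eq_square algebra_simps)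

lemma Hsob_norm_le:
  assumes ab: "a < b" and f: "has_weak_deriv a b f f1"
  shows "Hsob_norm a b 1 f \<le> L2_norm a b f + L2_norm a b f1"
    and "has_weak_deriv a b f1 f2 \<Longrightarrow> Hsob_norm a b 2 f \<le> L2_norm a b f + L2_norm a b f1 + L2_norm a b f2"
  using Hsob_norm_eq[OF assms] sqrt_sum_squares3_le[of "L2_norm a b f" "L2_norm a b f1" 0]
    sqrt_sum_squares3_le[of "L2_norm a b f" "L2_norm a b f1" "L2_norm a b f2"] by simp_all

lemma Hper_2_weak_derivs:
  assumes ab: "a < b" and f: "f \<in> Hper a b 2"
  shows "has_weak_deriv a b f (wderiv a b f)"
    and "has_weak_deriv a b (wderiv a b f) ((wderiv a b ^^ 2) f)"
proof -
  obtain g g' where g: "has_weak_deriv a b f g" "has_weak_deriv a b g g'"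
    using f by (auto simp: Hper_def numeral_2_eq_2)
  show w: "has_weak_deriv a b f (wderiv a b f)" by (rule has_weak_deriv_wderiv[OF g(1)])
  have "AE x in Omega a b. g x = wderiv a b f x" using wderiv_AE_eq[OF ab g(1)] by eventually_elim simp
  then have "has_weak_deriv a b (wderiv a b f) g'"
    by (intro has_weak_deriv_cong_AE[OF g(2)] has_weak_deriv_L2[OF w] has_weak_deriv_L2[OF g(2)]) auto
  then show "has_weak_deriv a b (wderiv a b f) ((wderiv a b ^^ 2) f)"
    using has_weak_deriv_wderiv by (simp add: numeral_2_eq_2)
qed

lemma Hper_2_periodic:
  assumes "f \<in> Hper a b 2"
  obtains u v where "continuous_on {a..b} u" "AE x in Omega a b. u x = f x" "u a = u b"
    "continuous_on {a..b} v" "AE x in Omega a b. v x = wderiv a b f x" "v a = v b"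
proof -
  have "\<forall>k<2. \<exists>u. continuous_on {a..b} u \<and> (AE x in Omega a b. u x = (wderiv a b ^^ k) f x) \<and> u a = u b"
    using assms by (simp add: Hper_def)
  from this[rule_format, of 0] this[rule_format, of 1] show thesis using that by auto
qed

lemma ii_mult_twice: "\<i> * r * (\<i> * r * z) = - (r\<^sup>2) * z"
proof -
  have "\<i> * r * (\<i> * r * z) = (\<i> * \<i>) * (r * r) * z"
    by (simp only: mult_ac)
  then show ?thesis by (simp add: power2_eq_square)
qed

text \<open>Each of the two boundary conditions in \<open>Hper a b 2\<close> removes the boundary
  terms of one integration by parts.\<close>

lemma Hper_2_fcoeff:
  assumes ab: "a < b" and f: "f \<in> Hper a b 2"
  shows "fcoeff a b (wderiv a b f) l = \<i> * of_real (freq a b l) * fcoeff a b f l"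
    and "fcoeff a b ((wderiv a b ^^ 2) f) l = - of_real ((freq a b l)\<^sup>2) * fcoeff a b f l"
proof -
  obtain u v where u: "continuous_on {a..b} u" "AE x in Omega a b. u x = f x" "u a = u b"
    and v: "continuous_on {a..b} v" "AE x in Omega a b. v x = wderiv a b f x" "v a = v b"
    by (rule Hper_2_periodic[OF f])
  note w = Hper_2_weak_derivs[OF ab f]
  show 1: "fcoeff a b (wderiv a b f) l = \<i> * of_real (freq a b l) * fcoeff a b f l"
    by (rule fcoeff_weak_deriv[OF ab w(1) u])
  have 2: "fcoeff a b ((wderiv a b ^^ 2) f) l = \<i> * of_real (freq a b l) * fcoeff a b (wderiv a b f) l"
    by (rule fcoeff_weak_deriv[OF ab w(2) v])
  show "fcoeff a b ((wderiv a b ^^ 2) f) l = - of_real ((freq a b l)\<^sup>2) * fcoeff a b f l"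
    unfolding 2 1 ii_mult_twice of_real_power ..
qed

lemma Hper_2_PN_error:
  assumes ab: "a < b" and f: "f \<in> Hper a b 2" and N: "0 < N" "even N"
  shows "L2_norm a b (\<lambda>x. f x - PN a b N f x) \<le> ((b - a) / real N)\<^sup>2 * L2_norm a b ((wderiv a b ^^ 2) f)"
    and "L2_norm a b (\<lambda>x. wderiv a b f x - PN a b N (wderiv a b f) x)
      \<le> ((b - a) / real N) * L2_norm a b ((wderiv a b ^^ 2) f)"
proof -
  obtain u v where u: "continuous_on {a..b} u" "AE x in Omega a b. u x = f x" "u a = u b"
    and v: "continuous_on {a..b} v" "AE x in Omega a b. v x = wderiv a b f x" "v a = v b"
    by (rule Hper_2_periodic[OF f])
  note w = Hper_2_weak_derivs[OF ab f]
  note fc = Hper_2_fcoeff[OF ab f]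
  show "L2_norm a b (\<lambda>x. f x - PN a b N f x) \<le> ((b - a) / real N)\<^sup>2 * L2_norm a b ((wderiv a b ^^ 2) f)"
    by (rule PN_error[OF ab N has_weak_deriv_L2(1)[OF w(1)] has_weak_deriv_L2(2)[OF w(2)] u(1,3,2)])
      (simp add: fc norm_mult norm_power)
  have "L2_norm a b (\<lambda>x. wderiv a b f x - PN a b N (wderiv a b f) x)
      \<le> ((b - a) / real N) ^ 1 * L2_norm a b ((wderiv a b ^^ 2) f)"
    by (rule PN_error[OF ab N has_weak_deriv_L2(1)[OF w(2)] has_weak_deriv_L2(2)[OF w(2)] v(1,3,2)])
      (simp add: fc norm_mult norm_power power2_eq_square del: funpow.simps)
  then show "L2_norm a b (\<lambda>x. wderiv a b f x - PN a b N (wderiv a b f) x)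
      \<le> ((b - a) / real N) * L2_norm a b ((wderiv a b ^^ 2) f)" by simp
qed

section \<open>The logarithmic nonlinearity\<close>

definition flog :: "complex \<Rightarrow> complex" where
  "flog z = of_real (ln ((cmod z)\<^sup>2)) * z"

lemma Bop_eq: "Bop V lam f x = of_real (V x) * f x + of_real lam * flog (f x)"
  by (simp add: Bop_def flog_def)

lemma flog_0 [simp]: "flog 0 = 0"
  by (simp add: flog_def)

lemma flog_eq: "z \<noteq> 0 \<Longrightarrow> flog z = of_real (2 * ln (cmod z)) * z"
  by (simp add: flog_def ln_realpow)

text \<open>The logarithm of one modulus is split off as the factor of \<open>z - w\<close>. What
  remains is a difference of logarithms times \<open>w\<close>, which \<open>ln_diff_mult_le\<close>
  bounds without any logarithm if \<open>w\<close> has the smaller modulus.\<close>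

lemma flog_diff_eq:
  "z \<noteq> 0 \<Longrightarrow> w \<noteq> 0 \<Longrightarrow>
    flog z - flog w = of_real (2 * ln (cmod z)) * (z - w) + of_real (2 * (ln (cmod z) - ln (cmod w))) * w"
  by (simp add: flog_eq algebra_simps)

lemma ln_diff_mult_le:
  assumes "0 < y" "y \<le> x"
  shows "0 \<le> ln x - ln y" "(ln x - ln y) * y \<le> x - (y :: real)"
proof -
  show "0 \<le> ln x - ln y" using assms by simp
  have "ln (x / y) \<le> x / y - 1" using assms by (intro ln_le_minus_one) simp
  then have "ln x - ln y \<le> x / y - 1" using assms by (simp add: ln_div)
  then have "(ln x - ln y) * y \<le> (x / y - 1) * y" using assms by (intro mult_right_mono) auto
  also have "(x / y - 1) * y = x - y" using assms by (simp add: left_diff_distrib)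
  finally show "(ln x - ln y) * y \<le> x - y" .
qed

text \<open>The threshold \<open>e\<close> separates two cases. If the larger modulus is at least
  \<open>e\<close>, its logarithm is bounded; otherwise both values have size e |ln e|, which the
  additive \<open>e\<close> pays for. A free \<open>e\<close> permits \<tau> as threshold for
  increments in time and \<open>h\<^sup>2\<close> for the error in space.\<close>

lemma flog_diff_le_ordered:
  fixes z w :: complex
  assumes e: "0 < e" "e \<le> 1" and R: "1 \<le> R" "cmod z \<le> R" and le: "cmod w \<le> cmod z"
  shows "cmod (flog z - flog w) \<le> 4 * (\<bar>ln e\<bar> + ln R + 1) * (cmod (z - w) + e)"
proof -
  define L where "L = \<bar>ln e\<bar> + ln R + 1"
  have R0: "0 \<le> ln R" using R by simp
  have L: "1 \<le> L" using R0 by (simp add: L_def)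
  have "cmod (flog z - flog w) \<le> 4 * L * (cmod (z - w) + e)"
  proof (cases "e \<le> cmod z")
    case True
    then have z: "z \<noteq> 0" using e by auto
    have "ln e \<le> ln (cmod z)" "ln (cmod z) \<le> ln R" using True e z le R by simp_all
    then have lnz: "\<bar>ln (cmod z)\<bar> \<le> L" using R0 by (simp add: L_def)
    have "cmod (flog z - flog w) \<le> 2 * \<bar>ln (cmod z)\<bar> * cmod (z - w) + 2 * cmod (z - w)"
    proof (cases "w = 0")
      case False
      have "cmod (flog z - flog w) \<le> cmod (of_real (2 * ln (cmod z)) * (z - w)) + cmod (of_real (2 * (ln (cmod z) - ln (cmod w))) * w)"
        unfolding flog_diff_eq[OF z False] by (rule norm_triangle_ineq)
      also have "cmod (of_real (2 * ln (cmod z)) * (z - w)) = 2 * \<bar>ln (cmod z)\<bar> * cmod (z - w)"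
        by (simp only: norm_mult norm_of_real abs_mult)
      also have "cmod (of_real (2 * (ln (cmod z) - ln (cmod w))) * w) = 2 * ((ln (cmod z) - ln (cmod w)) * cmod w)"
        using ln_diff_mult_le(1)[of "cmod w" "cmod z"] False le by (simp only: norm_mult norm_of_real abs_mult) simp
      also have "(ln (cmod z) - ln (cmod w)) * cmod w \<le> cmod (z - w)"
        using ln_diff_mult_le(2)[of "cmod w" "cmod z"] False le norm_triangle_ineq2[of z w] by simp
      finally show ?thesis by simp
    qed (simp add: flog_eq[OF z] norm_mult)
    also have "\<dots> \<le> 2 * L * cmod (z - w) + 2 * L * cmod (z - w)"
      using lnz L by (intro add_mono mult_right_mono mult_left_mono) auto
    also have "\<dots> \<le> 4 * L * (cmod (z - w) + e)"
      using e L by (simp add: distrib_left)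
    finally show ?thesis .
  next
    case False
    \<comment> \<open>Below the threshold ln |y| is ln e plus a difference of logarithms that the
      factor |y| controls, so the bound is uniform down to 0.\<close>
    have small: "cmod (flog y) \<le> 2 * e * L" if y: "cmod y < e" for y
    proof (cases "y = 0")
      case nz: False
      have ly: "ln (cmod y) \<le> 0" using nz y e by (intro ln_le_zero_iff[THEN iffD2]) auto
      have "\<bar>ln (cmod y)\<bar> * cmod y = (ln e - ln (cmod y)) * cmod y - ln e * cmod y"
        using ly by (simp add: algebra_simps)
      also have "\<dots> \<le> (e - cmod y) + \<bar>ln e\<bar> * cmod y"
        using ln_diff_mult_le(2)[of "cmod y" e] nz y e mult_right_mono[of "- ln e" "\<bar>ln e\<bar>" "cmod y"] by simp
      also have "\<dots> \<le> e + \<bar>ln e\<bar> * e"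
        using y by (intro add_mono mult_left_mono) auto
      also have "\<dots> \<le> e * L" using e R0 by (simp add: L_def algebra_simps)
      finally show ?thesis unfolding flog_eq[OF nz] by (simp only: norm_mult norm_of_real abs_mult abs_numeral)
    qed (use e L in simp)
    have "cmod (flog z - flog w) \<le> 2 * e * L + 2 * e * L"
      using norm_triangle_ineq4[of "flog z" "flog w"] small[of z] small[of w] False le by linarith
    also have "\<dots> \<le> 4 * L * (cmod (z - w) + e)"
      using L by (simp add: algebra_simps)
    finally show ?thesis .
  qed
  then show ?thesis by (simp add: L_def)
qed

lemma flog_diff_le:
  fixes z w :: complex
  assumes "0 < e" "e \<le> 1" "1 \<le> R" "cmod z \<le> R" "cmod w \<le> R"
  shows "cmod (flog z - flog w) \<le> 4 * (\<bar>ln e\<bar> + ln R + 1) * (cmod (z - w) + e)"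
  using flog_diff_le_ordered[of e R z w] flog_diff_le_ordered[of e R w z] assms
  by (cases "cmod w \<le> cmod z") (simp_all add: norm_minus_commute)

text \<open>This property, due to Cazenave and Haraux, replaces Lipschitz continuity in the energy
  estimate.\<close>

lemma flog_one_sided_Lipschitz_ordered:
  assumes le: "cmod w \<le> cmod z"
  shows "\<bar>Im (cnj (z - w) * (flog z - flog w))\<bar> \<le> 2 * (cmod (z - w))\<^sup>2"
proof (cases "w = 0 \<or> z = 0")
    case True
    then show ?thesis
    proof
      assume "w = 0"
      then have "cnj (z - w) * (flog z - flog w) = of_real (ln ((cmod z)\<^sup>2) * (cmod z)\<^sup>2)"
        by (simp add: flog_def complex_norm_square mult_ac del: of_real_power)
      then show ?thesis by (simp del: of_real_mult)
    next
      assume "z = 0"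
      then show ?thesis using le by simp
    qed
  next
    case False
    let ?d = "ln (cmod z) - ln (cmod w)"
    \<comment> \<open>The first summand of \<open>flog_diff_eq\<close> becomes a real multiple of
      the squared distance and has no imaginary part: this is how the unbounded logarithm drops
      out.\<close>
    have "cnj (z - w) * (flog z - flog w) = of_real (2 * ln (cmod z) * (cmod (z - w))\<^sup>2) + of_real (2 * ?d) * (cnj (z - w) * w)"
      using False by (simp add: flog_diff_eq complex_norm_square[of "z - w"] distrib_left mult_ac del: of_real_power complex_cnj_diff)
    moreover have "Im (of_real r * u) = r * Im u" for r u by simp
    ultimately have "\<bar>Im (cnj (z - w) * (flog z - flog w))\<bar> = 2 * (\<bar>?d\<bar> * \<bar>Im (cnj (z - w) * w)\<bar>)"
      by (simp only: plus_complex.sel Im_complex_of_real add_0_left abs_mult abs_numeral mult.assoc)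
    also have "\<dots> \<le> 2 * (\<bar>?d\<bar> * (cmod (z - w) * cmod w))"
      using abs_Im_le_cmod[of "cnj (z - w) * w"] by (intro mult_left_mono) (simp_all add: norm_mult del: complex_cnj_diff)
    also have "\<dots> = 2 * (cmod (z - w) * (?d * cmod w))"
      using ln_diff_mult_le(1)[of "cmod w" "cmod z"] False le by simp
    also have "\<dots> \<le> 2 * (cmod (z - w) * cmod (z - w))"
      using ln_diff_mult_le(2)[of "cmod w" "cmod z"] False le norm_triangle_ineq2[of z w]
      by (intro mult_left_mono) auto
    finally show ?thesis by (simp add: power2_eq_square)
  qed

lemma flog_one_sided_Lipschitz:
  "\<bar>Im (cnj (z - w) * (flog z - flog w))\<bar> \<le> 2 * (cmod (z - w))\<^sup>2"
proof -
  have "cnj (z - w) * (flog z - flog w) = cnj (w - z) * (flog w - flog z)" by (simp add: algebra_simps)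
  then show ?thesis
    using flog_one_sided_Lipschitz_ordered[of w z] flog_one_sided_Lipschitz_ordered[of z w]
    unfolding norm_minus_commute[of w z] by (metis linear)
qed

section \<open>The full nonlinearity with potential\<close>

lemma Bop_measurable:
  assumes [measurable]: "V \<in> borel_measurable (Omega a b)" "f \<in> borel_measurable (Omega a b)"
  shows "Bop V lam f \<in> borel_measurable (Omega a b)"
  unfolding Bop_def[abs_def] by measurable

lemma Bop_diff_pointwise:
  assumes "0 < e" "e \<le> 1" "1 \<le> R" "cmod (f x) \<le> R" "cmod (g x) \<le> R" "\<bar>V x\<bar> \<le> M"
  shows "cmod (Bop V lam f x - Bop V lam g x)
    \<le> (M + 4 * \<bar>lam\<bar>) * (\<bar>ln e\<bar> + ln R + 1) * (cmod (f x - g x) + e)"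
proof -
  let ?L = "\<bar>ln e\<bar> + ln R + 1"
  have L: "1 \<le> ?L" using assms by simp
  have "Bop V lam f x - Bop V lam g x = of_real (V x) * (f x - g x) + of_real lam * (flog (f x) - flog (g x))"
    by (simp add: Bop_eq algebra_simps)
  then have "cmod (Bop V lam f x - Bop V lam g x) \<le> \<bar>V x\<bar> * cmod (f x - g x) + \<bar>lam\<bar> * cmod (flog (f x) - flog (g x))"
    using norm_triangle_ineq[of "of_real (V x) * (f x - g x)" "of_real lam * (flog (f x) - flog (g x))"]
    by (simp add: norm_mult)
  also have "\<dots> \<le> M * (?L * (cmod (f x - g x) + e)) + \<bar>lam\<bar> * (4 * ?L * (cmod (f x - g x) + e))"
  proof (intro add_mono mult_left_mono flog_diff_le assms)
    have "1 * (cmod (f x - g x)) \<le> ?L * (cmod (f x - g x) + e)"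
      using L assms by (intro mult_mono) auto
    then show "\<bar>V x\<bar> * cmod (f x - g x) \<le> M * (?L * (cmod (f x - g x) + e))"
      using assms by (intro mult_mono) auto
  qed auto
  finally show ?thesis by (simp add: algebra_simps)
qed

lemma Bop_L2:
  assumes V: "V \<in> borel_measurable (Omega a b)" "AE x in Omega a b. \<bar>V x\<bar> \<le> M"
    and f: "f \<in> borel_measurable (Omega a b)" "AE x in Omega a b. cmod (f x) \<le> R"
  shows "Bop V lam f \<in> L2 a b"
proof (rule L2_bounded[OF Bop_measurable[OF V(1) f(1)]])
  show "AE x in Omega a b. cmod (Bop V lam f x) \<le> (M + 4 * \<bar>lam\<bar>) * (\<bar>ln 1\<bar> + ln (max 1 R) + 1) * (max 1 R + 1)"
    using V(2) f(2)
  proof eventually_elim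
    case (elim x)
    \<comment> \<open>Comparison with the zero function, where \<open>Bop\<close> vanishes, at
      threshold 1.\<close>
    have "cmod (Bop V lam f x - Bop V lam (\<lambda>x. 0) x) \<le> (M + 4 * \<bar>lam\<bar>) * (\<bar>ln 1\<bar> + ln (max 1 R) + 1) * (cmod (f x - 0) + 1)"
      using elim by (intro Bop_diff_pointwise[where g="\<lambda>x. 0"]) auto
    also have "\<dots> \<le> (M + 4 * \<bar>lam\<bar>) * (\<bar>ln 1\<bar> + ln (max 1 R) + 1) * (max 1 R + 1)"
      using elim by (intro mult_left_mono mult_nonneg_nonneg) auto
    finally show ?case by (simp add: Bop_eq)
  qed
qed

lemma Bop_diff_L2_norm:
  assumes ab: "a < b" and e: "0 < e" "e \<le> 1" and R: "1 \<le> R"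
    and V: "V \<in> borel_measurable (Omega a b)" "AE x in Omega a b. \<bar>V x\<bar> \<le> M" "0 \<le> M"
    and f: "f \<in> borel_measurable (Omega a b)" "AE x in Omega a b. cmod (f x) \<le> R"
    and g: "g \<in> borel_measurable (Omega a b)" "AE x in Omega a b. cmod (g x) \<le> R"
  shows "L2_norm a b (\<lambda>x. Bop V lam f x - Bop V lam g x)
    \<le> (M + 4 * \<bar>lam\<bar>) * (\<bar>ln e\<bar> + ln R + 1) * (L2_norm a b (\<lambda>x. f x - g x) + e * sqrt (b - a))"
proof (rule L2_norm_affine_bound[OF ab])
  show "(\<lambda>x. Bop V lam f x - Bop V lam g x) \<in> L2 a b"
    by (intro L2_diff Bop_L2[OF V(1,2) f] Bop_L2[OF V(1,2) g])
  show "(\<lambda>x. f x - g x) \<in> L2 a b"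
    using f g by (intro L2_diff L2_bounded)
  show "AE x in Omega a b. cmod (Bop V lam f x - Bop V lam g x)
    \<le> (M + 4 * \<bar>lam\<bar>) * (\<bar>ln e\<bar> + ln R + 1) * (cmod (f x - g x) + e)"
    using V(2) f(2) g(2) by eventually_elim (intro Bop_diff_pointwise e R)
qed (use assms in auto)

text \<open>The real-valued potential contributes a real multiple of the squared distance, invisible
  to the imaginary part; the rest is \<open>flog_one_sided_Lipschitz\<close> under the
  integral.\<close>

lemma Bop_one_sided_Lipschitz:
  assumes V: "V \<in> borel_measurable (Omega a b)" "AE x in Omega a b. \<bar>V x\<bar> \<le> M"
    and f: "f \<in> borel_measurable (Omega a b)" "AE x in Omega a b. cmod (f x) \<le> R"
    and g: "g \<in> borel_measurable (Omega a b)" "AE x in Omega a b. cmod (g x) \<le> R"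
  shows "\<bar>Im (LINT x|Omega a b. cnj (f x - g x) * (Bop V lam f x - Bop V lam g x))\<bar>
    \<le> 2 * \<bar>lam\<bar> * (L2_norm a b (\<lambda>x. f x - g x))\<^sup>2"
proof -
  have d: "(\<lambda>x. f x - g x) \<in> L2 a b" using f g by (intro L2_diff L2_bounded)
  have B: "(\<lambda>x. Bop V lam f x - Bop V lam g x) \<in> L2 a b" by (intro L2_diff Bop_L2[OF V(1,2) f] Bop_L2[OF V(1,2) g])
  have i: "integrable (Omega a b) (\<lambda>x. cnj (f x - g x) * (Bop V lam f x - Bop V lam g x))"
    by (intro integrable_L2_mult L2_cnj d B)
  have pw: "\<bar>Im (cnj (f x - g x) * (Bop V lam f x - Bop V lam g x))\<bar> \<le> 2 * \<bar>lam\<bar> * (cmod (f x - g x))\<^sup>2" for x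
  proof -
    have "cnj (f x - g x) * (Bop V lam f x - Bop V lam g x)
        = of_real (V x * (cmod (f x - g x))\<^sup>2) + of_real lam * (cnj (f x - g x) * (flog (f x) - flog (g x)))"
      unfolding Bop_eq of_real_mult complex_norm_square by (simp add: algebra_simps)
    then have "\<bar>Im (cnj (f x - g x) * (Bop V lam f x - Bop V lam g x))\<bar> = \<bar>lam\<bar> * \<bar>Im (cnj (f x - g x) * (flog (f x) - flog (g x)))\<bar>"
      by (simp only: plus_complex.sel Im_complex_of_real Im_complex_of_real times_complex.sel(2)[of "of_real lam"]) (simp only: Re_complex_of_real mult_zero_left add_0_left add_0_right abs_mult)
    also have "\<dots> \<le> \<bar>lam\<bar> * (2 * (cmod (f x - g x))\<^sup>2)"
      by (intro mult_left_mono flog_one_sided_Lipschitz) simp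
    finally show ?thesis by simp
  qed
  have "\<bar>Im (LINT x|Omega a b. cnj (f x - g x) * (Bop V lam f x - Bop V lam g x))\<bar>
      = \<bar>LINT x|Omega a b. Im (cnj (f x - g x) * (Bop V lam f x - Bop V lam g x))\<bar>"
    by (simp only: integral_Im[OF i])
  also have "\<dots> \<le> (LINT x|Omega a b. \<bar>Im (cnj (f x - g x) * (Bop V lam f x - Bop V lam g x))\<bar>)"
    by (rule integral_abs_bound)
  also have "\<dots> \<le> (LINT x|Omega a b. 2 * \<bar>lam\<bar> * (cmod (f x - g x))\<^sup>2)"
    by (intro integral_mono integrable_abs integrable_Im i integrable_mult_right L2_integrable_square d pw)
  also have "\<dots> = 2 * \<bar>lam\<bar> * (L2_norm a b (\<lambda>x. f x - g x))\<^sup>2"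
    by (simp add: L2_norm_square)
  finally show ?thesis .
qed

section \<open>Properties of the exact solution\<close>

text \<open>Essential suprema bound the data at almost every time only. A good time arbitrarily
  close to any given one, together with continuity in L2, extends the bounds to every time in
  [0, T].\<close>

lemma AE_interval_dense:
  fixes T t \<delta> :: real
  assumes "0 < T" and ae: "AE s in lebesgue_on {0..T}. P s" and t: "t \<in> {0..T}" and "0 < \<delta>"
  obtains s where "s \<in> {0..T}" "s \<noteq> t" "\<bar>s - t\<bar> < \<delta>" "P s"
proof -
  \<comment> \<open>The interval lies to the right of \<open>t\<close>, except for
    \<open>t = T\<close>, where it has to lie to the left.\<close>
  define c d where "c = (if t < T then t else max 0 (t - \<delta>))" and "d = (if t < T then min T (t + \<delta>) else t)"
  have I: "c < d" "{c<..<d} \<subseteq> {0..T}" "\<And>s. s \<in> {c<..<d} \<Longrightarrow> s \<noteq> t \<and> \<bar>s - t\<bar> < \<delta>"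
    using assms by (auto simp: c_def d_def split: if_splits)
  have "\<exists>s\<in>{c<..<d}. P s"
  proof (rule ccontr)
    assume "\<not> (\<exists>s\<in>{c<..<d}. P s)"
    then have no: "\<And>s. s \<in> {c<..<d} \<Longrightarrow> \<not> P s" by blast
    have "AE s in lebesgue. s \<in> {0..T} \<longrightarrow> P s"
      using ae by (subst (asm) AE_restrict_space_iff) auto
    then have "AE s in lebesgue. s \<notin> {c<..<d}"
    proof eventually_elim
      case (elim s)
      then show ?case using no[of s] I(2) by blast
    qed
    then have "{c<..<d} \<in> null_sets lebesgue" by (subst AE_iff_null_sets) auto
    then have "emeasure lborel {c<..<d} = 0" by (simp add: null_sets_def)
    then show False using I(1) by simp
  qed
  then show thesis using that I by blast
qed

lemma complex_mean_value_bound: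
  fixes f :: "real \<Rightarrow> complex"
  assumes d: "\<And>x. x \<in> {c..d} \<Longrightarrow> (f has_vector_derivative f' x) (at x within {c..d})"
    and B: "\<And>x. x \<in> {c..d} \<Longrightarrow> cmod (f' x) \<le> B" and xy: "x \<in> {c..d}" "y \<in> {c..d}"
  shows "cmod (f x - f y) \<le> B * \<bar>x - y\<bar>"
proof -
  have "norm (f x - f y) \<le> B * norm (x - y)"
  proof (rule differentiable_bound[OF convex_real_interval(5)])
    fix z assume z: "z \<in> {c..d}"
    show "(f has_derivative (\<lambda>h. h *\<^sub>R f' z)) (at z within {c..d})"
      using d[OF z] by (simp add: has_vector_derivative_def)
    show "onorm (\<lambda>h. h *\<^sub>R f' z) \<le> B"
    proof (rule onorm_le)
      show "norm (h *\<^sub>R f' z) \<le> B * norm h" for h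
        using mult_left_mono[OF B[OF z], of "\<bar>h\<bar>"] by (simp add: mult.commute)
    qed
  qed (use xy in auto)
  then show ?thesis by simp
qed

locale logSE =
  fixes a b lam T M :: real and V :: "real \<Rightarrow> real" and \<psi>0 :: "real \<Rightarrow> complex"
    and \<psi> \<psi>t :: "real \<Rightarrow> real \<Rightarrow> complex"
  assumes ab: "a < b" and T: "0 < T" and V: "V \<in> Linf a b"
    and sol: "logSE_solution a b T V lam \<psi>0 \<psi> \<psi>t"
    and bound: "data_bound a b T V \<psi> \<psi>t = ereal M"
begin

lemma data_bounds:
  "time_Linf T (\<lambda>t. ereal (L2_norm a b (\<psi>t t))) \<le> ereal M"
  "time_Linf T (\<lambda>t. Linf_norm a b (\<psi> t)) \<le> ereal M"
  "Linf_norm a b V \<le> ereal M"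
  unfolding bound[symmetric] data_bound_def by (intro Max_ge; simp)+

lemma V_measurable: "V \<in> borel_measurable (Omega a b)"
  using V by (simp add: Linf_def)

lemma V_bound: "AE x in Omega a b. \<bar>V x\<bar> \<le> M"
proof -
  have "AE x in Omega a b. ereal (norm (V x)) \<le> Linf_norm a b V"
    unfolding Linf_norm_def by (rule esssup_AE)
  then show ?thesis
  proof eventually_elim
    case (elim x)
    then have "ereal (norm (V x)) \<le> ereal M" using data_bounds(3) by (rule order_trans)
    then show ?case by simp
  qed
qed

lemma \<psi>_Hper: "t \<in> {0..T} \<Longrightarrow> \<psi> t \<in> Hper a b 2"
  using sol by (simp add: logSE_solution_def C_Hper_def)

lemma \<psi>_L2: "t \<in> {0..T} \<Longrightarrow> \<psi> t \<in> L2 a b"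
  using sol by (simp add: logSE_solution_def C1_L2_def)

lemma \<psi>t_L2: "t \<in> {0..T} \<Longrightarrow> \<psi>t t \<in> L2 a b"
  using sol by (simp add: logSE_solution_def C1_L2_def)

lemma \<psi>t_norm_le:
  assumes t: "t \<in> {0..T}"
  shows "L2_norm a b (\<psi>t t) \<le> M"
proof (rule field_le_epsilon)
  fix e :: real assume "0 < e"
  have "AE s in lebesgue_on {0..T}. ereal (L2_norm a b (\<psi>t s)) \<le> esssup (lebesgue_on {0..T}) (\<lambda>t. ereal (L2_norm a b (\<psi>t t)))"
    by (rule esssup_AE)
  then have ae: "AE s in lebesgue_on {0..T}. L2_norm a b (\<psi>t s) \<le> M"
  proof eventually_elim
    case (elim s)
    then have "ereal (L2_norm a b (\<psi>t s)) \<le> ereal M"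
      using data_bounds(1) unfolding time_Linf_def by (rule order_trans)
    then show ?case by simp
  qed
  have "((\<lambda>s. L2_norm a b (\<lambda>x. \<psi>t s x - \<psi>t t x)) \<longlongrightarrow> 0) (at t within {0..T})"
    using sol t by (simp add: logSE_solution_def C1_L2_def)
  then have "\<forall>\<^sub>F s in at t within {0..T}. L2_norm a b (\<lambda>x. \<psi>t s x - \<psi>t t x) < e"
    using \<open>0 < e\<close> by (rule order_tendstoD)
  then obtain \<delta> where \<delta>: "0 < \<delta>" "\<And>s. s \<in> {0..T} \<Longrightarrow> s \<noteq> t \<Longrightarrow> dist s t < \<delta> \<Longrightarrow> L2_norm a b (\<lambda>x. \<psi>t s x - \<psi>t t x) < e"
    unfolding eventually_at by blast
  obtain s where s: "s \<in> {0..T}" "s \<noteq> t" "\<bar>s - t\<bar> < \<delta>" "L2_norm a b (\<psi>t s) \<le> M"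
    by (rule AE_interval_dense[OF T ae t \<delta>(1)])
  have "L2_norm a b (\<psi>t t) \<le> L2_norm a b (\<psi>t s) + L2_norm a b (\<lambda>x. \<psi>t t x - \<psi>t s x)"
    by (intro L2_norm_triangle \<psi>t_L2 s t)
  then show "L2_norm a b (\<psi>t t) \<le> M + e"
    using \<delta>(2)[of s] s L2_norm_minus_commute[of a b "\<psi>t t" "\<psi>t s"] by (simp add: dist_real_def)
qed

lemma M_nonneg: "0 \<le> M"
  by (rule order_trans[OF L2_norm_nonneg \<psi>t_norm_le[of 0]]) (use T in simp)

text \<open>Passage to scalar functions of time: by Cauchy-Schwarz, pairing with a fixed
  \<open>w\<close> turns convergence of difference quotients in L2 into an ordinary derivative.
  Later \<open>w\<close> is the conjugate of an increment of the solution, or a character.\<close>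

lemma integral_\<psi>_has_vector_derivative:
  assumes w: "w \<in> L2 a b" and t: "t \<in> {0..T}"
  shows "((\<lambda>s. LINT x|Omega a b. w x * \<psi> s x) has_vector_derivative (LINT x|Omega a b. w x * \<psi>t t x)) (at t within {0..T})"
  unfolding has_vector_derivative_def has_derivative_iff_norm
proof (intro conjI bounded_linear_scaleR_left)
  let ?I = "\<lambda>s. LINT x|Omega a b. w x * \<psi> s x" and ?J = "LINT x|Omega a b. w x * \<psi>t t x"
  let ?q = "\<lambda>s x. (\<psi> s x - \<psi> t x) / of_real (s - t) - \<psi>t t x"
  have q: "((\<lambda>s. L2_norm a b (?q s)) \<longlongrightarrow> 0) (at t within {0..T})"
    using sol t by (simp add: logSE_solution_def C1_L2_def)
  have "\<forall>\<^sub>F s in at t within {0..T}. norm (norm (?I s - ?I t - (s - t) *\<^sub>R ?J) / norm (s - t)) \<le> L2_norm a b w * L2_norm a b (?q s)"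
    unfolding eventually_at_filter
  proof (intro always_eventually allI impI)
    fix s assume s: "s \<noteq> t" "s \<in> {0..T}"
    let ?r = "complex_of_real (s - t)"
    have r: "?r \<noteq> 0" using s by simp
    have L: "(\<lambda>x. (1 / ?r) * (\<psi> s x - \<psi> t x)) \<in> L2 a b"
      by (intro L2_cmult L2_diff \<psi>_L2 s t)
    then have qL: "?q s \<in> L2 a b"
      using L2_diff[OF L \<psi>t_L2[OF t]] by simp
    have "(LINT x|Omega a b. w x * ?q s x) = (LINT x|Omega a b. (1 / ?r) * (w x * \<psi> s x - w x * \<psi> t x) - w x * \<psi>t t x)"
      by (intro Bochner_Integration.integral_cong refl) (simp add: algebra_simps diff_divide_distrib)
    also have "\<dots> = (1 / ?r) * (?I s - ?I t) - ?J"
      by (subst Bochner_Integration.integral_diff, intro integrable_mult_right Bochner_Integration.integrable_diff integrable_L2_mult w \<psi>_L2 s t,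
        intro integrable_L2_mult w \<psi>t_L2 t, simp only: integral_mult_right_zero,
        subst Bochner_Integration.integral_diff) (intro integrable_L2_mult w \<psi>_L2 s t refl)+
    finally have e: "(LINT x|Omega a b. w x * ?q s x) = (1 / ?r) * (?I s - ?I t) - ?J" .
    have "?I s - ?I t - (s - t) *\<^sub>R ?J = ?r * (LINT x|Omega a b. w x * ?q s x)"
      unfolding e using r by (simp add: right_diff_distrib scaleR_conv_of_real)
    then have "norm (?I s - ?I t - (s - t) *\<^sub>R ?J) = norm (s - t) * cmod (LINT x|Omega a b. w x * ?q s x)"
      by (simp only: norm_mult norm_of_real real_norm_def)
    then have "norm (?I s - ?I t - (s - t) *\<^sub>R ?J) / norm (s - t) = cmod (LINT x|Omega a b. w x * ?q s x)"
      using s by simp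
    then show "norm (norm (?I s - ?I t - (s - t) *\<^sub>R ?J) / norm (s - t)) \<le> L2_norm a b w * L2_norm a b (?q s)"
      using Cauchy_Schwarz_L2[OF w qL] by (simp only: real_norm_def abs_norm_cancel)
  qed
  then show "((\<lambda>s. norm (?I s - ?I t - (s - t) *\<^sub>R ?J) / norm (s - t)) \<longlongrightarrow> 0) (at t within {0..T})"
    by (rule Lim_null_comparison) (use tendsto_mult[OF tendsto_const q, of "L2_norm a b w"] in simp)
qed

text \<open>Duality instead of a vector-valued integral: the conjugated increment itself is the test
  function, and the mean value inequality is applied to the scalar pairing.\<close>

lemma \<psi>_Lipschitz:
  assumes s: "s \<in> {0..T}" and t: "t \<in> {0..T}"
  shows "L2_norm a b (\<lambda>x. \<psi> s x - \<psi> t x) \<le> M * \<bar>s - t\<bar>"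
proof -
  define d where "d x = \<psi> s x - \<psi> t x" for x
  define w where "w x = cnj (d x)" for x
  have dL: "d \<in> L2 a b" unfolding d_def[abs_def] by (intro L2_diff \<psi>_L2 s t)
  then have w: "w \<in> L2 a b" and nw: "L2_norm a b w = L2_norm a b d"
    unfolding w_def[abs_def] by (simp_all add: L2_cnj L2_norm_cnj)
  let ?I = "\<lambda>s. LINT x|Omega a b. w x * \<psi> s x"
  have "cmod (?I s - ?I t) \<le> (L2_norm a b w * M) * \<bar>s - t\<bar>"
  proof (rule complex_mean_value_bound[OF integral_\<psi>_has_vector_derivative[OF w]])
    fix r assume r: "r \<in> {0..T}"
    have "cmod (LINT x|Omega a b. w x * \<psi>t r x) \<le> L2_norm a b w * L2_norm a b (\<psi>t r)"
      by (intro Cauchy_Schwarz_L2 w \<psi>t_L2 r)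
    also have "\<dots> \<le> L2_norm a b w * M" by (intro mult_left_mono \<psi>t_norm_le r) simp
    finally show "cmod (LINT x|Omega a b. w x * \<psi>t r x) \<le> L2_norm a b w * M" .
  qed (use s t in auto)
  moreover have "?I s - ?I t = (LINT x|Omega a b. w x * d x)"
    unfolding d_def right_diff_distrib
    by (intro Bochner_Integration.integral_diff[symmetric] integrable_L2_mult w \<psi>_L2 s t)
  moreover have "(LINT x|Omega a b. w x * d x) = of_real ((L2_norm a b d)\<^sup>2)"
    unfolding L2_norm_square_complex w_def ..
  ultimately have "(L2_norm a b d)\<^sup>2 \<le> (L2_norm a b d * M) * \<bar>s - t\<bar>"
    by (simp only: norm_of_real nw)
  then have "L2_norm a b d * L2_norm a b d \<le> L2_norm a b d * (M * \<bar>s - t\<bar>)"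
    by (simp add: power2_eq_square mult_ac)
  then have "L2_norm a b d \<le> M * \<bar>s - t\<bar>"
    using L2_norm_nonneg[of a b d] M_nonneg
    by (cases "L2_norm a b d = 0") (auto simp: mult_le_cancel_left)
  then show ?thesis by (simp add: d_def[abs_def])
qed

text \<open>The excess of the modulus over \<open>M\<close> at time \<open>t\<close> is dominated by
  the increment from a good time s, hence has L2 norm at most M |t - s|; s may be taken arbitrarily
  close to \<open>t\<close>.\<close>

lemma \<psi>_bound:
  assumes t: "t \<in> {0..T}"
  shows "AE x in Omega a b. cmod (\<psi> t x) \<le> M"
proof -
  have ae: "AE s in lebesgue_on {0..T}. AE x in Omega a b. cmod (\<psi> s x) \<le> M"
  proof -
    have "AE s in lebesgue_on {0..T}. Linf_norm a b (\<psi> s) \<le> esssup (lebesgue_on {0..T}) (\<lambda>t. Linf_norm a b (\<psi> t))"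
      by (rule esssup_AE)
    then show ?thesis
    proof eventually_elim
      case (elim s)
      then have s: "Linf_norm a b (\<psi> s) \<le> ereal M"
        using data_bounds(2) unfolding time_Linf_def by (rule order_trans)
      have "AE x in Omega a b. ereal (norm (\<psi> s x)) \<le> Linf_norm a b (\<psi> s)"
        unfolding Linf_norm_def by (rule esssup_AE)
      then show ?case
      proof eventually_elim
        case (elim x)
        then have "ereal (norm (\<psi> s x)) \<le> ereal M" using s by (rule order_trans)
        then show ?case by simp
      qed
    qed
  qed
  define p where "p x = complex_of_real (max 0 (cmod (\<psi> t x) - M))" for x
  have [measurable]: "\<psi> t \<in> borel_measurable (Omega a b)" using \<psi>_L2[OF t] by (rule L2_measurable)
  have pm: "p \<in> borel_measurable (Omega a b)" unfolding p_def[abs_def] by measurable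
  have ple: "cmod (p x) \<le> cmod (\<psi> t x)" for x
    using M_nonneg by (simp add: p_def)
  have pL: "p \<in> L2 a b"
    unfolding L2_def using pm ple L2_integrable_square[OF \<psi>_L2[OF t]]
    by (auto intro!: Bochner_Integration.integrable_bound[of _ "\<lambda>x. (cmod (\<psi> t x))\<^sup>2"] power_mono)
  have "L2_norm a b p \<le> 0"
  proof (rule field_le_epsilon)
    fix e :: real assume "0 < e"
    define \<delta> where "\<delta> = e / (M + 1)"
    have \<delta>: "0 < \<delta>" using \<open>0 < e\<close> M_nonneg by (simp add: \<delta>_def)
    obtain s where s: "s \<in> {0..T}" "s \<noteq> t" "\<bar>s - t\<bar> < \<delta>" "AE x in Omega a b. cmod (\<psi> s x) \<le> M"
      by (rule AE_interval_dense[OF T ae t \<delta>])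
    have "L2_norm a b p \<le> L2_norm a b (\<lambda>x. \<psi> t x - \<psi> s x)"
    proof (rule L2_norm_mono_AE[OF pL L2_diff[OF \<psi>_L2[OF t] \<psi>_L2[OF s(1)]]])
      show "AE x in Omega a b. cmod (p x) \<le> cmod (\<psi> t x - \<psi> s x)"
        using s(4)
      proof eventually_elim
        case (elim x)
        then show ?case using norm_triangle_ineq2[of "\<psi> t x" "\<psi> s x"] by (simp add: p_def)
      qed
    qed
    also have "\<dots> \<le> M * \<bar>t - s\<bar>" by (rule \<psi>_Lipschitz[OF t s(1)])
    also have "\<dots> \<le> (M + 1) * \<delta>" using s(3) M_nonneg by (intro mult_mono) auto
    also have "\<dots> = 0 + e" using M_nonneg by (simp add: \<delta>_def)
    finally show "L2_norm a b p \<le> 0 + e" .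
  qed
  then have "L2_norm a b p = 0" by (simp add: order_antisym)
  from L2_norm_eq_0_AE[OF pL this] show ?thesis
    by eventually_elim (simp add: p_def max_def split: if_splits)
qed

lemma \<psi>_norm_le: "t \<in> {0..T} \<Longrightarrow> L2_norm a b (\<psi> t) \<le> M * sqrt (b - a)"
  by (intro L2_norm_bounded ab \<psi>_bound M_nonneg L2_measurable \<psi>_L2)

lemma Bop_\<psi>_L2: "t \<in> {0..T} \<Longrightarrow> Bop V lam (\<psi> t) \<in> L2 a b"
  by (rule Bop_L2[OF V_measurable V_bound L2_measurable[OF \<psi>_L2] \<psi>_bound])

lemma equation_AE:
  assumes "t \<in> {0..T}"
  shows "AE x in Omega a b. \<i> * \<psi>t t x = Bop V lam (\<psi> t) x - (wderiv a b ^^ 2) (\<psi> t) x"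
proof -
  have "AE x in Omega a b. \<i> * \<psi>t t x = - (wderiv a b ^^ 2) (\<psi> t) x + Bop V lam (\<psi> t) x"
    using sol assms by (simp add: logSE_solution_def)
  then show ?thesis by eventually_elim simp
qed

text \<open>A bound for the second space derivative, read off from the equation: the log-Lipschitz
  bound against the zero function at threshold 1, plus \<open>M\<close> for the time
  derivative.\<close>

definition K2 :: real where
  "K2 = (M + 4 * \<bar>lam\<bar>) * (\<bar>ln 1\<bar> + ln (max 1 M) + 1) * (M * sqrt (b - a) + 1 * sqrt (b - a)) + M"

lemma K2_nonneg: "0 \<le> K2"
  using M_nonneg ab by (auto simp: K2_def intro!: mult_nonneg_nonneg add_nonneg_nonneg)

lemma wderiv2_\<psi>_norm_le:
  assumes t: "t \<in> {0..T}"
  shows "L2_norm a b ((wderiv a b ^^ 2) (\<psi> t)) \<le> K2"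
proof -
  note D = has_weak_deriv_L2(2)[OF Hper_2_weak_derivs(2)[OF ab \<psi>_Hper[OF t]]]
  have i: "(\<lambda>x. \<i> * \<psi>t t x) \<in> L2 a b" by (intro L2_cmult \<psi>t_L2 t)
  have B: "L2_norm a b (\<lambda>x. Bop V lam (\<psi> t) x - Bop V lam (\<lambda>x. 0) x)
      \<le> (M + 4 * \<bar>lam\<bar>) * (\<bar>ln 1\<bar> + ln (max 1 M) + 1) * (L2_norm a b (\<lambda>x. \<psi> t x - 0) + 1 * sqrt (b - a))"
  proof (rule Bop_diff_L2_norm[OF ab _ _ _ V_measurable V_bound M_nonneg L2_measurable[OF \<psi>_L2[OF t]]])
    show "AE x in Omega a b. cmod (\<psi> t x) \<le> max 1 M"
      using \<psi>_bound[OF t] by eventually_elim simp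
  qed auto
  have "L2_norm a b ((wderiv a b ^^ 2) (\<psi> t)) = L2_norm a b (\<lambda>x. Bop V lam (\<psi> t) x - \<i> * \<psi>t t x)"
  proof (rule L2_norm_cong_AE[OF D L2_diff[OF Bop_\<psi>_L2[OF t] i]])
    show "AE x in Omega a b. (wderiv a b ^^ 2) (\<psi> t) x = Bop V lam (\<psi> t) x - \<i> * \<psi>t t x"
      using equation_AE[OF t] by eventually_elim simp
  qed
  also have "\<dots> \<le> L2_norm a b (Bop V lam (\<psi> t)) + L2_norm a b (\<lambda>x. \<i> * \<psi>t t x)"
    by (rule L2_norm_diff[OF Bop_\<psi>_L2[OF t] i])
  also have "L2_norm a b (\<lambda>x. \<i> * \<psi>t t x) \<le> M"
    using \<psi>t_norm_le[OF t] by (simp add: L2_norm_cmult)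
  also have "L2_norm a b (Bop V lam (\<psi> t)) \<le> (M + 4 * \<bar>lam\<bar>) * (\<bar>ln 1\<bar> + ln (max 1 M) + 1) * (M * sqrt (b - a) + 1 * sqrt (b - a))"
  proof -
    have "L2_norm a b (Bop V lam (\<psi> t)) \<le> (M + 4 * \<bar>lam\<bar>) * (\<bar>ln 1\<bar> + ln (max 1 M) + 1) * (L2_norm a b (\<psi> t) + 1 * sqrt (b - a))"
    proof -
      have "(\<lambda>x. Bop V lam (\<psi> t) x - Bop V lam (\<lambda>x. 0) x) = Bop V lam (\<psi> t)"
        by (rule ext) (simp add: Bop_eq[of _ _ "\<lambda>x. 0"])
      then show ?thesis using B by simp
    qed
    also have "\<dots> \<le> (M + 4 * \<bar>lam\<bar>) * (\<bar>ln 1\<bar> + ln (max 1 M) + 1) * (M * sqrt (b - a) + 1 * sqrt (b - a))"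
      using M_nonneg by (intro mult_left_mono add_right_mono \<psi>_norm_le t mult_nonneg_nonneg) auto
    finally show ?thesis .
  qed
  finally show ?thesis by (simp add: K2_def)
qed

text \<open>The equation becomes an ordinary differential equation for every mode, with one-sided
  derivatives at the ends of [0, T].\<close>

lemma fcoeff_\<psi>_has_vector_derivative:
  assumes t: "t \<in> {0..T}"
  shows "((\<lambda>s. fcoeff a b (\<psi> s) l) has_vector_derivative
     - \<i> * (of_real ((freq a b l)\<^sup>2) * fcoeff a b (\<psi> t) l + fcoeff a b (Bop V lam (\<psi> t)) l)) (at t within {0..T})"
proof -
  note D = has_weak_deriv_L2(2)[OF Hper_2_weak_derivs(2)[OF ab \<psi>_Hper[OF t]]]
  have "((\<lambda>s. (LINT x|Omega a b. fbasis a b (- l) x * \<psi> s x) / of_real (b - a)) has_vector_derivative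
      (LINT x|Omega a b. fbasis a b (- l) x * \<psi>t t x) / of_real (b - a)) (at t within {0..T})"
    by (intro has_vector_derivative_divide integral_\<psi>_has_vector_derivative t fbasis_L2)
  then have d: "((\<lambda>s. fcoeff a b (\<psi> s) l) has_vector_derivative fcoeff a b (\<psi>t t) l) (at t within {0..T})"
    by (simp only: fcoeff_eq mult.commute[of "fbasis a b (- l) _"])
  have "\<i> * fcoeff a b (\<psi>t t) l = fcoeff a b (\<lambda>x. \<i> * \<psi>t t x) l"
    by (simp add: fcoeff_cmult)
  also have "\<dots> = fcoeff a b (\<lambda>x. Bop V lam (\<psi> t) x - (wderiv a b ^^ 2) (\<psi> t) x) l"
    by (rule fcoeff_cong_AE[OF L2_cmult[OF \<psi>t_L2[OF t]] L2_diff[OF Bop_\<psi>_L2[OF t] D] equation_AE[OF t]])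
  also have "\<dots> = of_real ((freq a b l)\<^sup>2) * fcoeff a b (\<psi> t) l + fcoeff a b (Bop V lam (\<psi> t)) l"
    using fcoeff_diff[OF Bop_\<psi>_L2[OF t] D] Hper_2_fcoeff(2)[OF ab \<psi>_Hper[OF t]] by simp
  finally have e: "\<i> * fcoeff a b (\<psi>t t) l = of_real ((freq a b l)\<^sup>2) * fcoeff a b (\<psi> t) l + fcoeff a b (Bop V lam (\<psi> t)) l" .
  have "fcoeff a b (\<psi>t t) l = - \<i> * (\<i> * fcoeff a b (\<psi>t t) l)" by simp
  then show ?thesis using d unfolding e by simp
qed

end

section \<open>The local error\<close>

lemma has_vector_derivative_exp_ii:
  "((\<lambda>s. exp (\<i> * of_real (s * m))) has_vector_derivative \<i> * of_real m * exp (\<i> * of_real (s * m))) (at s within A)"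
proof -
  have "((\<lambda>z. exp (\<i> * (z * of_real m))) has_field_derivative \<i> * of_real m * exp (\<i> * (of_real s * of_real m))) (at (of_real s))"
    by (auto intro!: derivative_eq_intros)
  from has_vector_derivative_real_field[OF this, of A] show ?thesis
    by (simp add: o_def)
qed

lemma varphi1_mult: "of_real s * varphi1 (\<i> * of_real (s * m)) = (if m = 0 then of_real s else (exp (\<i> * of_real (s * m)) - 1) / (\<i> * of_real m))"
  by (auto simp: varphi1_def)

text \<open>The differentiated function is the integral of the exponential from 0 to s, that is, the
  weight of a frozen nonlinearity in Duhamel's formula.\<close>

lemma has_vector_derivative_varphi1:
  "((\<lambda>s. of_real s * varphi1 (\<i> * of_real (s * m))) has_vector_derivative exp (\<i> * of_real (s * m))) (at s within A)"
proof (cases "m = 0")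
  case True
  have "(of_real has_vector_derivative (1::complex)) (at s within A)"
    using has_vector_derivative_of_real[OF DERIV_ident[of "at s within A"]] by simp
  then show ?thesis using True by (simp add: varphi1_def)
next
  case False
  have "((\<lambda>s. (exp (\<i> * of_real (s * m)) - 1) / (\<i> * of_real m)) has_vector_derivative
      (\<i> * of_real m * exp (\<i> * of_real (s * m)) - 0) / (\<i> * of_real m)) (at s within A)"
    by (intro has_vector_derivative_divide has_vector_derivative_diff has_vector_derivative_exp_ii has_vector_derivative_const)
  then show ?thesis using False by (simp only: varphi1_mult) simp
qed

text \<open>Pulling the unimodular factor out of a step of the scheme flips the sign in the argument
  of \<open>varphi1\<close>; local error and energy step both work with the remaining form.\<close>

lemma exp_mult_varphi1: "exp (- \<i> * of_real x) * varphi1 (\<i> * of_real x) = varphi1 (- \<i> * of_real x)"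
proof (cases "x = 0")
  case False
  have "exp (- \<i> * of_real x) * exp (\<i> * of_real x) = 1" by (simp add: exp_add[symmetric])
  then show ?thesis using False by (simp add: varphi1_def field_simps)
qed (simp add: varphi1_def)

lemma cmod_varphi1_le: "cmod (varphi1 (\<i> * of_real x)) \<le> 1"
  using iexp_approx1[of x 0] by (auto simp: varphi1_def norm_divide norm_mult divide_le_eq)

text \<open>The second-order Taylor remainder of the exponential, divided by x. It measures the
  defect of replacing \<open>varphi1\<close> by the constant 1.\<close>

lemma cmod_varphi1_minus_1_le: "cmod (varphi1 (\<i> * of_real x) - 1) \<le> \<bar>x\<bar>"
proof (cases "x = 0")
  case False
  have "cmod (exp (\<i> * of_real x) - 1 - \<i> * of_real x) * 2 \<le> x * x"
    using iexp_approx1[of x 1] by (simp add: power2_eq_square numeral_2_eq_2 diff_diff_eq)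
  then have "cmod (exp (\<i> * of_real x) - 1 - \<i> * of_real x) \<le> \<bar>x\<bar> * \<bar>x\<bar>"
    unfolding abs_mult_self_eq using norm_ge_zero[of "exp (\<i> * of_real x) - 1 - \<i> * of_real x"] by linarith
  moreover have "varphi1 (\<i> * of_real x) - 1 = (exp (\<i> * of_real x) - 1 - \<i> * of_real x) / (\<i> * of_real x)"
    using False by (simp add: varphi1_def diff_divide_distrib)
  ultimately show ?thesis using False by (simp add: norm_divide norm_mult divide_le_eq)
qed (simp add: varphi1_def)

context logSE
begin

text \<open>The local error is the increment of \<open>F l\<close> below, whose derivative only contains increments of
  the nonlinearity; testing with the increment itself avoids vector-valued integrals.\<close>

lemma local_error_le:
  assumes t: "0 \<le> t" "0 \<le> \<tau>" "t + \<tau> \<le> T" and A: "finite A"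
    and D: "\<And>s. s \<in> {0..\<tau>} \<Longrightarrow> L2_norm a b (\<lambda>x. Bop V lam (\<psi> (t + s)) x - Bop V lam (\<psi> t) x) \<le> D"
  shows "L2_norm a b (trig a b A (\<lambda>l. fcoeff a b (\<psi> (t + \<tau>)) l
      - (exp (- \<i> * of_real (\<tau> * (freq a b l)\<^sup>2)) * fcoeff a b (\<psi> t) l
         - \<i> * of_real \<tau> * (varphi1 (- \<i> * of_real (\<tau> * (freq a b l)\<^sup>2)) * fcoeff a b (Bop V lam (\<psi> t)) l))))
    \<le> \<tau> * D"
proof -
  let ?m = "\<lambda>l. (freq a b l)\<^sup>2"
  let ?b = "\<lambda>s l. fcoeff a b (Bop V lam (\<psi> (t + s))) l"
  \<comment> \<open>The integrating factor removes the free flow; the second summand is the Duhamel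
    integral of the nonlinearity frozen at time \<open>t\<close>, with the sign that cancels its
    leading contribution.\<close>
  define F where "F l s = exp (\<i> * of_real (s * ?m l)) * fcoeff a b (\<psi> (t + s)) l
     + \<i> * (of_real s * varphi1 (\<i> * of_real (s * ?m l))) * ?b 0 l" for l s
  define k where "k l = F l \<tau> - F l 0" for l
  have dF: "(F l has_vector_derivative - \<i> * exp (\<i> * of_real (s * ?m l)) * (?b s l - ?b 0 l)) (at s within {0..\<tau>})"
    if s: "s \<in> {0..\<tau>}" for l s
  proof -
    have ts: "t + s \<in> {0..T}" using s t by auto
    have "((\<lambda>s. fcoeff a b (\<psi> (t + s)) l) has_vector_derivative
       1 *\<^sub>R (- \<i> * (of_real (?m l) * fcoeff a b (\<psi> (t + s)) l + ?b s l))) (at s within {0..\<tau>})"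
    proof -
      have "((\<lambda>s. t + s) has_vector_derivative 1) (at s within {0..\<tau>})"
        by (auto intro!: derivative_eq_intros)
      moreover have "((\<lambda>s. fcoeff a b (\<psi> s) l) has_vector_derivative
          - \<i> * (of_real (?m l) * fcoeff a b (\<psi> (t + s)) l + ?b s l)) (at (t + s) within (\<lambda>s. t + s) ` {0..\<tau>})"
        by (rule has_vector_derivative_within_subset[OF fcoeff_\<psi>_has_vector_derivative[OF ts]]) (use t in auto)
      ultimately show ?thesis by (rule vector_diff_chain_within[unfolded o_def])
    qed
    from has_vector_derivative_add[OF has_vector_derivative_mult[OF has_vector_derivative_exp_ii this]
        has_vector_derivative_mult_left[OF has_vector_derivative_mult_right[OF has_vector_derivative_varphi1]], of "?m l" \<i> "?m l" "?b 0 l"]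
    show ?thesis unfolding F_def[abs_def]
      by (rule has_vector_derivative_eq_rhs) (simp add: algebra_simps)
  qed
  \<comment> \<open>The pairing of \<open>F\<close> with its own total increment \<open>k\<close>;
    over the whole step it grows by exactly the squared norm of \<open>k\<close>.\<close>
  define \<Lambda> where "\<Lambda> s = of_real (b - a) * (\<Sum>l\<in>A. cnj (k l) * F l s)" for s
  have "cmod (\<Lambda> \<tau> - \<Lambda> 0) \<le> (L2_norm a b (trig a b A k) * D) * \<bar>\<tau> - 0\<bar>"
  proof (rule complex_mean_value_bound)
    fix s assume s: "s \<in> {0..\<tau>}"
    show "(\<Lambda> has_vector_derivative of_real (b - a) * (\<Sum>l\<in>A. cnj (k l) * (- \<i> * exp (\<i> * of_real (s * ?m l)) * (?b s l - ?b 0 l)))) (at s within {0..\<tau>})"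
      unfolding \<Lambda>_def[abs_def]
      by (intro has_vector_derivative_mult_right has_vector_derivative_sum dF s)
    let ?c = "\<lambda>l. \<i> * k l * cnj (exp (\<i> * of_real (s * ?m l)))"
    have ts: "t + s \<in> {0..T}" "t + 0 \<in> {0..T}" using s t by auto
    note B = Bop_\<psi>_L2[OF ts(1)] Bop_\<psi>_L2[OF ts(2)]
    have eq1: "of_real (b - a) * (\<Sum>l\<in>A. cnj (k l) * (- \<i> * exp (\<i> * of_real (s * ?m l)) * (?b s l - ?b 0 l)))
       = of_real (b - a) * (\<Sum>l\<in>A. cnj (?c l) * fcoeff a b (\<lambda>x. Bop V lam (\<psi> (t + s)) x - Bop V lam (\<psi> (t + 0)) x) l)"
      unfolding fcoeff_diff[OF B] by (simp add: mult_ac)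
    have eq2: "\<dots> = (LINT x|Omega a b. cnj (trig a b A ?c x) * (Bop V lam (\<psi> (t + s)) x - Bop V lam (\<psi> (t + 0)) x))"
      by (rule integral_cnj_trig_mult[OF ab A L2_diff[OF B], symmetric])
    have "cmod (LINT x|Omega a b. cnj (trig a b A ?c x) * (Bop V lam (\<psi> (t + s)) x - Bop V lam (\<psi> (t + 0)) x)) \<le> L2_norm a b (\<lambda>x. cnj (trig a b A ?c x)) * L2_norm a b (\<lambda>x. Bop V lam (\<psi> (t + s)) x - Bop V lam (\<psi> (t + 0)) x)"
      by (intro Cauchy_Schwarz_L2 L2_cnj trig_L2 A L2_diff B)
    also have "\<dots> \<le> L2_norm a b (trig a b A k) * D"
    proof (intro mult_mono)
      have "L2_norm a b (trig a b A ?c) \<le> 1 * L2_norm a b (trig a b A k)"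
        by (rule L2_norm_trig_mono[OF ab A]) (simp_all add: norm_mult del: complex_cnj_mult)
      then show "L2_norm a b (\<lambda>x. cnj (trig a b A ?c x)) \<le> L2_norm a b (trig a b A k)"
        by (simp add: L2_norm_cnj)
    qed (use D[OF s] in auto)
    finally show "cmod (of_real (b - a) * (\<Sum>l\<in>A. cnj (k l) * (- \<i> * exp (\<i> * of_real (s * ?m l)) * (?b s l - ?b 0 l))))
        \<le> L2_norm a b (trig a b A k) * D" unfolding eq1 eq2 .
  qed (use t in auto)
  moreover have "\<Lambda> \<tau> - \<Lambda> 0 = of_real ((L2_norm a b (trig a b A k))\<^sup>2)"
  proof -
    have "\<Lambda> \<tau> - \<Lambda> 0 = of_real (b - a) * (\<Sum>l\<in>A. cnj (k l) * k l)"
      by (simp add: \<Lambda>_def right_diff_distrib[symmetric] sum_subtractf[symmetric] k_def[of _, symmetric])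
    also have "\<dots> = of_real ((b - a) * (\<Sum>l\<in>A. (cmod (k l))\<^sup>2))"
      by (simp add: complex_norm_square mult.commute del: of_real_power)
    finally show ?thesis by (simp only: L2_norm_trig[OF ab A])
  qed
  ultimately have "(L2_norm a b (trig a b A k))\<^sup>2 \<le> (L2_norm a b (trig a b A k) * D) * \<tau>"
    using t by (simp only: norm_of_real) simp
  then have "L2_norm a b (trig a b A k) * L2_norm a b (trig a b A k) \<le> L2_norm a b (trig a b A k) * (\<tau> * D)"
    by (simp add: power2_eq_square mult_ac)
  moreover have "0 \<le> D" using D[of 0] L2_norm_nonneg t by (meson atLeastAtMost_iff order_refl order_trans)
  ultimately have "L2_norm a b (trig a b A k) \<le> \<tau> * D"
    using L2_norm_nonneg[of a b "trig a b A k"] t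
    by (cases "L2_norm a b (trig a b A k) = 0") (auto simp: mult_le_cancel_left)
  moreover have "L2_norm a b (trig a b A (\<lambda>l. fcoeff a b (\<psi> (t + \<tau>)) l
      - (exp (- \<i> * of_real (\<tau> * ?m l)) * fcoeff a b (\<psi> t) l
         - \<i> * of_real \<tau> * (varphi1 (- \<i> * of_real (\<tau> * ?m l)) * fcoeff a b (Bop V lam (\<psi> t)) l))))
    \<le> 1 * L2_norm a b (trig a b A k)"
  proof (rule L2_norm_trig_mono[OF ab A])
    fix l
    \<comment> \<open>This unimodular factor undoes the integrating factor, so the increment
      \<open>k l\<close> and the local error of the mode have the same modulus.\<close>
    let ?e = "exp (- \<i> * of_real (\<tau> * ?m l))"
    have e1: "?e * exp (\<i> * of_real (\<tau> * ?m l)) = 1" by (simp add: exp_add[symmetric])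
    have "?e * k l = (?e * exp (\<i> * of_real (\<tau> * ?m l))) * fcoeff a b (\<psi> (t + \<tau>)) l
        + \<i> * of_real \<tau> * ((?e * varphi1 (\<i> * of_real (\<tau> * ?m l))) * ?b 0 l) - ?e * fcoeff a b (\<psi> t) l"
      by (simp add: k_def F_def algebra_simps)
    also have "\<dots> = fcoeff a b (\<psi> (t + \<tau>)) l
        + \<i> * of_real \<tau> * (varphi1 (- \<i> * of_real (\<tau> * ?m l)) * fcoeff a b (Bop V lam (\<psi> t)) l) - ?e * fcoeff a b (\<psi> t) l"
      by (simp only: e1 exp_mult_varphi1 mult_1_left add_0_right)
    finally have "fcoeff a b (\<psi> (t + \<tau>)) l - (?e * fcoeff a b (\<psi> t) l
         - \<i> * of_real \<tau> * (varphi1 (- \<i> * of_real (\<tau> * ?m l)) * fcoeff a b (Bop V lam (\<psi> t)) l)) = ?e * k l"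
      by simp
    moreover have "cmod (?e * k l) = cmod (k l)"
      by (simp add: norm_mult)
    ultimately show "cmod (fcoeff a b (\<psi> (t + \<tau>)) l - (?e * fcoeff a b (\<psi> t) l
         - \<i> * of_real \<tau> * (varphi1 (- \<i> * of_real (\<tau> * ?m l)) * fcoeff a b (Bop V lam (\<psi> t)) l))) \<le> 1 * cmod (k l)"
      by (simp only: mult_1_left order_refl)
  qed simp
  ultimately show ?thesis by linarith
qed

text \<open>The threshold \<tau> matches the size M \<tau> of the increment of the solution, so the
  nonlinearity changes by O(\<tau> |ln \<tau>|) within one step.\<close>

lemma Bop_\<psi>_time_increment:
  assumes t: "0 \<le> t" "t + s \<le> T" and s: "0 \<le> s" "s \<le> \<tau>" and \<tau>: "0 < \<tau>" "\<tau> \<le> 1"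
  shows "L2_norm a b (\<lambda>x. Bop V lam (\<psi> (t + s)) x - Bop V lam (\<psi> t) x)
    \<le> (M + 4 * \<bar>lam\<bar>) * (\<bar>ln \<tau>\<bar> + ln (max 1 M) + 1) * ((M + sqrt (b - a)) * \<tau>)"
proof -
  have tt: "t + s \<in> {0..T}" "t \<in> {0..T}" using t s by auto
  have b: "AE x in Omega a b. cmod (\<psi> r x) \<le> max 1 M" if "r \<in> {0..T}" for r
    using \<psi>_bound[OF that] by eventually_elim simp
  have "L2_norm a b (\<lambda>x. Bop V lam (\<psi> (t + s)) x - Bop V lam (\<psi> t) x)
    \<le> (M + 4 * \<bar>lam\<bar>) * (\<bar>ln \<tau>\<bar> + ln (max 1 M) + 1) * (L2_norm a b (\<lambda>x. \<psi> (t + s) x - \<psi> t x) + \<tau> * sqrt (b - a))"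
    by (intro Bop_diff_L2_norm ab \<tau> V_measurable V_bound M_nonneg L2_measurable \<psi>_L2 tt b) auto
  also have "\<dots> \<le> (M + 4 * \<bar>lam\<bar>) * (\<bar>ln \<tau>\<bar> + ln (max 1 M) + 1) * ((M + sqrt (b - a)) * \<tau>)"
  proof (intro mult_left_mono mult_nonneg_nonneg)
    have "L2_norm a b (\<lambda>x. \<psi> (t + s) x - \<psi> t x) \<le> M * \<bar>t + s - t\<bar>"
      by (rule \<psi>_Lipschitz[OF tt])
    also have "\<dots> \<le> M * \<tau>" using s M_nonneg by (intro mult_left_mono) auto
    finally show "L2_norm a b (\<lambda>x. \<psi> (t + s) x - \<psi> t x) + \<tau> * sqrt (b - a) \<le> (M + sqrt (b - a)) * \<tau>"
      by (simp add: algebra_simps)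
  qed (use M_nonneg in auto)
  finally show ?thesis .
qed

end

section \<open>A discrete Osgood and Gronwall argument\<close>

lemma real_of_nat_power_exp_le:
  fixes \<tau> B T :: real
  assumes "0 \<le> \<tau>" "0 \<le> B" "real n * \<tau> \<le> T"
  shows "(1 + \<tau> * B) ^ n \<le> exp (B * T)"
proof -
  have "(1 + \<tau> * B) ^ n \<le> exp (\<tau> * B) ^ n"
    using assms by (intro power_mono exp_ge_add_one_self) auto
  also have "\<dots> = exp (B * (real n * \<tau>))"
    by (simp add: exp_of_nat_mult[symmetric] mult_ac)
  also have "\<dots> \<le> exp (B * T)"
    using assms by (simp add: mult_left_mono)
  finally show ?thesis .
qed

text \<open>The logarithm of the error grows at most linearly (first part), hence is bounded, after which
  the recursion is an ordinary Gronwall inequality (second part).\<close>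

lemma discrete_osgood_gronwall:
  fixes L k K m T :: real
  assumes L: "0 \<le> L" and k: "0 \<le> k" and m: "1 \<le> m" and T: "0 < T"
  obtains C where "0 < C"
    "\<And>\<tau> q p E n. 0 < \<tau> \<Longrightarrow> \<tau> \<le> 1 \<Longrightarrow> 0 \<le> q \<Longrightarrow> q \<le> 1 \<Longrightarrow> 0 \<le> p \<Longrightarrow> p \<le> 1 \<Longrightarrow> E 0 = 0 \<Longrightarrow> (\<And>n. 0 \<le> E n) \<Longrightarrow>
      (\<And>n. real (Suc n) * \<tau> \<le> T \<Longrightarrow>
        (E (Suc n))\<^sup>2 \<le> (1 + \<tau>) * ((E n)\<^sup>2 + \<tau> * (L * (1 + ln (m + E n) + \<tau> * (ln (m + E n))\<^sup>2)) * (E n + k * q)\<^sup>2)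
          + 2 * \<tau> * (K * p)\<^sup>2) \<Longrightarrow>
      real n * \<tau> \<le> T \<Longrightarrow> E n \<le> C * (q + p)"
proof -
  \<comment> \<open>\<open>A\<close> makes \<open>m + E n\<close> at most (E n)^2 + A,
    \<open>B\<close> closes the recursion for \<open>ln ((E n)\<^sup>2 + A)\<close>,
    \<open>W\<close> bounds 1 plus this logarithm up to time \<open>T\<close>, and \<open>G\<close>
    is the Gronwall constant that results once it is bounded.\<close>
  define L' where "L' = 2 * L * (1 + k\<^sup>2)"
  define B where "B = 1 + 2 * L' + 2 * K\<^sup>2"
  define A where "A = m + 1"
  define W where "W = exp (2 * B * T) * (1 + ln A)"
  define G where "G = 1 + 4 * L * W\<^sup>2 + 4 * L * W\<^sup>2 * k\<^sup>2 + 2 * K\<^sup>2"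
  have L': "0 \<le> L'" using L by (simp add: L'_def)
  have B: "1 \<le> B" using L' by (simp add: B_def)
  have A: "2 \<le> A" using m by (simp add: A_def)
  have G: "1 \<le> G" using L by (simp add: G_def)
  show thesis
  proof (rule that)
    show "0 < exp (G * T)" by simp
    fix \<tau> q p :: real and E :: "nat \<Rightarrow> real" and n :: nat
    assume \<tau>: "0 < \<tau>" "\<tau> \<le> 1" and q: "0 \<le> q" "q \<le> 1" and p: "0 \<le> p" "p \<le> 1" and E0: "E 0 = 0" and E: "\<And>n. 0 \<le> E n"
      and rec: "\<And>n. real (Suc n) * \<tau> \<le> T \<Longrightarrow>
        (E (Suc n))\<^sup>2 \<le> (1 + \<tau>) * ((E n)\<^sup>2 + \<tau> * (L * (1 + ln (m + E n) + \<tau> * (ln (m + E n))\<^sup>2)) * (E n + k * q)\<^sup>2)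
          + 2 * \<tau> * (K * p)\<^sup>2"
      and n: "real n * \<tau> \<le> T"
    define y where "y n = ln ((E n)\<^sup>2 + A)" for n
    have Y: "0 \<le> ln (m + E n)" "ln (m + E n) \<le> y n" for n
    proof -
      show "0 \<le> ln (m + E n)" using m E[of n] by simp
      have "E n \<le> (E n)\<^sup>2 + 1"
        using zero_le_power2[of "E n - 1 / 2"] by (simp add: power2_eq_square algebra_simps)
      then have "m + E n \<le> (E n)\<^sup>2 + A" by (simp add: A_def)
      then show "ln (m + E n) \<le> y n" using m E[of n] A by (simp add: y_def add_nonneg_pos)
    qed
    have X: "(E n + k * q)\<^sup>2 \<le> 2 * (E n)\<^sup>2 + 2 * (k\<^sup>2 * q\<^sup>2)" for n
      using zero_le_power2[of "E n - k * q"] by (simp add: power2_eq_square algebra_simps)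
    have sq1: "q\<^sup>2 \<le> 1" "p\<^sup>2 \<le> 1" using q p by (auto intro: power_le_one)
    have y_step: "1 + y (Suc n) \<le> (1 + \<tau> * (2 * B)) * (1 + y n)" if n: "real (Suc n) * \<tau> \<le> T" for n
    proof -
      define Q where "Q = (E n)\<^sup>2 + A"
      define z where "z = y n"
      have Q: "1 \<le> Q" "(E n)\<^sup>2 \<le> Q" using A by (auto simp: Q_def intro: order_trans[of 1 A])
      have z: "0 \<le> z" using Y[of n] by (simp add: z_def)
      have X2: "(E n + k * q)\<^sup>2 \<le> 2 * (1 + k\<^sup>2) * Q"
      proof -
        have "k\<^sup>2 * q\<^sup>2 \<le> k\<^sup>2 * Q" using sq1(1) Q by (intro mult_left_mono) auto
        then show ?thesis using X[of n] Q by (simp add: algebra_simps)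
      qed
      have Y2: "1 + ln (m + E n) + \<tau> * (ln (m + E n))\<^sup>2 \<le> 1 + z + \<tau> * z\<^sup>2"
        using Y[of n] \<tau> by (intro add_mono mult_left_mono power_mono) (auto simp: z_def)
      have "\<tau> * (L * (1 + ln (m + E n) + \<tau> * (ln (m + E n))\<^sup>2)) * (E n + k * q)\<^sup>2
          \<le> \<tau> * (L * (1 + z + \<tau> * z\<^sup>2)) * (2 * (1 + k\<^sup>2) * Q)"
        using \<tau> L z Y[of n] by (intro mult_mono mult_left_mono Y2 X2 mult_nonneg_nonneg add_nonneg_nonneg) auto
      also have "\<dots> = \<tau> * (L' * (1 + z + \<tau> * z\<^sup>2)) * Q" by (simp add: L'_def mult_ac)
      finally have 1: "(E n)\<^sup>2 + \<tau> * (L * (1 + ln (m + E n) + \<tau> * (ln (m + E n))\<^sup>2)) * (E n + k * q)\<^sup>2 + A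
          \<le> Q * (1 + \<tau> * (L' * (1 + z + \<tau> * z\<^sup>2)))" by (simp add: Q_def algebra_simps)
      have "(K * p)\<^sup>2 \<le> K\<^sup>2 * Q"
        using sq1(2) Q unfolding power_mult_distrib by (intro mult_left_mono) auto
      then have 2: "2 * \<tau> * (K * p)\<^sup>2 \<le> Q * (2 * \<tau> * K\<^sup>2)"
        using \<tau> by (simp add: mult_ac)
      have "(E (Suc n))\<^sup>2 + A \<le> (1 + \<tau>) * ((E n)\<^sup>2 + \<tau> * (L * (1 + ln (m + E n) + \<tau> * (ln (m + E n))\<^sup>2)) * (E n + k * q)\<^sup>2 + A)
          + 2 * \<tau> * (K * p)\<^sup>2"
      proof -
        have "0 \<le> \<tau> * A" using \<tau> A by simp
        then show ?thesis using rec[OF n] by (simp only: distrib_left distrib_right mult_1_left)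
      qed
      also have "\<dots> \<le> (1 + \<tau>) * (Q * (1 + \<tau> * (L' * (1 + z + \<tau> * z\<^sup>2)))) + Q * (2 * \<tau> * K\<^sup>2)"
        using 1 2 \<tau> by (intro add_mono mult_left_mono) auto
      also have "\<dots> = Q * ((1 + \<tau>) * (1 + \<tau> * (L' * (1 + z + \<tau> * z\<^sup>2))) + 2 * \<tau> * K\<^sup>2)"
        by (simp add: algebra_simps)
      \<comment> \<open>A perfect square, so that taking logarithms adds at most 2 \<tau> B (1 + z)
        and \<open>1 + z\<close> grows by a factor 1 + 2 B \<tau>. Its quadratic part absorbs the
        term with \<tau>^2 z^2.\<close>
      also have "\<dots> \<le> Q * (1 + \<tau> * B * (1 + z))\<^sup>2"
      proof (rule mult_left_mono)
        have pos: "0 \<le> \<tau> * (L' * (1 + z + \<tau> * z\<^sup>2))" using \<tau> L' z by simp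
        have "(1 + \<tau>) * (1 + \<tau> * (L' * (1 + z + \<tau> * z\<^sup>2))) \<le> 1 + \<tau> + 2 * (\<tau> * (L' * (1 + z + \<tau> * z\<^sup>2)))"
          using mult_right_mono[OF \<tau>(2) pos] by (simp only: distrib_left distrib_right mult_1_left mult_1_right)
        also have "\<dots> + 2 * \<tau> * K\<^sup>2 = 1 + \<tau> * ((1 + 2 * L' + 2 * K\<^sup>2) + 2 * L' * z) + \<tau>\<^sup>2 * (2 * L') * z\<^sup>2"
          by (simp add: algebra_simps power2_eq_square)
        finally have "(1 + \<tau>) * (1 + \<tau> * (L' * (1 + z + \<tau> * z\<^sup>2))) + 2 * \<tau> * K\<^sup>2
            \<le> 1 + \<tau> * (B + 2 * L' * z) + \<tau>\<^sup>2 * (2 * L') * z\<^sup>2" by (simp add: B_def)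
        also have "\<dots> \<le> 1 + \<tau> * (2 * B + 2 * B * z) + \<tau>\<^sup>2 * B\<^sup>2 * (1 + z)\<^sup>2"
        proof -
          have LB: "2 * L' \<le> B" by (simp add: B_def)
          have "B * 1 \<le> B * B" using B by (intro mult_left_mono) auto
          then have LB2: "2 * L' \<le> B\<^sup>2" using LB by (simp add: power2_eq_square)
          have "2 * L' * z \<le> B * z" using LB z by (rule mult_right_mono)
          moreover have "0 \<le> B * z" using B z by simp
          ultimately have a: "B + 2 * L' * z \<le> 2 * B + 2 * B * z" using B by linarith
          have b: "z\<^sup>2 \<le> (1 + z)\<^sup>2" using z by (intro power_mono) auto
          have "\<tau> * (B + 2 * L' * z) \<le> \<tau> * (2 * B + 2 * B * z)"
            using \<tau> a by (intro mult_left_mono) auto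
          moreover have "\<tau>\<^sup>2 * (2 * L') * z\<^sup>2 \<le> \<tau>\<^sup>2 * B\<^sup>2 * (1 + z)\<^sup>2"
            using b LB2 L' by (intro mult_mono mult_left_mono) auto
          ultimately show ?thesis by linarith
        qed
        also have "\<dots> = (1 + \<tau> * B * (1 + z))\<^sup>2"
          by (simp add: power2_eq_square algebra_simps)
        finally show "(1 + \<tau>) * (1 + \<tau> * (L' * (1 + z + \<tau> * z\<^sup>2))) + 2 * \<tau> * K\<^sup>2 \<le> (1 + \<tau> * B * (1 + z))\<^sup>2" .
      qed (use Q in simp)
      finally have le: "(E (Suc n))\<^sup>2 + A \<le> Q * (1 + \<tau> * B * (1 + z))\<^sup>2" .
      have u: "0 \<le> \<tau> * B * (1 + z)" using \<tau> B z by simp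
      have "y (Suc n) \<le> ln (Q * (1 + \<tau> * B * (1 + z))\<^sup>2)"
        unfolding y_def using le A zero_le_power2[of "E (Suc n)"] Q u
        by (intro ln_mono) (auto simp: add_nonneg_pos)
      also have "\<dots> = z + 2 * ln (1 + \<tau> * B * (1 + z))"
        using Q u by (simp add: ln_mult ln_realpow z_def y_def Q_def add_nonneg_pos)
      also have "\<dots> \<le> z + 2 * (\<tau> * B * (1 + z))"
        using ln_add_one_self_le_self[OF u] by simp
      finally show ?thesis by (simp add: z_def algebra_simps)
    qed
    have yW: "1 + y n \<le> W" if "real n * \<tau> \<le> T" for n
    proof -
      have "1 + y n \<le> (1 + \<tau> * (2 * B)) ^ n * (1 + ln A)" if "real n * \<tau> \<le> T" for n
        using that
      proof (induction n)
        case 0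
        then show ?case by (simp add: y_def E0)
      next
        case (Suc n)
        have "real n * \<tau> \<le> real (Suc n) * \<tau>" using \<tau> by simp
        then have "1 + y n \<le> (1 + \<tau> * (2 * B)) ^ n * (1 + ln A)" using Suc by linarith
        then have "(1 + \<tau> * (2 * B)) * (1 + y n) \<le> (1 + \<tau> * (2 * B)) * ((1 + \<tau> * (2 * B)) ^ n * (1 + ln A))"
          using \<tau> B by (intro mult_left_mono) auto
        then show ?case using y_step[OF Suc.prems] by (simp add: mult.assoc)
      qed
      also have "(1 + \<tau> * (2 * B)) ^ n * (1 + ln A) \<le> W"
        unfolding W_def using real_of_nat_power_exp_le[of \<tau> "2 * B" n T] \<tau> B A that by (intro mult_right_mono) auto
      finally show ?thesis using that by simp
    qed
    have lin: "(E (Suc n))\<^sup>2 \<le> (1 + \<tau> * G) * (E n)\<^sup>2 + \<tau> * G * (q\<^sup>2 + p\<^sup>2)" if n: "real (Suc n) * \<tau> \<le> T" for n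
    proof -
      have "real n * \<tau> \<le> real (Suc n) * \<tau>" using \<tau> by simp
      then have w: "1 + y n \<le> W" using n by (intro yW) linarith
      let ?Y = "ln (m + E n)"
      \<comment> \<open>The logarithm is bounded by now, so the whole bracket becomes a
        constant.\<close>
      have "1 + ?Y + \<tau> * ?Y\<^sup>2 \<le> 1 + ?Y + 1 * ?Y\<^sup>2"
        using \<tau> by (intro add_left_mono mult_right_mono) auto
      also have "\<dots> \<le> (1 + ?Y)\<^sup>2" using Y[of n] by (simp add: power2_eq_square algebra_simps)
      also have "\<dots> \<le> W\<^sup>2" using Y[of n] w by (intro power_mono) auto
      finally have "\<tau> * (L * (1 + ?Y + \<tau> * ?Y\<^sup>2)) * (E n + k * q)\<^sup>2 \<le> \<tau> * (L * W\<^sup>2) * (2 * (E n)\<^sup>2 + 2 * (k\<^sup>2 * q\<^sup>2))"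
        using \<tau> L Y[of n] by (intro mult_mono mult_left_mono X mult_nonneg_nonneg add_nonneg_nonneg) auto
      then have "(E (Suc n))\<^sup>2 \<le> (1 + \<tau>) * ((E n)\<^sup>2 + \<tau> * (L * W\<^sup>2) * (2 * (E n)\<^sup>2 + 2 * (k\<^sup>2 * q\<^sup>2))) + 2 * \<tau> * (K * p)\<^sup>2"
        using \<tau> by (intro order_trans[OF rec[OF n]] add_right_mono mult_left_mono add_left_mono) auto
      also have "\<dots> \<le> ((1 + \<tau>) * (E n)\<^sup>2 + 2 * (\<tau> * (L * W\<^sup>2) * (2 * (E n)\<^sup>2 + 2 * (k\<^sup>2 * q\<^sup>2)))) + 2 * \<tau> * (K * p)\<^sup>2"
      proof -
        have gen: "(1 + \<tau>) * (e + P) \<le> (1 + \<tau>) * e + 2 * P" if "0 \<le> P" for e P :: real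
          using mult_right_mono[OF \<tau>(2) that] by (simp add: algebra_simps)
        have "0 \<le> \<tau> * (L * W\<^sup>2) * (2 * (E n)\<^sup>2 + 2 * (k\<^sup>2 * q\<^sup>2))" using \<tau> L by simp
        from gen[OF this] show ?thesis by (rule add_right_mono)
      qed
      also have "\<dots> = (E n)\<^sup>2 + \<tau> * ((1 + 4 * L * W\<^sup>2) * (E n)\<^sup>2 + 4 * L * W\<^sup>2 * k\<^sup>2 * q\<^sup>2 + 2 * K\<^sup>2 * p\<^sup>2)"
        by (simp add: power_mult_distrib algebra_simps)
      also have "\<dots> \<le> (E n)\<^sup>2 + \<tau> * (G * (E n)\<^sup>2 + G * q\<^sup>2 + G * p\<^sup>2)"
        using \<tau> L by (intro add_mono mult_left_mono mult_right_mono order_refl) (auto simp: G_def)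
      finally show ?thesis by (simp add: algebra_simps)
    qed
    have "(E n)\<^sup>2 + (q\<^sup>2 + p\<^sup>2) \<le> (1 + \<tau> * G) ^ n * (q\<^sup>2 + p\<^sup>2)" if "real n * \<tau> \<le> T" for n
      using that
    proof (induction n)
      case 0
      then show ?case by (simp add: E0)
    next
      case (Suc n)
      have "real n * \<tau> \<le> real (Suc n) * \<tau>" using \<tau> by simp
      then have IH: "(E n)\<^sup>2 + (q\<^sup>2 + p\<^sup>2) \<le> (1 + \<tau> * G) ^ n * (q\<^sup>2 + p\<^sup>2)" using Suc by linarith
      have "(E (Suc n))\<^sup>2 + (q\<^sup>2 + p\<^sup>2) \<le> (1 + \<tau> * G) * ((E n)\<^sup>2 + (q\<^sup>2 + p\<^sup>2))"
        using lin[OF Suc.prems] by (simp add: algebra_simps)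
      also have "\<dots> \<le> (1 + \<tau> * G) * ((1 + \<tau> * G) ^ n * (q\<^sup>2 + p\<^sup>2))"
        using IH \<tau> G by (intro mult_left_mono) auto
      finally show ?case by (simp add: mult.assoc)
    qed
    from this[OF n] have "(E n)\<^sup>2 \<le> (1 + \<tau> * G) ^ n * (q\<^sup>2 + p\<^sup>2)"
      using zero_le_power2[of q] zero_le_power2[of p] by linarith
    also have "\<dots> \<le> exp (G * T) * (q\<^sup>2 + p\<^sup>2)"
      using real_of_nat_power_exp_le[of \<tau> G n T] \<tau> G n by (intro mult_right_mono) auto
    \<comment> \<open>The constant is at least 1 and may be squared, which makes the right-hand side
      a square.\<close>
    also have "\<dots> \<le> (exp (G * T))\<^sup>2 * (q + p)\<^sup>2"
    proof (rule mult_mono)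
      have "1 \<le> exp (G * T)" using G T by simp
      then have "exp (G * T) * 1 \<le> exp (G * T) * exp (G * T)" by (intro mult_left_mono) auto
      then show "exp (G * T) \<le> (exp (G * T))\<^sup>2" by (simp add: power2_eq_square)
      show "q\<^sup>2 + p\<^sup>2 \<le> (q + p)\<^sup>2" using q p by (simp add: power2_eq_square algebra_simps)
    qed auto
    finally have "(E n)\<^sup>2 \<le> (exp (G * T) * (q + p))\<^sup>2" by (simp add: power_mult_distrib)
    then show "E n \<le> exp (G * T) * (q + p)"
      by (rule power2_le_imp_le) (use q p in simp)
  qed
qed

section \<open>The numerical scheme in Fourier space\<close>

text \<open>The terms outside \<open>A\<close> vanish, so the infinite sum reduces to a finite
  one.\<close>

lemma fourier_mult_trig:
  assumes "a < b" "finite A"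
  shows "fourier_mult a b m (trig a b A c) = trig a b A (\<lambda>l. m l * c l)"
proof
  fix x
  have "fourier_mult a b m (trig a b A c) x = (\<Sum>\<^sub>\<infinity>l\<in>A. m l * c l * fbasis a b l x)"
    unfolding fourier_mult_def by (rule infsum_cong_neutral) (auto simp: fcoeff_trig assms)
  then show "fourier_mult a b m (trig a b A c) x = trig a b A (\<lambda>l. m l * c l) x"
    using assms by (simp add: trig_def)
qed

lemma trig_cong: "(\<And>l. l \<in> A \<Longrightarrow> c l = d l) \<Longrightarrow> trig a b A c = trig a b A d"
  by (simp add: trig_def[abs_def])

lemma trig_fcoeff:
  "a < b \<Longrightarrow> finite A \<Longrightarrow> trig a b A (fcoeff a b (trig a b A c)) = trig a b A c"
  by (rule trig_cong) (simp add: fcoeff_trig)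

text \<open>By induction every iterate stays in X_N, so both Fourier multipliers act on finitely
  many coefficients.\<close>

lemma ewi_fs_eq_trig:
  assumes ab: "a < b"
  shows "ewi_fs a b V lam \<psi>0 N \<tau> n = trig a b (freqs N) (fcoeff a b (ewi_fs a b V lam \<psi>0 N \<tau> n))"
    and ewi_fs_Suc_eq_trig: "ewi_fs a b V lam \<psi>0 N \<tau> (Suc n) = trig a b (freqs N)
      (\<lambda>l. exp (- \<i> * of_real (\<tau> * (freq a b l)\<^sup>2)) * fcoeff a b (ewi_fs a b V lam \<psi>0 N \<tau> n) l
         - \<i> * of_real \<tau> * (varphi1 (- \<i> * of_real (\<tau> * (freq a b l)\<^sup>2)) * fcoeff a b (Bop V lam (ewi_fs a b V lam \<psi>0 N \<tau> n)) l))"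
proof -
  let ?u = "ewi_fs a b V lam \<psi>0 N \<tau>"
  have step: "?u (Suc n) = trig a b (freqs N)
      (\<lambda>l. exp (- \<i> * of_real (\<tau> * (freq a b l)\<^sup>2)) * c l
         - \<i> * of_real \<tau> * (varphi1 (- \<i> * of_real (\<tau> * (freq a b l)\<^sup>2)) * fcoeff a b (Bop V lam (?u n)) l))"
    if c: "?u n = trig a b (freqs N) c" for n c
  proof -
    have "exp_itLaplace a b \<tau> (?u n) = trig a b (freqs N) (\<lambda>l. exp (- \<i> * of_real (\<tau> * (freq a b l)\<^sup>2)) * c l)"
      unfolding c exp_itLaplace_def by (rule fourier_mult_trig[OF ab finite_freqs])
    moreover have "varphi1_itLaplace a b \<tau> (PN a b N (Bop V lam (?u n)))
        = trig a b (freqs N) (\<lambda>l. varphi1 (- \<i> * of_real (\<tau> * (freq a b l)\<^sup>2)) * fcoeff a b (Bop V lam (?u n)) l)"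
      unfolding PN_eq_trig varphi1_itLaplace_def by (rule fourier_mult_trig[OF ab finite_freqs])
    ultimately have "?u (Suc n) = (\<lambda>x. trig a b (freqs N) (\<lambda>l. exp (- \<i> * of_real (\<tau> * (freq a b l)\<^sup>2)) * c l) x
        - \<i> * of_real \<tau> * trig a b (freqs N) (\<lambda>l. varphi1 (- \<i> * of_real (\<tau> * (freq a b l)\<^sup>2)) * fcoeff a b (Bop V lam (?u n)) l) x)"
      by (simp only: ewi_fs.simps(2))
    then show ?thesis
      by (simp add: trig_def[abs_def] left_diff_distrib sum_subtractf sum_distrib_left mult.assoc)
  qed
  have "\<exists>c. ?u n = trig a b (freqs N) c" for n
  proof (induction n)
    case 0
    then show ?case by (auto simp: PN_eq_trig)
  next
    case (Suc n)
    then show ?case using step by blast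
  qed
  then have eq: "?u n = trig a b (freqs N) (fcoeff a b (?u n))" for n
    using trig_fcoeff[OF ab finite_freqs] by metis
  show "?u n = trig a b (freqs N) (fcoeff a b (?u n))" by (rule eq)
  show "?u (Suc n) = trig a b (freqs N)
      (\<lambda>l. exp (- \<i> * of_real (\<tau> * (freq a b l)\<^sup>2)) * fcoeff a b (?u n) l
         - \<i> * of_real \<tau> * (varphi1 (- \<i> * of_real (\<tau> * (freq a b l)\<^sup>2)) * fcoeff a b (Bop V lam (?u n)) l))"
    by (rule step[OF eq])
qed

text \<open>Cauchy-Schwarz over at most \<open>N\<close> frequencies, where N = (b - a) / h. This
  controls the maximum norm of the numerical solution at the price h^(-1/2), which inside a
  logarithm is only half of |ln h|.\<close>

lemma cmod_trig_le:
  assumes ab: "a < b" and "0 < N"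
  shows "cmod (trig a b (freqs N) c x) \<le> L2_norm a b (trig a b (freqs N) c) / sqrt ((b - a) / real N)"
proof -
  define S where "S = (\<Sum>l\<in>freqs N. (cmod (c l))\<^sup>2)"
  have "real (card (freqs N)) \<le> real N" by (simp add: freqs_def)
  have "cmod (trig a b (freqs N) c x) \<le> (\<Sum>l\<in>freqs N. 1 * cmod (c l))"
    unfolding trig_def by (rule order_trans[OF norm_sum]) (simp add: norm_mult)
  then have "(cmod (trig a b (freqs N) c x))\<^sup>2 \<le> (\<Sum>l\<in>freqs N. 1 * cmod (c l))\<^sup>2"
    by (intro power_mono) auto
  also have "\<dots> \<le> (\<Sum>l\<in>freqs N. 1\<^sup>2) * S"
    unfolding S_def by (rule Cauchy_Schwarz_ineq_sum)
  also have "\<dots> \<le> real N * S"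
    using \<open>real (card (freqs N)) \<le> real N\<close> by (intro mult_right_mono) (auto simp: S_def sum_nonneg)
  also have "\<dots> = (L2_norm a b (trig a b (freqs N) c) / sqrt ((b - a) / real N))\<^sup>2"
    using ab \<open>0 < N\<close> L2_norm_trig[OF ab finite_freqs[of N], of c] by (simp add: power_divide S_def)
  finally show ?thesis
    by (rule power2_le_imp_le) (use ab in simp)
qed

text \<open>The free flow is an isometry on every mode, so to first order in \<tau> only the cross
  term matters. The factor -i turns it into an imaginary part, the quantity that the one-sided
  Lipschitz bound controls; replacing \<open>varphi1\<close> by 1 in it costs the term with
  \<open>\<theta>\<close>.\<close>

lemma energy_step:
  assumes ab: "a < b" and A: "finite A" and F: "F \<in> L2 a b" and "0 \<le> \<tau>"
    and \<theta>: "\<And>l. l \<in> A \<Longrightarrow> \<tau> * (freq a b l)\<^sup>2 \<le> \<theta>" "0 \<le> \<theta>"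
  shows "(L2_norm a b (trig a b A (\<lambda>l. exp (- \<i> * of_real (\<tau> * (freq a b l)\<^sup>2)) * c l
         - \<i> * of_real \<tau> * (varphi1 (- \<i> * of_real (\<tau> * (freq a b l)\<^sup>2)) * fcoeff a b F l))))\<^sup>2
    \<le> (L2_norm a b (trig a b A c))\<^sup>2 + 2 * \<tau> * \<bar>Im (LINT x|Omega a b. cnj (trig a b A c x) * F x)\<bar>
      + 2 * \<tau> * \<theta> * (L2_norm a b (trig a b A c) * L2_norm a b F) + \<tau>\<^sup>2 * (L2_norm a b F)\<^sup>2"
proof -
  let ?g = "\<lambda>l. exp (- \<i> * of_real (\<tau> * (freq a b l)\<^sup>2)) * c l
         - \<i> * of_real \<tau> * (varphi1 (- \<i> * of_real (\<tau> * (freq a b l)\<^sup>2)) * fcoeff a b F l)"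
  let ?\<beta> = "fcoeff a b F"
  have coord: "(cmod (?g l))\<^sup>2 \<le> (cmod (c l))\<^sup>2 + 2 * \<tau> * Im (cnj (c l) * ?\<beta> l)
      + 2 * \<tau> * \<theta> * (cmod (c l) * cmod (?\<beta> l)) + \<tau>\<^sup>2 * (cmod (?\<beta> l))\<^sup>2" if l: "l \<in> A" for l
  proof -
    define x where "x = \<tau> * (freq a b l)\<^sup>2"
    define \<phi> where "\<phi> = varphi1 (\<i> * of_real x)"
    have x: "0 \<le> x" "x \<le> \<theta>" using \<open>0 \<le> \<tau>\<close> \<theta>(1)[OF l] by (auto simp: x_def)
    have e: "?g l = exp (- \<i> * of_real x) * (c l - \<i> * of_real \<tau> * (\<phi> * ?\<beta> l))"
      unfolding x_def[symmetric] exp_mult_varphi1[symmetric] by (simp add: \<phi>_def algebra_simps)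
    have "cmod (?g l) = cmod (c l - \<i> * of_real \<tau> * (\<phi> * ?\<beta> l))"
      unfolding e norm_mult by simp
    moreover have "(cmod (u - \<i> * of_real \<tau> * v))\<^sup>2 = (cmod u)\<^sup>2 + 2 * \<tau> * Im (cnj u * v) + (\<tau> * cmod v)\<^sup>2" for u v
      unfolding power_mult_distrib cmod_power2 by (simp add: power2_eq_square algebra_simps)
    ultimately have "(cmod (?g l))\<^sup>2 = (cmod (c l))\<^sup>2 + 2 * \<tau> * Im (cnj (c l) * (\<phi> * ?\<beta> l)) + (\<tau> * cmod (\<phi> * ?\<beta> l))\<^sup>2"
      by (simp only:)
    \<comment> \<open>\<open>\<phi>\<close> is 1 plus a defect of size at most
      \<open>\<theta>\<close>: the 1 reproduces the exact scalar product after summation, while the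
      defect is estimated mode by mode.\<close>
    also have "Im (cnj (c l) * (\<phi> * ?\<beta> l)) = Im (cnj (c l) * ?\<beta> l) + Im (cnj (c l) * ((\<phi> - 1) * ?\<beta> l))"
      by (simp add: algebra_simps)
    also have "2 * \<tau> * (Im (cnj (c l) * ?\<beta> l) + Im (cnj (c l) * ((\<phi> - 1) * ?\<beta> l)))
        \<le> 2 * \<tau> * (Im (cnj (c l) * ?\<beta> l) + \<theta> * (cmod (c l) * cmod (?\<beta> l)))"
    proof (intro mult_left_mono add_left_mono)
      have "Im (cnj (c l) * ((\<phi> - 1) * ?\<beta> l)) \<le> cmod (cnj (c l) * ((\<phi> - 1) * ?\<beta> l))"
        by (rule order_trans[OF abs_ge_self abs_Im_le_cmod])
      also have "\<dots> = cmod (\<phi> - 1) * (cmod (c l) * cmod (?\<beta> l))" by (simp add: norm_mult)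
      also have "\<dots> \<le> \<theta> * (cmod (c l) * cmod (?\<beta> l))"
        using cmod_varphi1_minus_1_le[of x] x by (intro mult_right_mono) (auto simp: \<phi>_def)
      finally show "Im (cnj (c l) * ((\<phi> - 1) * ?\<beta> l)) \<le> \<theta> * (cmod (c l) * cmod (?\<beta> l))" .
    qed (use \<open>0 \<le> \<tau>\<close> in simp)
    also have "(\<tau> * cmod (\<phi> * ?\<beta> l))\<^sup>2 \<le> \<tau>\<^sup>2 * (cmod (?\<beta> l))\<^sup>2"
    proof -
      have "cmod \<phi> * cmod (?\<beta> l) \<le> 1 * cmod (?\<beta> l)"
        using cmod_varphi1_le[of x] by (intro mult_right_mono) (auto simp: \<phi>_def)
      then show ?thesis unfolding power_mult_distrib norm_mult
        by (intro mult_left_mono) (auto intro: power_mono simp: power_mult_distrib[symmetric])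
    qed
    finally show ?thesis by (simp add: algebra_simps)
  qed
  have "(\<Sum>l\<in>A. (cmod (?g l))\<^sup>2) \<le> (\<Sum>l\<in>A. (cmod (c l))\<^sup>2 + 2 * \<tau> * Im (cnj (c l) * ?\<beta> l)
      + 2 * \<tau> * \<theta> * (cmod (c l) * cmod (?\<beta> l)) + \<tau>\<^sup>2 * (cmod (?\<beta> l))\<^sup>2)"
    by (rule sum_mono) (rule coord)
  also have "\<dots> = (\<Sum>l\<in>A. (cmod (c l))\<^sup>2) + 2 * \<tau> * Im (\<Sum>l\<in>A. cnj (c l) * ?\<beta> l)
      + 2 * \<tau> * \<theta> * (\<Sum>l\<in>A. cmod (c l) * cmod (?\<beta> l)) + \<tau>\<^sup>2 * (\<Sum>l\<in>A. (cmod (?\<beta> l))\<^sup>2)"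
    unfolding Im_sum by (simp only: sum.distrib sum_distrib_left)
  finally have "(b - a) * (\<Sum>l\<in>A. (cmod (?g l))\<^sup>2) \<le> (b - a) * ((\<Sum>l\<in>A. (cmod (c l))\<^sup>2) + 2 * \<tau> * Im (\<Sum>l\<in>A. cnj (c l) * ?\<beta> l)
      + 2 * \<tau> * \<theta> * (\<Sum>l\<in>A. cmod (c l) * cmod (?\<beta> l)) + \<tau>\<^sup>2 * (\<Sum>l\<in>A. (cmod (?\<beta> l))\<^sup>2))"
    using ab by (intro mult_left_mono) auto
  then have main: "(L2_norm a b (trig a b A ?g))\<^sup>2 \<le> (L2_norm a b (trig a b A c))\<^sup>2
      + 2 * \<tau> * ((b - a) * Im (\<Sum>l\<in>A. cnj (c l) * ?\<beta> l))
      + 2 * \<tau> * \<theta> * ((b - a) * (\<Sum>l\<in>A. cmod (c l) * cmod (?\<beta> l)))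
      + \<tau>\<^sup>2 * ((b - a) * (\<Sum>l\<in>A. (cmod (?\<beta> l))\<^sup>2))"
    unfolding L2_norm_trig[OF ab A] by (simp only: distrib_left mult_ac)
  have i1: "(b - a) * Im (\<Sum>l\<in>A. cnj (c l) * ?\<beta> l) \<le> \<bar>Im (LINT x|Omega a b. cnj (trig a b A c x) * F x)\<bar>"
  proof -
    have "Im (LINT x|Omega a b. cnj (trig a b A c x) * F x) = (b - a) * Im (\<Sum>l\<in>A. cnj (c l) * ?\<beta> l)"
      unfolding integral_cnj_trig_mult[OF ab A F] by (simp del: Im_sum)
    then show ?thesis by linarith
  qed
  have i2: "(b - a) * (\<Sum>l\<in>A. cmod (c l) * cmod (?\<beta> l)) \<le> L2_norm a b (trig a b A c) * L2_norm a b F"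
  proof (rule power2_le_imp_le)
    have "((b - a) * (\<Sum>l\<in>A. cmod (c l) * cmod (?\<beta> l)))\<^sup>2
        \<le> (b - a)\<^sup>2 * ((\<Sum>l\<in>A. (cmod (c l))\<^sup>2) * (\<Sum>l\<in>A. (cmod (?\<beta> l))\<^sup>2))"
      unfolding power_mult_distrib by (intro mult_left_mono Cauchy_Schwarz_ineq_sum) simp
    also have "\<dots> = (L2_norm a b (trig a b A c))\<^sup>2 * ((b - a) * (\<Sum>l\<in>A. (cmod (?\<beta> l))\<^sup>2))"
      unfolding L2_norm_trig[OF ab A] by (simp only: power2_eq_square mult_ac)
    also have "\<dots> \<le> (L2_norm a b (trig a b A c))\<^sup>2 * (L2_norm a b F)\<^sup>2"
      by (intro mult_left_mono Bessel ab A F) simp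
    finally show "((b - a) * (\<Sum>l\<in>A. cmod (c l) * cmod (?\<beta> l)))\<^sup>2 \<le> (L2_norm a b (trig a b A c) * L2_norm a b F)\<^sup>2"
      by (simp add: power_mult_distrib)
  qed simp
  show ?thesis
    using \<open>0 \<le> \<tau>\<close> \<theta>(2)
    by (intro order_trans[OF main] add_mono mult_left_mono i1 i2 Bessel ab A F order_refl) auto
qed

section \<open>The error recursion\<close>

text \<open>Completeness of the Lebesgue measure transfers measurability. The initial datum is only
  known to agree almost everywhere with the solution at time 0.\<close>

lemma L2_cong_AE:
  assumes f: "f \<in> L2 a b" and ae: "AE x in Omega a b. f x = g x"
  shows "g \<in> L2 a b"
proof -
  let ?S = "{a<..<b}"
  have "(\<lambda>x. if x \<in> ?S then f x else 0) \<in> borel_measurable lebesgue"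
    using L2_measurable[OF f] by (subst borel_measurable_if) auto
  moreover have "AE x in lebesgue. x \<in> ?S \<longrightarrow> f x = g x"
    using ae by (subst (asm) AE_restrict_space_iff) auto
  then have "AE x in lebesgue. (if x \<in> ?S then f x else 0) = (if x \<in> ?S then g x else 0)"
    by eventually_elim simp
  ultimately have "(\<lambda>x. if x \<in> ?S then g x else 0) \<in> borel_measurable lebesgue"
    by (rule borel_measurable_AE)
  then have g: "g \<in> borel_measurable (Omega a b)"
    by (subst (asm) borel_measurable_if) auto
  have [measurable]: "f \<in> borel_measurable (Omega a b)" "g \<in> borel_measurable (Omega a b)"
    using g L2_measurable[OF f] by auto
  have "integrable (Omega a b) (\<lambda>x. (cmod (g x))\<^sup>2)"
  proof (rule integrable_cong_AE_imp[OF L2_integrable_square[OF f]])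
    show "AE x in Omega a b. (cmod (f x))\<^sup>2 = (cmod (g x))\<^sup>2" using ae by eventually_elim simp
  qed measurable
  then show ?thesis using g by (simp add: L2_def)
qed

lemma abs_ln_small:
  assumes "0 < x" "x < exp (- 1 :: real)"
  shows "x \<le> 1" "\<bar>ln x\<bar> = - ln x" "1 \<le> \<bar>ln x\<bar>" "x * \<bar>ln x\<bar> \<le> 1"
proof -
  have "exp (- 1 :: real) \<le> 1" by simp
  then show 1: "x \<le> 1" using assms by linarith
  have "ln x < ln (exp (- 1))" using assms by (subst ln_less_cancel_iff) auto
  then have l: "ln x < - 1" by simp
  then show e: "\<bar>ln x\<bar> = - ln x" "1 \<le> \<bar>ln x\<bar>" by simp_all
  have "ln (1 / x) \<le> 1 / x - 1" using assms by (intro ln_le_minus_one) simp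
  then have "- ln x \<le> 1 / x" using assms by (simp add: ln_div)
  then have "x * - ln x \<le> x * (1 / x)" using assms by (intro mult_left_mono) auto
  then show "x * \<bar>ln x\<bar> \<le> 1" using assms e by simp
qed

context logSE
begin

section \<open>Constants of the error recursion\<close>

definition KB :: real where "KB = M + 4 * \<bar>lam\<bar>"
text \<open>Weight of the error in space: \<open>K2\<close> for the projection,
  \<open>sqrt (b - a)\<close> for the threshold \<open>h\<^sup>2\<close> in the log-Lipschitz
  bound.\<close>

definition k0 :: real where "k0 = K2 + sqrt (b - a) + 1"
text \<open>Dominates both the L2 norm and the maximum norm of the exact solution, and is at least
  1, so that \<open>ln (m0 + E n)\<close> is nonnegative.\<close>

definition m0 :: real where "m0 = M * sqrt (b - a) + M + 1"
text \<open>One summand for each source: the one-sided bound, the projection error, the defect of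
  \<open>varphi1\<close>, and the two parts of the squared nonlinear difference.\<close>

definition L0 :: "real \<Rightarrow> real" where
  "L0 Ct = 4 * \<bar>lam\<bar> + 8 * KB + 8 * (pi\<^sup>2 * Ct * KB) + 32 * (KB\<^sup>2 * Ct) + 2 * KB\<^sup>2"
definition Kp :: real where "Kp = KB * (2 + ln (max 1 M)) * (M + sqrt (b - a))"

lemma constants_nonneg:
  "0 \<le> KB" "1 \<le> k0" "1 \<le> m0" "0 \<le> Ct \<Longrightarrow> 0 \<le> L0 Ct" "0 \<le> Kp"
  using M_nonneg K2_nonneg ab by (auto simp: KB_def k0_def m0_def L0_def Kp_def)

lemma \<psi>_0_AE: "AE x in Omega a b. \<psi> 0 x = \<psi>0 x"
  using sol by (simp add: logSE_solution_def)

lemma fcoeff_\<psi>0: "fcoeff a b \<psi>0 l = fcoeff a b (\<psi> 0) l"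
proof -
  have 0: "\<psi> 0 \<in> L2 a b" by (rule \<psi>_L2) (use T in simp)
  show ?thesis
    by (rule fcoeff_cong_AE[OF 0 L2_cong_AE[OF 0 \<psi>_0_AE] \<psi>_0_AE, symmetric])
qed

end

section \<open>The discrete error and its recursion\<close>

locale ewi = logSE +
  fixes N :: nat and h \<tau> Ct :: real
  assumes N: "0 < N" "even N" and h: "h = (b - a) / real N" "h < exp (- 1)"
    and \<tau>: "0 < \<tau>" "\<tau> < exp (- 1)" and Ct: "0 < Ct"
    and cfl: "\<tau> * \<bar>ln \<tau>\<bar> \<le> Ct * h\<^sup>2 / \<bar>ln h\<bar>"
begin

abbreviation u :: "nat \<Rightarrow> real \<Rightarrow> complex" where
  "u n \<equiv> ewi_fs a b V lam \<psi>0 N \<tau> n"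

abbreviation t :: "nat \<Rightarrow> real" where
  "t n \<equiv> real n * \<tau>"

abbreviation H :: real where
  "H \<equiv> \<bar>ln h\<bar>"

definition ecoeff :: "nat \<Rightarrow> int \<Rightarrow> complex" where
  "ecoeff n l = fcoeff a b (\<psi> (t n)) l - fcoeff a b (u n) l"

definition E :: "nat \<Rightarrow> real" where
  "E n = L2_norm a b (trig a b (freqs N) (ecoeff n))"

lemma h_pos: "0 < h"
  using ab N h by simp

lemmas h_small = abs_ln_small[OF h_pos h(2)]
lemmas \<tau>_small = abs_ln_small[OF \<tau>]

lemma E_nonneg: "0 \<le> E n"
  by (simp add: E_def)

lemma u_trig: "u n = trig a b (freqs N) (fcoeff a b (u n))"
  by (rule ewi_fs_eq_trig[OF ab])

lemma u_L2: "u n \<in> L2 a b"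
  by (subst u_trig) (rule trig_L2[OF finite_freqs])

lemma E_0: "E 0 = 0"
proof -
  have "trig a b (freqs N) (ecoeff 0) = trig a b (freqs N) (\<lambda>_. 0)"
    by (rule trig_cong) (simp add: ecoeff_def PN_eq_trig fcoeff_trig[OF ab finite_freqs] fcoeff_\<psi>0)
  then have "(E 0)\<^sup>2 = 0"
    unfolding E_def by (simp add: L2_norm_trig[OF ab finite_freqs])
  then show ?thesis by simp
qed

lemma error_trig_eq: "trig a b (freqs N) (ecoeff n) x = PN a b N (\<psi> (t n)) x - u n x"
  unfolding ecoeff_def[abs_def] trig_diff[symmetric] u_trig[symmetric] PN_eq_trig ..

lemma t_range: "t n \<le> T \<Longrightarrow> t n \<in> {0..T}"
  using \<tau> by simp

lemma q_bounds: "h\<^sup>2 \<le> h\<^sup>2 * H" "h\<^sup>2 * H \<le> 1" "h\<^sup>2 * H \<le> h * H" "0 \<le> h\<^sup>2 * H"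
proof -
  show "h\<^sup>2 \<le> h\<^sup>2 * H" using mult_left_mono[OF h_small(3), of "h\<^sup>2"] by simp
  have "0 \<le> h * H" using h_pos by (intro mult_nonneg_nonneg) auto
  with h_small(1) have "h * (h * H) \<le> 1 * (h * H)" by (rule mult_right_mono)
  then show 1: "h\<^sup>2 * H \<le> h * H" by (simp add: power2_eq_square mult.assoc)
  show "h\<^sup>2 * H \<le> 1" using 1 h_small(4) by linarith
  show "0 \<le> h\<^sup>2 * H" by simp
qed

text \<open>Both logarithms have modulus at least 1, so either one may be dropped from the step size
  restriction.\<close>

lemma cfl': "\<tau> * H \<le> Ct * h\<^sup>2" "\<tau> * \<bar>ln \<tau>\<bar> \<le> Ct * h\<^sup>2"
proof -
  have H: "0 < H" using h_small(3) by linarith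
  have c: "\<tau> * \<bar>ln \<tau>\<bar> * H \<le> Ct * h\<^sup>2" using cfl H by (simp add: pos_le_divide_eq)
  have "(\<tau> * H) * 1 \<le> (\<tau> * H) * \<bar>ln \<tau>\<bar>" using \<tau> \<tau>_small(3) by (intro mult_left_mono) auto
  then show "\<tau> * H \<le> Ct * h\<^sup>2" using c by (simp add: mult_ac)
  have "(\<tau> * \<bar>ln \<tau>\<bar>) * 1 \<le> (\<tau> * \<bar>ln \<tau>\<bar>) * H" using \<tau> h_small(3) by (intro mult_left_mono) auto
  then show "\<tau> * \<bar>ln \<tau>\<bar> \<le> Ct * h\<^sup>2" using c by simp
qed

lemma projection_error_le:
  "t n \<le> T \<Longrightarrow> L2_norm a b (\<lambda>x. \<psi> (t n) x - PN a b N (\<psi> (t n)) x) \<le> h\<^sup>2 * K2"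
  using Hper_2_PN_error(1)[OF ab \<psi>_Hper[OF t_range] N] wderiv2_\<psi>_norm_le[OF t_range]
  unfolding h(1)[symmetric] by (meson mult_left_mono order_trans zero_le_power2)

lemma error_le:
  assumes n: "t n \<le> T"
  shows "L2_norm a b (\<lambda>x. \<psi> (t n) x - u n x) \<le> E n + h\<^sup>2 * K2"
proof -
  have "(\<lambda>x. \<psi> (t n) x - u n x) = (\<lambda>x. trig a b (freqs N) (ecoeff n) x + (\<psi> (t n) x - PN a b N (\<psi> (t n)) x))"
    by (simp add: error_trig_eq)
  then have "L2_norm a b (\<lambda>x. \<psi> (t n) x - u n x) \<le> E n + L2_norm a b (\<lambda>x. \<psi> (t n) x - PN a b N (\<psi> (t n)) x)"
    unfolding E_def using L2_norm_add[OF trig_L2[OF finite_freqs] L2_diff[OF \<psi>_L2[OF t_range[OF n]] PN_L2]] by simp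
  then show ?thesis using projection_error_le[OF n] by linarith
qed

lemma u_norm_le:
  assumes n: "t n \<le> T"
  shows "L2_norm a b (u n) \<le> M * sqrt (b - a) + E n"
proof -
  have "u n = (\<lambda>x. PN a b N (\<psi> (t n)) x - trig a b (freqs N) (ecoeff n) x)"
    by (simp add: error_trig_eq)
  then have "L2_norm a b (u n) \<le> L2_norm a b (PN a b N (\<psi> (t n))) + E n"
    unfolding E_def using L2_norm_diff[OF PN_L2 trig_L2[OF finite_freqs]] by metis
  then show ?thesis
    using PN_norm_le[OF ab \<psi>_L2[OF t_range[OF n]], of N] \<psi>_norm_le[OF t_range[OF n]] by linarith
qed

text \<open>The inverse inequality supplies the radius \<open>R\<close>, and the threshold is
  \<open>h\<^sup>2\<close>, the size of the projection error; so the logarithms combine into a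
  multiple of \<open>H\<close> plus \<open>ln (m0 + E n)\<close>.\<close>

lemma nonlinearity_error_le:
  assumes n: "t n \<le> T"
  shows "L2_norm a b (\<lambda>x. Bop V lam (\<psi> (t n)) x - Bop V lam (u n) x)
    \<le> KB * (4 * H + ln (m0 + E n)) * (E n + k0 * h\<^sup>2)"
    and "Bop V lam (u n) \<in> L2 a b"
    and "\<bar>Im (LINT x|Omega a b. cnj (\<psi> (t n) x - u n x) * (Bop V lam (\<psi> (t n)) x - Bop V lam (u n) x))\<bar>
      \<le> 2 * \<bar>lam\<bar> * (L2_norm a b (\<lambda>x. \<psi> (t n) x - u n x))\<^sup>2"
proof -
  define R where "R = (m0 + E n) / sqrt h"
  have sh: "0 < sqrt h" "sqrt h \<le> 1" using h_pos h_small by auto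
  have mE: "1 \<le> m0 + E n" using constants_nonneg(3) E_nonneg[of n] by linarith
  have "(m0 + E n) * sqrt h \<le> (m0 + E n) * 1" using sh mE by (intro mult_left_mono) auto
  then have R: "m0 + E n \<le> R" using sh by (simp add: R_def pos_le_divide_eq)
  have Ms: "0 \<le> M * sqrt (b - a)" using M_nonneg ab by simp
  have R1: "1 \<le> R" and RM: "M \<le> R" using R mE E_nonneg[of n] M_nonneg Ms by (auto simp: m0_def)
  have \<psi>R: "AE x in Omega a b. cmod (\<psi> (t n) x) \<le> R"
    using \<psi>_bound[OF t_range[OF n]] by eventually_elim (use RM in linarith)
  have uR: "AE x in Omega a b. cmod (u n x) \<le> R"
  proof (rule AE_I2)
    fix x
    have "cmod (u n x) \<le> L2_norm a b (u n) / sqrt h"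
      using cmod_trig_le[OF ab N(1), of "fcoeff a b (u n)" x] unfolding u_trig[symmetric] h(1)[symmetric] .
    also have "\<dots> \<le> R" unfolding R_def
      using sh u_norm_le[OF n] M_nonneg by (intro divide_right_mono) (auto simp: m0_def)
    finally show "cmod (u n x) \<le> R" .
  qed
  note um = L2_measurable[OF u_L2[of n]] and \<psi>m = L2_measurable[OF \<psi>_L2[OF t_range[OF n]]]
  show "Bop V lam (u n) \<in> L2 a b" by (rule Bop_L2[OF V_measurable V_bound um uR])
  show "\<bar>Im (LINT x|Omega a b. cnj (\<psi> (t n) x - u n x) * (Bop V lam (\<psi> (t n)) x - Bop V lam (u n) x))\<bar>
      \<le> 2 * \<bar>lam\<bar> * (L2_norm a b (\<lambda>x. \<psi> (t n) x - u n x))\<^sup>2"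
    by (rule Bop_one_sided_Lipschitz[OF V_measurable V_bound \<psi>m \<psi>R um uR])
  have h2: "0 < h\<^sup>2" "h\<^sup>2 \<le> 1" using h_pos h_small by (auto intro: power_le_one)
  \<comment> \<open>The threshold contributes \<open>2 * H\<close>, the radius \<open>H / 2\<close>,
    and the 1 is at most \<open>H\<close>.\<close>
  have lns: "\<bar>ln (h\<^sup>2)\<bar> + ln R + 1 \<le> 4 * H + ln (m0 + E n)"
  proof -
    have "ln R = ln (m0 + E n) - ln h / 2"
      unfolding R_def using mE sh h_pos by (simp add: ln_div ln_sqrt)
    moreover have "\<bar>ln (h\<^sup>2)\<bar> = 2 * H" using h_pos by (simp add: ln_realpow abs_mult)
    ultimately show ?thesis using h_small by linarith
  qed
  have "L2_norm a b (\<lambda>x. Bop V lam (\<psi> (t n)) x - Bop V lam (u n) x)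
    \<le> KB * (\<bar>ln (h\<^sup>2)\<bar> + ln R + 1) * (L2_norm a b (\<lambda>x. \<psi> (t n) x - u n x) + h\<^sup>2 * sqrt (b - a))"
    unfolding KB_def by (rule Bop_diff_L2_norm[OF ab h2 R1 V_measurable V_bound M_nonneg \<psi>m \<psi>R um uR])
  also have "\<dots> \<le> KB * (4 * H + ln (m0 + E n)) * (E n + k0 * h\<^sup>2)"
  proof (rule mult_mono)
    show "KB * (\<bar>ln (h\<^sup>2)\<bar> + ln R + 1) \<le> KB * (4 * H + ln (m0 + E n))"
      by (rule mult_left_mono[OF lns constants_nonneg(1)])
    show "L2_norm a b (\<lambda>x. \<psi> (t n) x - u n x) + h\<^sup>2 * sqrt (b - a) \<le> E n + k0 * h\<^sup>2"
    proof -
      have "k0 * h\<^sup>2 = h\<^sup>2 * K2 + h\<^sup>2 * sqrt (b - a) + h\<^sup>2" by (simp add: k0_def algebra_simps)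
      then show ?thesis using error_le[OF n] h2(1) by linarith
    qed
    show "0 \<le> KB * (4 * H + ln (m0 + E n))" using constants_nonneg(1) mE by simp
    show "0 \<le> L2_norm a b (\<lambda>x. \<psi> (t n) x - u n x) + h\<^sup>2 * sqrt (b - a)"
      using ab by simp
  qed
  finally show "L2_norm a b (\<lambda>x. Bop V lam (\<psi> (t n)) x - Bop V lam (u n) x)
    \<le> KB * (4 * H + ln (m0 + E n)) * (E n + k0 * h\<^sup>2)" .
qed

lemma error_recursion:
  assumes n: "t (Suc n) \<le> T"
  shows "(E (Suc n))\<^sup>2 \<le> (1 + \<tau>) * ((E n)\<^sup>2 + \<tau> * (L0 Ct * (1 + ln (m0 + E n) + \<tau> * (ln (m0 + E n))\<^sup>2)) * (E n + k0 * (h\<^sup>2 * H))\<^sup>2)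
          + 2 * \<tau> * (Kp * (\<tau> * \<bar>ln \<tau>\<bar>))\<^sup>2"
proof -
  have tn: "t n + \<tau> = t (Suc n)" "t n \<le> T" using n \<tau> by (simp_all add: algebra_simps)
  note tr = t_range[OF tn(2)]
  note D = nonlinearity_error_le[OF tn(2)]
  let ?\<mu> = "\<lambda>l. (freq a b l)\<^sup>2"
  let ?F = "\<lambda>x. Bop V lam (\<psi> (t n)) x - Bop V lam (u n) x"
  have FL: "?F \<in> L2 a b" by (intro L2_diff Bop_\<psi>_L2 tr D(2))
  let ?g = "\<lambda>l. exp (- \<i> * of_real (\<tau> * ?\<mu> l)) * ecoeff n l
         - \<i> * of_real \<tau> * (varphi1 (- \<i> * of_real (\<tau> * ?\<mu> l)) * fcoeff a b ?F l)"
  let ?e = "\<lambda>l. fcoeff a b (\<psi> (t n + \<tau>)) l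
      - (exp (- \<i> * of_real (\<tau> * ?\<mu> l)) * fcoeff a b (\<psi> (t n)) l
         - \<i> * of_real \<tau> * (varphi1 (- \<i> * of_real (\<tau> * ?\<mu> l)) * fcoeff a b (Bop V lam (\<psi> (t n))) l))"
  define G where "G = L2_norm a b (trig a b (freqs N) ?g)"
  define d where "d = L2_norm a b ?F"
  define Y where "Y = ln (m0 + E n)"
  define q where "q = h\<^sup>2 * H"
  define X where "X = E n + k0 * q"
  define v where "v = Kp * (\<tau> * \<bar>ln \<tau>\<bar>)"
  have Y: "0 \<le> Y" using constants_nonneg(3) E_nonneg[of n] by (simp add: Y_def)
  have q: "h\<^sup>2 \<le> q" "q \<le> 1" "0 \<le> q" using q_bounds by (auto simp: q_def)
  have kb: "0 \<le> KB" and k0: "1 \<le> k0" using constants_nonneg by auto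
  have X: "0 \<le> X" "E n \<le> X" "k0 * q \<le> X" "E n + k0 * h\<^sup>2 \<le> X"
    using k0 q E_nonneg[of n] by (auto simp: X_def intro: mult_left_mono)
  have d: "0 \<le> d" "d \<le> KB * (4 * H + Y) * X"
  proof -
    show "0 \<le> d" by (simp add: d_def)
    have "d \<le> KB * (4 * H + Y) * (E n + k0 * h\<^sup>2)" using D(1) by (simp add: d_def Y_def)
    also have "\<dots> \<le> KB * (4 * H + Y) * X" using kb Y X(4) by (intro mult_left_mono) auto
    finally show "d \<le> KB * (4 * H + Y) * X" .
  qed
  have H1: "1 \<le> H" by (rule h_small(3))
  \<comment> \<open>With \<open>H\<close> as a common factor, each estimate below can spend it
    against one small quantity.\<close>
  have HY: "4 * H + Y \<le> H * (4 + Y)" using mult_right_mono[OF H1 Y] by (simp add: algebra_simps)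
  have local: "L2_norm a b (trig a b (freqs N) ?e) \<le> \<tau> * v"
  proof (rule local_error_le)
    fix s assume s: "s \<in> {0..\<tau>}"
    have "L2_norm a b (\<lambda>x. Bop V lam (\<psi> (t n + s)) x - Bop V lam (\<psi> (t n)) x)
      \<le> KB * (\<bar>ln \<tau>\<bar> + ln (max 1 M) + 1) * ((M + sqrt (b - a)) * \<tau>)"
      unfolding KB_def by (rule Bop_\<psi>_time_increment) (use s \<tau> \<tau>_small tn n in auto)
    also have "\<dots> \<le> KB * ((2 + ln (max 1 M)) * \<bar>ln \<tau>\<bar>) * ((M + sqrt (b - a)) * \<tau>)"
    proof (intro mult_right_mono mult_left_mono)
      have "ln (max 1 M) * 1 \<le> ln (max 1 M) * \<bar>ln \<tau>\<bar>" using \<tau>_small(3) by (intro mult_left_mono) auto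
      then show "\<bar>ln \<tau>\<bar> + ln (max 1 M) + 1 \<le> (2 + ln (max 1 M)) * \<bar>ln \<tau>\<bar>"
        using \<tau>_small(3) by (simp add: algebra_simps)
    qed (use kb M_nonneg ab \<tau> in auto)
    also have "\<dots> = v" by (simp add: v_def Kp_def mult_ac)
    finally show "L2_norm a b (\<lambda>x. Bop V lam (\<psi> (t n + s)) x - Bop V lam (\<psi> (t n)) x) \<le> v" .
  qed (use tn n \<tau> in auto)
  have Esum: "E (Suc n) \<le> G + \<tau> * v"
  proof -
    \<comment> \<open>One step of the scheme applied to the error, driven by the nonlinear
      difference \<open>?F\<close>, plus the local error.\<close>
    have "trig a b (freqs N) (ecoeff (Suc n)) = trig a b (freqs N) (\<lambda>l. ?g l + ?e l)"
    proof (rule trig_cong)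
      fix l assume l: "l \<in> freqs N"
      have "fcoeff a b (u (Suc n)) l = exp (- \<i> * of_real (\<tau> * ?\<mu> l)) * fcoeff a b (u n) l
         - \<i> * of_real \<tau> * (varphi1 (- \<i> * of_real (\<tau> * ?\<mu> l)) * fcoeff a b (Bop V lam (u n)) l)"
        unfolding ewi_fs_Suc_eq_trig[OF ab] fcoeff_trig[OF ab finite_freqs] using l by simp
      then show "ecoeff (Suc n) l = ?g l + ?e l"
        unfolding ecoeff_def fcoeff_diff[OF Bop_\<psi>_L2[OF tr] D(2)] tn(1)[symmetric]
        by (simp add: algebra_simps)
    qed
    then have "E (Suc n) = L2_norm a b (\<lambda>x. trig a b (freqs N) ?g x + trig a b (freqs N) ?e x)"
      by (simp add: E_def trig_def[abs_def] distrib_right sum.distrib)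
    then show ?thesis
      using L2_norm_add[OF trig_L2[OF finite_freqs, of a b N ?g] trig_L2[OF finite_freqs, of a b N ?e]] local
      by (simp add: G_def)
  qed
  have G2: "G\<^sup>2 \<le> (E n)\<^sup>2 + \<tau> * (L0 Ct * (1 + Y + \<tau> * Y\<^sup>2)) * X\<^sup>2"
  proof -
    \<comment> \<open>\<open>pi / h\<close> bounds the frequencies in X_N, so
      \<open>\<theta>\<close> bounds the arguments of \<open>varphi1\<close> on it.\<close>
    define \<theta> where "\<theta> = \<tau> * (pi / h)\<^sup>2"
    let ?e = "trig a b (freqs N) (ecoeff n)"
    let ?w = "\<lambda>x. \<psi> (t n) x - u n x" and ?r = "\<lambda>x. \<psi> (t n) x - PN a b N (\<psi> (t n)) x"
    have wL: "?w \<in> L2 a b" and rL: "?r \<in> L2 a b" by (intro L2_diff \<psi>_L2 tr u_L2 PN_L2)+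
    have \<theta>0: "0 \<le> \<theta>" using \<tau> by (simp add: \<theta>_def)
    have \<theta>l: "\<tau> * ?\<mu> l \<le> \<theta>" if "l \<in> freqs N" for l
    proof -
      have "\<bar>freq a b l\<bar> \<le> pi / h" using freq_in_freqs_le[OF ab N(1) that] by (simp add: h(1))
      then have "\<bar>freq a b l\<bar>\<^sup>2 \<le> (pi / h)\<^sup>2" by (intro power_mono) auto
      then show ?thesis unfolding \<theta>_def using \<tau> by (intro mult_left_mono) auto
    qed
    have en: "G\<^sup>2 \<le> (E n)\<^sup>2 + 2 * \<tau> * \<bar>Im (LINT x|Omega a b. cnj (?e x) * ?F x)\<bar>
        + 2 * \<tau> * \<theta> * (E n * d) + \<tau>\<^sup>2 * d\<^sup>2"
      unfolding G_def E_def d_def using energy_step[OF ab finite_freqs FL _ \<theta>l \<theta>0] \<tau> by simp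
    \<comment> \<open>The error in X_N is \<open>?w\<close> minus the projection error
      \<open>?r\<close>. The former obeys the one-sided bound, which has no logarithm; the latter
      meets the full log-Lipschitz bound, whose factor \<open>H\<close> turns
      \<open>h\<^sup>2\<close> into \<open>q\<close>.\<close>
    have Im: "\<bar>Im (LINT x|Omega a b. cnj (?e x) * ?F x)\<bar> \<le> 2 * \<bar>lam\<bar> * X\<^sup>2 + KB * (4 + Y) * X\<^sup>2"
    proof -
      have "(LINT x|Omega a b. cnj (?e x) * ?F x) = (LINT x|Omega a b. cnj (?w x) * ?F x - cnj (?r x) * ?F x)"
        by (intro Bochner_Integration.integral_cong refl) (simp add: error_trig_eq algebra_simps)
      also have "\<dots> = (LINT x|Omega a b. cnj (?w x) * ?F x) - (LINT x|Omega a b. cnj (?r x) * ?F x)"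
        by (intro Bochner_Integration.integral_diff integrable_L2_mult L2_cnj wL rL FL)
      finally have 1: "\<bar>Im (LINT x|Omega a b. cnj (?e x) * ?F x)\<bar>
          \<le> \<bar>Im (LINT x|Omega a b. cnj (?w x) * ?F x)\<bar> + cmod (LINT x|Omega a b. cnj (?r x) * ?F x)"
        using abs_Im_le_cmod[of "LINT x|Omega a b. cnj (?r x) * ?F x"] by (simp only: minus_complex.sel)
      have 2: "\<bar>Im (LINT x|Omega a b. cnj (?w x) * ?F x)\<bar> \<le> 2 * \<bar>lam\<bar> * X\<^sup>2"
      proof -
        have "h\<^sup>2 * K2 \<le> q * k0"
          using q K2_nonneg ab by (intro mult_mono) (auto simp: k0_def)
        then have "L2_norm a b ?w \<le> X" using error_le[OF tn(2)] by (simp add: X_def mult.commute)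
        then have "(L2_norm a b ?w)\<^sup>2 \<le> X\<^sup>2" by (intro power_mono) auto
        then have "2 * \<bar>lam\<bar> * (L2_norm a b ?w)\<^sup>2 \<le> 2 * \<bar>lam\<bar> * X\<^sup>2" by (intro mult_left_mono) auto
        then show ?thesis using D(3) by linarith
      qed
      have 3: "cmod (LINT x|Omega a b. cnj (?r x) * ?F x) \<le> KB * (4 + Y) * X\<^sup>2"
      proof -
        have "cmod (LINT x|Omega a b. cnj (?r x) * ?F x) \<le> L2_norm a b (\<lambda>x. cnj (?r x)) * d"
          unfolding d_def by (rule Cauchy_Schwarz_L2[OF L2_cnj[OF rL] FL])
        also have "\<dots> = L2_norm a b ?r * d" by (simp only: L2_norm_cnj)
        also have "\<dots> \<le> (h\<^sup>2 * k0) * (KB * (4 * H + Y) * X)"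
        proof (rule mult_mono)
          have "h\<^sup>2 * K2 \<le> h\<^sup>2 * k0" using ab by (intro mult_left_mono) (auto simp: k0_def)
          then show "L2_norm a b ?r \<le> h\<^sup>2 * k0" using projection_error_le[OF tn(2)] by linarith
        qed (use d k0 in auto)
        also have "\<dots> = k0 * KB * X * (h\<^sup>2 * (4 * H + Y))" by (simp add: mult_ac)
        also have "\<dots> \<le> k0 * KB * X * (h\<^sup>2 * (H * (4 + Y)))"
          using k0 kb X HY by (intro mult_left_mono mult_nonneg_nonneg) auto
        also have "\<dots> = (k0 * q) * (KB * X * (4 + Y))" by (simp add: q_def mult_ac)
        also have "\<dots> \<le> X * (KB * X * (4 + Y))"
          using X(3) kb X(1) Y by (intro mult_right_mono mult_nonneg_nonneg) auto
        also have "\<dots> = KB * (4 + Y) * X\<^sup>2" by (simp add: power2_eq_square mult_ac)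
        finally show ?thesis .
      qed
      show ?thesis using 1 2 3 by linarith
    qed
    \<comment> \<open>\<open>\<theta>\<close> is of order \<tau> / h^2, and by the step size
      restriction \<open>\<theta> * H\<close> is bounded: this pays for the \<open>H\<close> in the
      bound of \<open>d\<close>.\<close>
    have \<theta>d: "\<theta> * (E n * d) \<le> pi\<^sup>2 * Ct * KB * (4 + Y) * X\<^sup>2"
    proof -
      have \<theta>H: "\<theta> * H \<le> pi\<^sup>2 * Ct"
      proof -
        have "\<theta> * H = pi\<^sup>2 * (\<tau> * H / h\<^sup>2)" by (simp add: \<theta>_def power_divide)
        also have "\<tau> * H / h\<^sup>2 \<le> Ct" using cfl'(1) h_pos by (simp add: pos_divide_le_eq)
        finally show ?thesis by (simp add: mult_left_mono)
      qed
      have "\<theta> * (E n * d) \<le> \<theta> * (X * (KB * (4 * H + Y) * X))"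
        using \<theta>0 X d E_nonneg by (intro mult_left_mono mult_mono) auto
      also have "\<dots> = KB * X\<^sup>2 * \<theta> * (4 * H + Y)" by (simp add: power2_eq_square mult_ac)
      also have "\<dots> \<le> KB * X\<^sup>2 * \<theta> * (H * (4 + Y))"
        using kb \<theta>0 HY by (intro mult_left_mono mult_nonneg_nonneg) auto
      also have "\<dots> = (KB * X\<^sup>2 * (4 + Y)) * (\<theta> * H)" by (simp add: mult_ac)
      also have "\<dots> \<le> (KB * X\<^sup>2 * (4 + Y)) * (pi\<^sup>2 * Ct)"
        using kb Y \<theta>H by (intro mult_left_mono mult_nonneg_nonneg) auto
      finally show ?thesis by (simp add: mult_ac)
    qed
    \<comment> \<open>Here \<open>H\<close> occurs squared: one factor goes into \<tau> H \<le> Ct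
      h^2, the other into h^2 H \<le> 1. The part with \<open>Y\<close> cannot be absorbed and stays
      as \<open>\<tau> * Y\<^sup>2\<close>.\<close>
    have dd: "\<tau> * d\<^sup>2 \<le> KB\<^sup>2 * (32 * Ct + 2 * (\<tau> * Y\<^sup>2)) * X\<^sup>2"
    proof -
      have "\<tau> * d\<^sup>2 \<le> \<tau> * (KB * (4 * H + Y) * X)\<^sup>2"
        using \<tau> d by (intro mult_left_mono power_mono) auto
      also have "\<dots> = (KB\<^sup>2 * X\<^sup>2) * (\<tau> * (4 * H + Y)\<^sup>2)" by (simp add: power_mult_distrib mult_ac)
      also have "\<dots> \<le> (KB\<^sup>2 * X\<^sup>2) * (32 * Ct + 2 * (\<tau> * Y\<^sup>2))"
      proof (rule mult_left_mono)
        have "(4 * H + Y)\<^sup>2 \<le> 32 * H\<^sup>2 + 2 * Y\<^sup>2"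
          using zero_le_power2[of "4 * H - Y"] unfolding power2_eq_square by (simp add: algebra_simps)
        then have "\<tau> * (4 * H + Y)\<^sup>2 \<le> \<tau> * (32 * H\<^sup>2 + 2 * Y\<^sup>2)" using \<tau> by (intro mult_left_mono) auto
        moreover have "\<tau> * H\<^sup>2 \<le> Ct"
        proof -
          have "\<tau> * H\<^sup>2 = (\<tau> * H) * H" unfolding power2_eq_square by (simp only: mult.assoc)
          also have "\<dots> \<le> (Ct * h\<^sup>2) * H" using cfl'(1) by (intro mult_right_mono) auto
          also have "\<dots> = Ct * q" by (simp add: q_def)
          also have "\<dots> \<le> Ct * 1" using q Ct by (intro mult_left_mono) auto
          finally show ?thesis by simp
        qed
        ultimately show "\<tau> * (4 * H + Y)\<^sup>2 \<le> 32 * Ct + 2 * (\<tau> * Y\<^sup>2)"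
          unfolding distrib_left by linarith
      qed simp
      finally show ?thesis by (simp add: mult_ac)
    qed
    have "G\<^sup>2 \<le> (E n)\<^sup>2 + \<tau> * (2 * \<bar>Im (LINT x|Omega a b. cnj (?e x) * ?F x)\<bar> + 2 * (\<theta> * (E n * d)) + \<tau> * d\<^sup>2)"
      using en by (simp add: algebra_simps power2_eq_square[of \<tau>])
    also have "\<dots> \<le> (E n)\<^sup>2 + \<tau> * (2 * (2 * \<bar>lam\<bar> * X\<^sup>2 + KB * (4 + Y) * X\<^sup>2)
        + 2 * (pi\<^sup>2 * Ct * KB * (4 + Y) * X\<^sup>2) + KB\<^sup>2 * (32 * Ct + 2 * (\<tau> * Y\<^sup>2)) * X\<^sup>2)"
      using \<tau> Im \<theta>d dd by (intro add_left_mono mult_left_mono add_mono) auto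
    also have "\<dots> = (E n)\<^sup>2 + \<tau> * (((4 * \<bar>lam\<bar> + 8 * KB + 8 * (pi\<^sup>2 * Ct * KB) + 32 * (KB\<^sup>2 * Ct))
        + (2 * KB + 2 * (pi\<^sup>2 * Ct * KB)) * Y + 2 * KB\<^sup>2 * (\<tau> * Y\<^sup>2)) * X\<^sup>2)"
      by (simp add: algebra_simps)
    also have "\<dots> \<le> (E n)\<^sup>2 + \<tau> * ((L0 Ct * 1 + L0 Ct * Y + L0 Ct * (\<tau> * Y\<^sup>2)) * X\<^sup>2)"
    proof -
      define P Q K where "P = pi\<^sup>2 * Ct * KB" and "Q = KB\<^sup>2 * Ct" and "K = KB\<^sup>2"
      have L0: "L0 Ct = 4 * \<bar>lam\<bar> + 8 * KB + 8 * P + 32 * Q + 2 * K"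
        by (simp add: L0_def P_def Q_def K_def)
      have "0 \<le> P" "0 \<le> Q" "0 \<le> K" using kb Ct by (auto simp: P_def Q_def K_def)
      then have "4 * \<bar>lam\<bar> + 8 * KB + 8 * (pi\<^sup>2 * Ct * KB) + 32 * (KB\<^sup>2 * Ct) \<le> L0 Ct * 1"
        "2 * KB + 2 * (pi\<^sup>2 * Ct * KB) \<le> L0 Ct" "2 * KB\<^sup>2 \<le> L0 Ct"
        unfolding L0 P_def[symmetric] Q_def[symmetric] unfolding K_def[symmetric] using kb by simp_all
      then show ?thesis
        using \<tau> Y by (intro add_left_mono mult_left_mono mult_right_mono add_mono) auto
    qed
    finally show ?thesis by (simp add: algebra_simps)
  qed
  have "0 \<le> G + \<tau> * v" using Esum E_nonneg[of "Suc n"] by linarith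
  then have "(E (Suc n))\<^sup>2 \<le> (G + \<tau> * v)\<^sup>2" using Esum E_nonneg[of "Suc n"] by (intro power_mono)
  \<comment> \<open>Young's inequality for the cross term: the main part loses only a factor 1 +
    \<tau>, and the squared local error keeps one power of \<tau>, which the sum over all steps
    consumes.\<close>
  also have "\<dots> \<le> (1 + \<tau>) * G\<^sup>2 + 2 * \<tau> * v\<^sup>2"
  proof -
    have "\<tau> * (2 * G * v) \<le> \<tau> * (G\<^sup>2 + v\<^sup>2)"
      using \<tau> sum_squares_bound[of G v] by (intro mult_left_mono) auto
    moreover have "\<tau> * (\<tau> * v\<^sup>2) \<le> 1 * (\<tau> * v\<^sup>2)" using \<tau> \<tau>_small by (intro mult_right_mono) auto
    ultimately show ?thesis by (simp add: power2_eq_square algebra_simps)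
  qed
  also have "\<dots> \<le> (1 + \<tau>) * ((E n)\<^sup>2 + \<tau> * (L0 Ct * (1 + Y + \<tau> * Y\<^sup>2)) * X\<^sup>2) + 2 * \<tau> * v\<^sup>2"
    using G2 \<tau> by (intro add_right_mono mult_left_mono) auto
  finally show ?thesis unfolding Y_def X_def q_def v_def .
qed

section \<open>The error estimates\<close>

lemma PN_wderiv_\<psi>_trig:
  "t n \<le> T \<Longrightarrow> PN a b N (wderiv a b (\<psi> (t n))) = trig a b (freqs N) (\<lambda>l. \<i> * of_real (freq a b l) * fcoeff a b (\<psi> (t n)) l)"
  unfolding PN_eq_trig by (rule trig_cong) (rule Hper_2_fcoeff(1)[OF ab \<psi>_Hper[OF t_range]])

lemma PN_wderiv2_\<psi>_trig:
  "t n \<le> T \<Longrightarrow> PN a b N ((wderiv a b ^^ 2) (\<psi> (t n)))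
    = trig a b (freqs N) (\<lambda>l. \<i> * of_real (freq a b l) * (\<i> * of_real (freq a b l) * fcoeff a b (\<psi> (t n)) l))"
  unfolding PN_eq_trig
  by (rule trig_cong) (simp only: Hper_2_fcoeff(2)[OF ab \<psi>_Hper[OF t_range]] ii_mult_twice of_real_power)

text \<open>Interpolation in Fourier space: m^2 \<le> 1 + m^4 for every frequency m, so Bessel's
  inequality for the function and for its second derivative suffices.\<close>

lemma PN_wderiv_\<psi>_norm_le:
  assumes n: "t n \<le> T"
  shows "L2_norm a b (PN a b N (wderiv a b (\<psi> (t n)))) \<le> M * sqrt (b - a) + K2"
proof -
  note tr = t_range[OF n]
  note D = has_weak_deriv_L2(2)[OF Hper_2_weak_derivs(2)[OF ab \<psi>_Hper[OF tr]]]
  let ?c = "fcoeff a b (\<psi> (t n))" and ?d = "fcoeff a b ((wderiv a b ^^ 2) (\<psi> (t n)))"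
  have "(L2_norm a b (PN a b N (wderiv a b (\<psi> (t n)))))\<^sup>2 = (b - a) * (\<Sum>l\<in>freqs N. (cmod (fcoeff a b (wderiv a b (\<psi> (t n))) l))\<^sup>2)"
    unfolding PN_eq_trig L2_norm_trig[OF ab finite_freqs] ..
  also have "\<dots> \<le> (b - a) * (\<Sum>l\<in>freqs N. (cmod (?c l))\<^sup>2 + (cmod (?d l))\<^sup>2)"
  proof (intro mult_left_mono sum_mono)
    fix l
    let ?m = "freq a b l"
    have "?m\<^sup>2 \<le> 1 + (?m\<^sup>2)\<^sup>2"
      using zero_le_power2[of "?m\<^sup>2 - 1 / 2"] by (simp add: power2_diff power_divide)
    then have "?m\<^sup>2 * (cmod (?c l))\<^sup>2 \<le> (1 + (?m\<^sup>2)\<^sup>2) * (cmod (?c l))\<^sup>2" by (rule mult_right_mono) simp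
    then show "(cmod (fcoeff a b (wderiv a b (\<psi> (t n))) l))\<^sup>2 \<le> (cmod (?c l))\<^sup>2 + (cmod (?d l))\<^sup>2"
      unfolding Hper_2_fcoeff[OF ab \<psi>_Hper[OF tr]] by (simp add: norm_mult power_mult_distrib norm_power algebra_simps)
  qed (use ab in simp)
  also have "\<dots> = (b - a) * (\<Sum>l\<in>freqs N. (cmod (?c l))\<^sup>2) + (b - a) * (\<Sum>l\<in>freqs N. (cmod (?d l))\<^sup>2)"
    by (simp add: sum.distrib distrib_left)
  also have "\<dots> \<le> (L2_norm a b (\<psi> (t n)))\<^sup>2 + (L2_norm a b ((wderiv a b ^^ 2) (\<psi> (t n))))\<^sup>2"
    by (intro add_mono Bessel ab finite_freqs \<psi>_L2 tr D)
  also have "\<dots> \<le> (M * sqrt (b - a))\<^sup>2 + K2\<^sup>2"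
    by (intro add_mono power_mono \<psi>_norm_le wderiv2_\<psi>_norm_le tr L2_norm_nonneg)
  also have "\<dots> \<le> (M * sqrt (b - a) + K2)\<^sup>2"
    using M_nonneg ab K2_nonneg by (simp add: power2_sum)
  finally show ?thesis
    by (rule power2_le_imp_le) (use M_nonneg ab K2_nonneg in simp)
qed

lemma error_derivative_le:
  shows "L2_norm a b (trig a b (freqs N) (\<lambda>l. \<i> * of_real (freq a b l) * ecoeff n l)) \<le> pi / h * E n"
    and "L2_norm a b (trig a b (freqs N) (\<lambda>l. \<i> * of_real (freq a b l) * (\<i> * of_real (freq a b l) * ecoeff n l))) \<le> (pi / h)\<^sup>2 * E n"
proof -
  note inv = inverse_inequality[OF ab N(1), folded h(1)]
  show 1: "L2_norm a b (trig a b (freqs N) (\<lambda>l. \<i> * of_real (freq a b l) * ecoeff n l)) \<le> pi / h * E n"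
    unfolding E_def by (rule inv)
  have "0 \<le> pi / h" using h_pos by simp
  from order_trans[OF inv mult_left_mono[OF 1 this]]
  show "L2_norm a b (trig a b (freqs N) (\<lambda>l. \<i> * of_real (freq a b l) * (\<i> * of_real (freq a b l) * ecoeff n l))) \<le> (pi / h)\<^sup>2 * E n"
    by (simp only: power2_eq_square mult.assoc)
qed

text \<open>Inverse inequalities pay 1 / h for each derivative of the error in X_N. By the step size
  restriction E / h^2 is still of order |ln h|, and E / h of order sqrt \<tau> |ln \<tau>| + h |ln
  h|; the remaining terms are norms and projection errors of the exact solution.\<close>

lemma final_estimates:
  assumes n: "t n \<le> T" and C: "0 \<le> C" and En: "E n \<le> C * (h\<^sup>2 * H + \<tau> * \<bar>ln \<tau>\<bar>)"
  defines "C' \<equiv> C + 2 * K2 + 2 * (M * sqrt (b - a) + K2) + 3 * pi\<^sup>2 * C * (1 + Ct) + 1"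
  shows "L2_norm a b (\<lambda>x. \<psi> (t n) x - u n x) \<le> C' * (\<tau> * \<bar>ln \<tau>\<bar>\<^sup>2 + h\<^sup>2 * H)"
    and "Hsob_norm a b 2 (u n) \<le> C' * H"
    and "Hsob_norm a b 1 (\<lambda>x. \<psi> (t n) x - u n x) \<le> C' * (sqrt \<tau> * \<bar>ln \<tau>\<bar> + h * H)"
proof -
  define p where "p = \<tau> * \<bar>ln \<tau>\<bar>"
  define q where "q = h\<^sup>2 * H"
  define S where "S = sqrt \<tau> * \<bar>ln \<tau>\<bar>"
  define A where "A = M * sqrt (b - a)"
  note tr = t_range[OF n]
  have A: "0 \<le> A" using M_nonneg ab by (simp add: A_def)
  have K2: "0 \<le> K2" by (rule K2_nonneg)
  have p0: "0 \<le> p" and q0: "0 \<le> q" and S0: "0 \<le> S" using \<tau> by (auto simp: p_def q_def S_def)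
  have H1: "1 \<le> H" by (rule h_small(3))
  have qh: "q \<le> h * H" "h\<^sup>2 \<le> q" using q_bounds by (auto simp: q_def)
  have p2: "p \<le> \<tau> * \<bar>ln \<tau>\<bar>\<^sup>2"
    using mult_left_mono[OF \<tau>_small(3) p0] by (simp add: p_def power2_eq_square mult.assoc)
  have pS: "p \<le> S"
  proof -
    have "sqrt \<tau> * sqrt \<tau> \<le> 1 * sqrt \<tau>" using \<tau> \<tau>_small(1) by (intro mult_right_mono) auto
    then have "\<tau> \<le> sqrt \<tau>" using \<tau> by simp
    then show ?thesis unfolding p_def S_def by (intro mult_right_mono) auto
  qed
  have En': "E n \<le> C * (q + p)" using En by (simp add: p_def q_def)
  have CCt: "0 \<le> C * (1 + Ct)" using C Ct by simp
  have pi1: "1 \<le> pi" using pi_ge_two by linarith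
  then have pi2: "pi \<le> pi\<^sup>2" by (simp add: power2_eq_square)
  have L2: "L2_norm a b (\<lambda>x. \<psi> (t n) x - u n x) \<le> (C + K2) * (q + p)"
  proof -
    have "h\<^sup>2 * K2 \<le> (q + p) * K2" using qh p0 K2 by (intro mult_right_mono) auto
    then show ?thesis using error_le[OF n] En' by (simp add: algebra_simps)
  qed
  define Z where "Z = pi\<^sup>2 * C * (1 + Ct)"
  have Z: "0 \<le> Z" using CCt by (simp add: Z_def mult.assoc)
  have C'_eq: "C' = C + 2 * K2 + 2 * (A + K2) + 3 * Z + 1"
    by (simp add: C'_def A_def Z_def mult.assoc)
  have CC: "C + K2 \<le> C'" unfolding C'_eq using A K2 Z by simp
  have "(C + K2) * (q + p) \<le> C' * (q + p)" using CC p0 q0 by (intro mult_right_mono) auto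
  also have "\<dots> \<le> C' * (\<tau> * \<bar>ln \<tau>\<bar>\<^sup>2 + h\<^sup>2 * H)"
    using p2 CC C K2 by (intro mult_left_mono) (auto simp: q_def)
  finally show "L2_norm a b (\<lambda>x. \<psi> (t n) x - u n x) \<le> C' * (\<tau> * \<bar>ln \<tau>\<bar>\<^sup>2 + h\<^sup>2 * H)"
    using L2 by linarith
  let ?\<mu> = "\<lambda>l. \<i> * complex_of_real (freq a b l)"
  let ?c = "fcoeff a b (u n)"
  let ?u1 = "trig a b (freqs N) (\<lambda>l. ?\<mu> l * ?c l)" and ?u2 = "trig a b (freqs N) (\<lambda>l. ?\<mu> l * (?\<mu> l * ?c l))"
  have w1: "has_weak_deriv a b (u n) ?u1"
    by (subst u_trig) (rule has_weak_deriv_trig[OF ab finite_freqs])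
  have w2: "has_weak_deriv a b ?u1 ?u2" by (rule has_weak_deriv_trig[OF ab finite_freqs])
  let ?e1 = "trig a b (freqs N) (\<lambda>l. ?\<mu> l * ecoeff n l)" and ?e2 = "trig a b (freqs N) (\<lambda>l. ?\<mu> l * (?\<mu> l * ecoeff n l))"
  have u1: "?u1 = (\<lambda>x. PN a b N (wderiv a b (\<psi> (t n))) x - ?e1 x)"
    unfolding PN_wderiv_\<psi>_trig[OF n] trig_diff by (simp add: ecoeff_def algebra_simps)
  have u2: "?u2 = (\<lambda>x. PN a b N ((wderiv a b ^^ 2) (\<psi> (t n))) x - ?e2 x)"
    unfolding PN_wderiv2_\<psi>_trig[OF n] trig_diff by (simp add: ecoeff_def algebra_simps)
  have nu1: "L2_norm a b ?u1 \<le> (A + K2) + pi / h * E n"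
    unfolding u1
    using L2_norm_diff[OF PN_L2 trig_L2[OF finite_freqs], of a b N "wderiv a b (\<psi> (t n))" N "\<lambda>l. ?\<mu> l * ecoeff n l"]
      PN_wderiv_\<psi>_norm_le[OF n] error_derivative_le(1)[of n] by (simp add: A_def)
  have nu2: "L2_norm a b ?u2 \<le> K2 + (pi / h)\<^sup>2 * E n"
  proof -
    note D = has_weak_deriv_L2(2)[OF Hper_2_weak_derivs(2)[OF ab \<psi>_Hper[OF tr]]]
    have "L2_norm a b (PN a b N ((wderiv a b ^^ 2) (\<psi> (t n)))) \<le> K2"
      by (rule order_trans[OF PN_norm_le[OF ab D] wderiv2_\<psi>_norm_le[OF tr]])
    then show ?thesis
      unfolding u2
      using L2_norm_diff[OF PN_L2 trig_L2[OF finite_freqs], of a b N "(wderiv a b ^^ 2) (\<psi> (t n))" N "\<lambda>l. ?\<mu> l * (?\<mu> l * ecoeff n l)"]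
        error_derivative_le(2)[of n] by linarith
  qed
  have h1: "1 \<le> 1 / h" using h_pos h_small(1) by simp
  then have ph: "1 \<le> pi / h" using mult_mono[OF pi1 h1] by simp
  then have ph2: "pi / h \<le> (pi / h)\<^sup>2"
    using mult_left_mono[OF ph, of "pi / h"] by (simp only: power2_eq_square mult_1_right)
  have Eh2: "E n / h\<^sup>2 \<le> C * (1 + Ct) * H"
  proof -
    have "E n / h\<^sup>2 \<le> C * (q + p) / h\<^sup>2" using En' by (intro divide_right_mono) auto
    also have "\<dots> = C * (H + p / h\<^sup>2)" using h_pos by (simp add: q_def field_simps)
    also have "\<dots> \<le> C * (H + Ct * H)"
    proof (intro mult_left_mono add_left_mono C)
      have "p / h\<^sup>2 \<le> Ct" using cfl'(2) h_pos by (simp add: p_def pos_divide_le_eq)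
      also have "Ct \<le> Ct * H" using mult_left_mono[OF H1, of Ct] Ct by simp
      finally show "p / h\<^sup>2 \<le> Ct * H" .
    qed
    finally show ?thesis by (simp add: algebra_simps)
  qed
  have "Hsob_norm a b 2 (u n) \<le> L2_norm a b (u n) + L2_norm a b ?u1 + L2_norm a b ?u2"
    by (rule Hsob_norm_le(2)[OF ab w1 w2])
  also have "\<dots> \<le> (A + E n) + ((A + K2) + pi / h * E n) + (K2 + (pi / h)\<^sup>2 * E n)"
    using u_norm_le[OF n] nu1 nu2 by (intro add_mono) (simp_all add: A_def)
  also have "\<dots> \<le> 2 * (A + K2) * H + 3 * ((pi / h)\<^sup>2 * E n)"
  proof -
    have gen: "A + e + ((A + K2) + e1) + (K2 + e2) \<le> B + 3 * e2"
      if "1 * e \<le> e2" "e1 \<le> e2" "2 * (A + K2) * 1 \<le> B" for e e1 e2 B :: real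
      using that by (simp add: algebra_simps)
    have "1 * E n \<le> (pi / h)\<^sup>2 * E n" using ph ph2 E_nonneg by (intro mult_right_mono) auto
    moreover have "pi / h * E n \<le> (pi / h)\<^sup>2 * E n" using ph2 E_nonneg by (intro mult_right_mono) auto
    moreover have "2 * (A + K2) * 1 \<le> 2 * (A + K2) * H" using A K2 H1 by (intro mult_left_mono) auto
    ultimately show ?thesis by (rule gen)
  qed
  also have "(pi / h)\<^sup>2 * E n = pi\<^sup>2 * (E n / h\<^sup>2)" by (simp add: power_divide)
  also have "2 * (A + K2) * H + 3 * (pi\<^sup>2 * (E n / h\<^sup>2)) \<le> 2 * (A + K2) * H + 3 * (pi\<^sup>2 * (C * (1 + Ct) * H))"
    using Eh2 by (intro add_left_mono mult_left_mono) auto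
  also have "\<dots> = (2 * (A + K2) + 3 * Z) * H" by (simp add: Z_def algebra_simps)
  also have "\<dots> \<le> C' * H"
    unfolding C'_eq using C K2 H1 by (intro mult_right_mono) auto
  finally show "Hsob_norm a b 2 (u n) \<le> C' * H" .
  let ?v = "wderiv a b (\<psi> (t n))"
  note W = Hper_2_weak_derivs(1)[OF ab \<psi>_Hper[OF tr]]
  have ww: "has_weak_deriv a b (\<lambda>x. \<psi> (t n) x - u n x) (\<lambda>x. ?v x - ?u1 x)"
    by (rule has_weak_deriv_diff[OF W w1])
  have nw: "L2_norm a b (\<lambda>x. ?v x - ?u1 x) \<le> h * K2 + pi / h * E n"
  proof -
    have "(\<lambda>x. ?v x - ?u1 x) = (\<lambda>x. (?v x - PN a b N ?v x) + ?e1 x)" unfolding u1 by (simp add: algebra_simps)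
    then have "L2_norm a b (\<lambda>x. ?v x - ?u1 x) \<le> L2_norm a b (\<lambda>x. ?v x - PN a b N ?v x) + L2_norm a b ?e1"
      using L2_norm_add[OF L2_diff[OF has_weak_deriv_L2(2)[OF W] PN_L2] trig_L2[OF finite_freqs]] by simp
    moreover have "L2_norm a b (\<lambda>x. ?v x - PN a b N ?v x) \<le> h * K2"
      using Hper_2_PN_error(2)[OF ab \<psi>_Hper[OF tr] N] mult_left_mono[OF wderiv2_\<psi>_norm_le[OF tr], of h] h_pos
      unfolding h(1)[symmetric] by linarith
    ultimately show ?thesis using error_derivative_le(1)[of n] by linarith
  qed
  have Eh: "E n / h \<le> C * (1 + Ct) * (S + h * H)"
  proof -
    have "E n / h \<le> C * (q + p) / h" using En' h_pos by (intro divide_right_mono) auto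
    also have "\<dots> = C * (h * H + p / h)" using h_pos by (simp add: q_def field_simps power2_eq_square)
    also have "\<dots> \<le> C * ((1 + Ct) * (h * H) + (1 + Ct) * S)"
    proof (intro mult_left_mono add_mono C)
      have "0 \<le> Ct * (h * H)" using Ct h_pos by simp
      then show "h * H \<le> (1 + Ct) * (h * H)" by (simp add: algebra_simps)
      \<comment> \<open>Only half of the restriction is spent: (p / h)^2 is p times p / h^2, hence
        at most Ct p, and p \<le> \<tau> |ln \<tau>|^2. This is the origin of the square root of
        \<tau> in the H1 estimate.\<close>
      show "p / h \<le> (1 + Ct) * S"
      proof (rule power2_le_imp_le)
        have "(p / h)\<^sup>2 = p * (p / h\<^sup>2)" by (simp add: power_divide power2_eq_square)
        also have "\<dots> \<le> p * Ct"
          using cfl'(2) h_pos p0 by (intro mult_left_mono) (simp_all add: p_def pos_divide_le_eq)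
        also have "\<dots> \<le> S\<^sup>2 * (1 + Ct)\<^sup>2"
        proof (rule mult_mono)
          show "p \<le> S\<^sup>2" using p2 \<tau> by (simp add: S_def power_mult_distrib)
          show "Ct \<le> (1 + Ct)\<^sup>2" using Ct by (simp add: power2_eq_square algebra_simps)
        qed (use Ct in auto)
        finally show "(p / h)\<^sup>2 \<le> ((1 + Ct) * S)\<^sup>2" by (simp add: power_mult_distrib mult.commute)
      qed (use Ct S0 in simp)
    qed
    finally show ?thesis by (simp add: algebra_simps)
  qed
  have "Hsob_norm a b 1 (\<lambda>x. \<psi> (t n) x - u n x) \<le> L2_norm a b (\<lambda>x. \<psi> (t n) x - u n x) + L2_norm a b (\<lambda>x. ?v x - ?u1 x)"
    by (rule Hsob_norm_le(1)[OF ab ww])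
  also have "\<dots> \<le> (C + K2) * (q + p) + (h * K2 + pi / h * E n)"
    using L2 nw by (rule add_mono)
  also have "\<dots> \<le> (C + K2) * (S + h * H) + (K2 * (S + h * H) + pi\<^sup>2 * C * (1 + Ct) * (S + h * H))"
  proof (intro add_mono)
    show "(C + K2) * (q + p) \<le> (C + K2) * (S + h * H)"
      using C K2 pS qh by (intro mult_left_mono) auto
    have "h * 1 \<le> h * H" using H1 h_pos by (intro mult_left_mono) auto
    then have "h \<le> S + h * H" using S0 by linarith
    then show "h * K2 \<le> K2 * (S + h * H)" using K2 mult_right_mono[of h "S + h * H" K2] by (simp add: mult.commute)
    have "pi / h * E n = pi * (E n / h)" by simp
    also have "\<dots> \<le> pi\<^sup>2 * (C * (1 + Ct) * (S + h * H))"
      using Eh pi2 E_nonneg h_pos by (intro mult_mono) auto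
    finally show "pi / h * E n \<le> pi\<^sup>2 * C * (1 + Ct) * (S + h * H)" by (simp add: mult.assoc)
  qed
  also have "\<dots> = (C + 2 * K2 + pi\<^sup>2 * C * (1 + Ct)) * (S + h * H)" by (simp add: algebra_simps)
  also have "\<dots> \<le> C' * (S + h * H)"
  proof (rule mult_right_mono)
    show "C + 2 * K2 + pi\<^sup>2 * C * (1 + Ct) \<le> C'"
      unfolding C'_eq Z_def[symmetric] using A K2 Z by simp
  qed (use S0 h_pos in simp)
  finally show "Hsob_norm a b 1 (\<lambda>x. \<psi> (t n) x - u n x) \<le> C' * (sqrt \<tau> * \<bar>ln \<tau>\<bar> + h * H)"
    by (simp add: S_def)
qed

end

theorem theorem1:
  fixes a b lam T M :: real
  assumes "a < b" and "0 < T"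
  shows "\<exists>\<tau>0 h0. 0 < \<tau>0 \<and> \<tau>0 < exp (- 1) \<and> 0 < h0 \<and> h0 < exp (- 1) \<and>
    (\<forall>(V :: real \<Rightarrow> real) (\<psi>0 :: real \<Rightarrow> complex)
       (\<psi> :: real \<Rightarrow> real \<Rightarrow> complex) (\<psi>t :: real \<Rightarrow> real \<Rightarrow> complex).
      V \<in> Linf a b \<and> logSE_solution a b T V lam \<psi>0 \<psi> \<psi>t \<and>
      data_bound a b T V \<psi> \<psi>t = ereal M \<longrightarrow>
      (\<forall>Ct>0. \<exists>C>0. \<forall>(N::nat) (h::real) (\<tau>::real) (n::nat).
        0 < N \<and> even N \<and> h = (b - a) / real N \<and> h < h0 \<and> 0 < \<tau> \<and> \<tau> < \<tau>0 \<and>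
        \<tau> * \<bar>ln \<tau>\<bar> \<le> Ct * h\<^sup>2 / \<bar>ln h\<bar> \<and> real n \<le> T / \<tau> \<longrightarrow>
          L2_norm a b (\<lambda>x. \<psi> (real n * \<tau>) x - ewi_fs a b V lam \<psi>0 N \<tau> n x)
            \<le> C * (\<tau> * \<bar>ln \<tau>\<bar>\<^sup>2 + h\<^sup>2 * \<bar>ln h\<bar>) \<and>
          Hsob_norm a b 2 (ewi_fs a b V lam \<psi>0 N \<tau> n) \<le> C * \<bar>ln h\<bar> \<and>
          Hsob_norm a b 1 (\<lambda>x. \<psi> (real n * \<tau>) x - ewi_fs a b V lam \<psi>0 N \<tau> n x)
            \<le> C * (sqrt \<tau> * \<bar>ln \<tau>\<bar> + h * \<bar>ln h\<bar>)))"
\<comment> \<open>The argument uses that \<open>h\<close> and \<tau> lie below exp (-1), where both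
  logarithms have modulus at least 1; \<open>exp (- 2)\<close> is a positive value strictly below
  it.\<close>
proof (rule exI[of _ "exp (- 2)"], rule exI[of _ "exp (- 2)"], intro conjI allI impI)
  show "(0::real) < exp (- 2)" "exp (- 2) < exp (- 1 :: real)" by simp_all
  show "(0::real) < exp (- 2)" "exp (- 2) < exp (- 1 :: real)" by simp_all
  fix V :: "real \<Rightarrow> real" and \<psi>0 :: "real \<Rightarrow> complex" and \<psi> \<psi>t :: "real \<Rightarrow> real \<Rightarrow> complex" and Ct :: real
  assume A: "V \<in> Linf a b \<and> logSE_solution a b T V lam \<psi>0 \<psi> \<psi>t \<and> data_bound a b T V \<psi> \<psi>t = ereal M"
    and Ct: "0 < Ct"
  interpret logSE a b lam T M V \<psi>0 \<psi> \<psi>t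
    using assms A by unfold_locales auto
  \<comment> \<open>Fixed before \<open>N\<close>, \<open>h\<close>, \<tau> and n: the constant
    depends only on the coefficients of the recursion and on \<open>T\<close>, so it is uniform over
    all discretizations with the same \<open>Ct\<close>.\<close>
  obtain C where C: "0 < C"
    "\<And>\<tau> q p E n. 0 < \<tau> \<Longrightarrow> \<tau> \<le> 1 \<Longrightarrow> 0 \<le> q \<Longrightarrow> q \<le> 1 \<Longrightarrow> 0 \<le> p \<Longrightarrow> p \<le> 1 \<Longrightarrow> E 0 = 0 \<Longrightarrow> (\<And>n. 0 \<le> E n) \<Longrightarrow>
      (\<And>n. real (Suc n) * \<tau> \<le> T \<Longrightarrow>
        (E (Suc n))\<^sup>2 \<le> (1 + \<tau>) * ((E n)\<^sup>2 + \<tau> * (L0 Ct * (1 + ln (m0 + E n) + \<tau> * (ln (m0 + E n))\<^sup>2)) * (E n + k0 * q)\<^sup>2)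
          + 2 * \<tau> * (Kp * p)\<^sup>2) \<Longrightarrow>
      real n * \<tau> \<le> T \<Longrightarrow> E n \<le> C * (q + p)"
    by (rule discrete_osgood_gronwall[of "L0 Ct" k0 m0 T Kp])
      (use constants_nonneg Ct \<open>0 < T\<close> in \<open>auto intro: order_trans[of 0 1]\<close>)
  define C' where "C' = C + 2 * K2 + 2 * (M * sqrt (b - a) + K2) + 3 * pi\<^sup>2 * C * (1 + Ct) + 1"
  have C': "0 < C'"
    unfolding C'_def using M_nonneg ab C(1) Ct K2_nonneg by (intro add_nonneg_pos add_nonneg_nonneg) auto
  show "\<exists>C>0. \<forall>(N::nat) (h::real) (\<tau>::real) (n::nat).
        0 < N \<and> even N \<and> h = (b - a) / real N \<and> h < exp (- 2) \<and> 0 < \<tau> \<and> \<tau> < exp (- 2) \<and>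
        \<tau> * \<bar>ln \<tau>\<bar> \<le> Ct * h\<^sup>2 / \<bar>ln h\<bar> \<and> real n \<le> T / \<tau> \<longrightarrow>
          L2_norm a b (\<lambda>x. \<psi> (real n * \<tau>) x - ewi_fs a b V lam \<psi>0 N \<tau> n x)
            \<le> C * (\<tau> * \<bar>ln \<tau>\<bar>\<^sup>2 + h\<^sup>2 * \<bar>ln h\<bar>) \<and>
          Hsob_norm a b 2 (ewi_fs a b V lam \<psi>0 N \<tau> n) \<le> C * \<bar>ln h\<bar> \<and>
          Hsob_norm a b 1 (\<lambda>x. \<psi> (real n * \<tau>) x - ewi_fs a b V lam \<psi>0 N \<tau> n x)
            \<le> C * (sqrt \<tau> * \<bar>ln \<tau>\<bar> + h * \<bar>ln h\<bar>)"
  proof (rule exI[of _ C'], rule conjI[OF C'], intro allI impI)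
    fix N :: nat and h \<tau> :: real and n :: nat
    assume B: "0 < N \<and> even N \<and> h = (b - a) / real N \<and> h < exp (- 2) \<and> 0 < \<tau> \<and> \<tau> < exp (- 2) \<and>
        \<tau> * \<bar>ln \<tau>\<bar> \<le> Ct * h\<^sup>2 / \<bar>ln h\<bar> \<and> real n \<le> T / \<tau>"
    have e: "exp (- 2) < exp (- 1 :: real)" by simp
    have n: "real n * \<tau> \<le> T"
    proof -
      have "0 < \<tau>" "real n \<le> T / \<tau>" using B by blast+
      then show ?thesis by (simp add: pos_le_divide_eq)
    qed
    interpret ewi a b lam T M V \<psi>0 \<psi> \<psi>t N h \<tau> Ct
      using B Ct e by unfold_locales (auto intro: less_trans)
    \<comment> \<open>The discrete lemma with q = h^2 |ln h| and p = \<tau> |ln \<tau>|, both at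
      most 1.\<close>
    have "E n \<le> C * (h\<^sup>2 * \<bar>ln h\<bar> + \<tau> * \<bar>ln \<tau>\<bar>)"
      by (rule C(2)[OF \<tau>(1) \<tau>_small(1) q_bounds(4,2) _ \<tau>_small(4) E_0 E_nonneg error_recursion n])
        (use \<tau> in simp_all)
    from final_estimates[OF n less_imp_le[OF C(1)] this]
    show "L2_norm a b (\<lambda>x. \<psi> (real n * \<tau>) x - ewi_fs a b V lam \<psi>0 N \<tau> n x)
            \<le> C' * (\<tau> * \<bar>ln \<tau>\<bar>\<^sup>2 + h\<^sup>2 * \<bar>ln h\<bar>) \<and>
          Hsob_norm a b 2 (ewi_fs a b V lam \<psi>0 N \<tau> n) \<le> C' * \<bar>ln h\<bar> \<and>
          Hsob_norm a b 1 (\<lambda>x. \<psi> (real n * \<tau>) x - ewi_fs a b V lam \<psi>0 N \<tau> n x)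
            \<le> C' * (sqrt \<tau> * \<bar>ln \<tau>\<bar> + h * \<bar>ln h\<bar>)"
      by (simp add: C'_def)
  qed
qed

end
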